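(* Let $(\mathcal P_t)_{t\ge0}$ be a decohering QMS on $\mathcal B(\mathcal H)$ which is reversible, and assume that for some $2<p\le\infty$ there exist $t_p,M_p>0$ such that $\|\mathcal P_{t_p}(X)\|_{(2,p),\mathcal N}\le M_p\|X\|_{2,\sigma_{\mathrm{Tr}}}$ for all positive semidefinite $X$. Then $\mathrm{LSI}_{2,\mathcal N}\big(\frac{p\,t_p}{p-2},\frac{p}{p-2}\ln M_p\big)$ holds (with $\frac{p}{p-2}:=1$ when $p=\infty$).
   Context: $\mathcal H$ finite-dimensional of dimension $d_{\mathcal H}$; QMS $\mathcal P_t=e^{t\mathcal L}$ (unital completely positive maps), decohering = has a full-rank invariant state; $\mathcal N$ its decoherence-free algebra ($X$ with $\mathcal P_t(X^*X)=\mathcal P_t(X)^*\mathcal P_t(X)$, $\mathcal P_t(XX^* )=\mathcal P_t(X)\mathcal P_t(X)^*$ for all $t$), $E_{\mathcal N}$ the unique conditional expectation onto $\mathcal N$ with $\mathcal P_t(X-E_{\mathcal N}[X])\to0$, $E_{\mathcal N*}$ its predual, $\sigma_{\mathrm{Tr}}=E_{\mathcal N*}(\mathbb I/d_{\mathcal H})$. $\Gamma^s(X)=\sigma_{\mathrm{Tr}}^{s/2}X\sigma_{\mathrm{Tr}}^{s/2}$, $\|X\|_{p,\sigma_{\mathrm{Tr}}}=\|\Gamma^{1/p}(X)\|_p$ (Schatten), $\langle X,Y\rangle_{\sigma_{\mathrm{Tr}}}=\mathrm{Tr}[\sigma_{\mathrm{Tr}}^{1/2}X^*\sigma_{\mathrm{Tr}}^{1/2}Y]$;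 reversible means $\mathcal L$ is self-adjoint for this inner product. For $1\le a\le b\le\infty$, $1/r=1/a-1/b$: $\|X\|_{(a,b),\mathcal N}=\inf\{\|A\|_{2r,\sigma_{\mathrm{Tr}}}\|B\|_{2r,\sigma_{\mathrm{Tr}}}\|Y\|_{b,\sigma_{\mathrm{Tr}}}:A,B\in\mathcal N,X=AYB\}$. $\mathcal E_{2,\mathcal L}(X)=-\langle X,\mathcal L X\rangle_{\sigma_{\mathrm{Tr}}}$; with $Z=\Gamma^{1/2}(X)$, $\mathrm{Ent}_{2,\mathcal N}(X)=\mathrm{Tr}[Z^2(\ln Z-\frac12\ln E_{\mathcal N}[\sigma_{\mathrm{Tr}}^{-1/2}Z^2\sigma_{\mathrm{Tr}}^{-1/2}]-\frac12\ln\sigma_{\mathrm{Tr}})]$. $\mathrm{LSI}_{2,\mathcal N}(c,d)$: $\mathrm{Ent}_{2,\mathcal N}(X)\le c\,\mathcal E_{2,\mathcal L}(X)+d\|X\|^2_{2,\sigma_{\mathrm{Tr}}}$ for all $X>0$. *)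

theory Defs
  imports "Jordan_Normal_Form.Matrix" "HOL-Library.Extended_Real"
begin

definition adj :: "complex mat \<Rightarrow> complex mat" where
  "adj A = mat (dim_col A) (dim_row A) (\<lambda>(i,j). cnj (A $$ (j,i)))"

definition tr :: "complex mat \<Rightarrow> complex" where
  "tr A = (\<Sum>i<dim_row A. A $$ (i,i))"

definition cinner :: "complex vec \<Rightarrow> complex vec \<Rightarrow> complex" where
  "cinner v w = (\<Sum>i<dim_vec v. cnj (v $ i) * w $ i)"

definition vnorm :: "complex vec \<Rightarrow> real" where
  "vnorm v = sqrt (\<Sum>i<dim_vec v. (cmod (v $ i))\<^sup>2)"

definition psd :: "nat \<Rightarrow> complex mat \<Rightarrow> bool" where
  "psd n A \<longleftrightarrow> A \<in> carrier_mat n n \<and> A = adj A \<and>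
     (\<forall>v\<in>carrier_vec n. Im (cinner v (A *\<^sub>v v)) = 0 \<and> 0 \<le> Re (cinner v (A *\<^sub>v v)))"

definition pd :: "nat \<Rightarrow> complex mat \<Rightarrow> bool" where
  "pd n A \<longleftrightarrow> psd n A \<and> (\<forall>v\<in>carrier_vec n. v \<noteq> 0\<^sub>v n \<longrightarrow> 0 < Re (cinner v (A *\<^sub>v v)))"

definition unitary :: "nat \<Rightarrow> complex mat \<Rightarrow> bool" where
  "unitary n U \<longleftrightarrow> U \<in> carrier_mat n n \<and> adj U * U = 1\<^sub>m n"

definition spec_decomp :: "complex mat \<Rightarrow> complex mat \<times> (nat \<Rightarrow> real) \<Rightarrow> bool" where
  "spec_decomp A p \<longleftrightarrow> unitary (dim_row A) (fst p) \<and>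
     A = fst p * mat_diag (dim_row A) (\<lambda>i. complex_of_real (snd p i)) * adj (fst p)"

definition mfun :: "(real \<Rightarrow> real) \<Rightarrow> complex mat \<Rightarrow> complex mat" where
  "mfun f A = (let p = (SOME p. spec_decomp A p)
     in fst p * mat_diag (dim_row A) (\<lambda>i. complex_of_real (f (snd p i))) * adj (fst p))"

definition mpow :: "real \<Rightarrow> complex mat \<Rightarrow> complex mat" where
  "mpow s A = mfun (\<lambda>x. x powr s) A"

definition mln :: "complex mat \<Rightarrow> complex mat" where
  "mln A = mfun ln A"

definition mabs :: "complex mat \<Rightarrow> complex mat" where
  "mabs X = mpow (1/2) (adj X * X)"

definition opnorm :: "complex mat \<Rightarrow> real" where
  "opnorm X = Sup {vnorm (X *\<^sub>v v) | v. v \<in> carrier_vec (dim_col X) \<and> vnorm v \<le> 1}"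

definition schatten :: "ereal \<Rightarrow> complex mat \<Rightarrow> real" where
  "schatten p X = (if p = \<infinity> then opnorm X
     else (Re (tr (mpow (real_of_ereal p) (mabs X)))) powr (1 / real_of_ereal p))"

definition einv :: "ereal \<Rightarrow> real" where
  "einv p = (if p = \<infinity> then 0 else 1 / real_of_ereal p)"

definition lin_map :: "nat \<Rightarrow> (complex mat \<Rightarrow> complex mat) \<Rightarrow> bool" where
  "lin_map n \<Phi> \<longleftrightarrow> (\<forall>X\<in>carrier_mat n n. \<Phi> X \<in> carrier_mat n n) \<and>
     (\<forall>X\<in>carrier_mat n n. \<forall>Y\<in>carrier_mat n n. \<forall>c. \<Phi> (c \<cdot>\<^sub>m X + Y) = c \<cdot>\<^sub>m \<Phi> X + \<Phi> Y)"

definition blockmat :: "nat \<Rightarrow> nat \<Rightarrow> (nat \<Rightarrow> nat \<Rightarrow> complex mat) \<Rightarrow> complex mat" where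
  "blockmat m n B = mat (m*n) (m*n) (\<lambda>(i,j). B (i div n) (j div n) $$ (i mod n, j mod n))"

definition cp_map :: "nat \<Rightarrow> (complex mat \<Rightarrow> complex mat) \<Rightarrow> bool" where
  "cp_map n \<Phi> \<longleftrightarrow> (\<forall>m B. (\<forall>i<m. \<forall>j<m. B i j \<in> carrier_mat n n) \<longrightarrow>
     psd (m*n) (blockmat m n B) \<longrightarrow> psd (m*n) (blockmat m n (\<lambda>i j. \<Phi> (B i j))))"

definition ucp :: "nat \<Rightarrow> (complex mat \<Rightarrow> complex mat) \<Rightarrow> bool" where
  "ucp n \<Phi> \<longleftrightarrow> lin_map n \<Phi> \<and> \<Phi> (1\<^sub>m n) = 1\<^sub>m n \<and> cp_map n \<Phi>"

definition sg :: "(complex mat \<Rightarrow> complex mat) \<Rightarrow> real \<Rightarrow> complex mat \<Rightarrow> complex mat" where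
  "sg L t X = mat (dim_row X) (dim_col X)
     (\<lambda>(i,j). \<Sum>k. complex_of_real (t ^ k / fact k) * ((L ^^ k) X) $$ (i,j))"

definition qms :: "nat \<Rightarrow> (complex mat \<Rightarrow> complex mat) \<Rightarrow> bool" where
  "qms n L \<longleftrightarrow> lin_map n L \<and> (\<forall>t\<ge>0. ucp n (sg L t))"

definition decohering :: "nat \<Rightarrow> (complex mat \<Rightarrow> complex mat) \<Rightarrow> bool" where
  "decohering n L \<longleftrightarrow> (\<exists>\<rho>. pd n \<rho> \<and> tr \<rho> = 1 \<and>
     (\<forall>t\<ge>0. \<forall>X\<in>carrier_mat n n. tr (\<rho> * sg L t X) = tr (\<rho> * X)))"

definition dfa :: "nat \<Rightarrow> (complex mat \<Rightarrow> complex mat) \<Rightarrow> complex mat set" where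
  "dfa n L = {X \<in> carrier_mat n n. \<forall>t\<ge>0.
      sg L t (adj X * X) = adj (sg L t X) * sg L t X \<and>
      sg L t (X * adj X) = sg L t X * adj (sg L t X)}"

definition cond_exp :: "nat \<Rightarrow> complex mat set \<Rightarrow> (complex mat \<Rightarrow> complex mat) \<Rightarrow> bool" where
  "cond_exp n N E \<longleftrightarrow> lin_map n E \<and> (\<forall>X\<in>carrier_mat n n. E X \<in> N) \<and> (\<forall>A\<in>N. E A = A) \<and>
     (\<forall>X. psd n X \<longrightarrow> psd n (E X)) \<and>
     (\<forall>A\<in>N. \<forall>B\<in>N. \<forall>X\<in>carrier_mat n n. E (A * X * B) = A * E X * B)"

text \<open>E_N: the unique conditional expectation onto N with P_t(X - E_N X) \<rightarrow> 0
  (normalised to 0 outside B(H) so that it is unique as a HOL function)\<close>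
definition EN :: "nat \<Rightarrow> (complex mat \<Rightarrow> complex mat) \<Rightarrow> complex mat \<Rightarrow> complex mat" where
  "EN n L = (THE E. cond_exp n (dfa n L) E \<and> (\<forall>X. X \<notin> carrier_mat n n \<longrightarrow> E X = 0\<^sub>m n n) \<and>
     (\<forall>X\<in>carrier_mat n n. \<forall>i<n. \<forall>j<n.
        ((\<lambda>t. sg L t (X - E X) $$ (i,j)) \<longlongrightarrow> 0) at_top))"

text \<open>sigma_Tr = E_N*(I/d), E_N* the predual w.r.t. the trace pairing\<close>
definition sigTr :: "nat \<Rightarrow> (complex mat \<Rightarrow> complex mat) \<Rightarrow> complex mat" where
  "sigTr n L = (THE \<sigma>. \<sigma> \<in> carrier_mat n n \<and>
     (\<forall>X\<in>carrier_mat n n. tr (\<sigma> * X) = tr ((1 / of_nat n) \<cdot>\<^sub>m 1\<^sub>m n * EN n L X)))"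

definition Gam :: "nat \<Rightarrow> (complex mat \<Rightarrow> complex mat) \<Rightarrow> real \<Rightarrow> complex mat \<Rightarrow> complex mat" where
  "Gam n L s X = mpow (s/2) (sigTr n L) * X * mpow (s/2) (sigTr n L)"

definition wnorm :: "nat \<Rightarrow> (complex mat \<Rightarrow> complex mat) \<Rightarrow> ereal \<Rightarrow> complex mat \<Rightarrow> real" where
  "wnorm n L p X = schatten p (Gam n L (einv p) X)"

definition winner :: "nat \<Rightarrow> (complex mat \<Rightarrow> complex mat) \<Rightarrow> complex mat \<Rightarrow> complex mat \<Rightarrow> complex" where
  "winner n L X Y = tr (mpow (1/2) (sigTr n L) * adj X * mpow (1/2) (sigTr n L) * Y)"

definition reversible :: "nat \<Rightarrow> (complex mat \<Rightarrow> complex mat) \<Rightarrow> bool" where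
  "reversible n L \<longleftrightarrow> (\<forall>X\<in>carrier_mat n n. \<forall>Y\<in>carrier_mat n n. winner n L X (L Y) = winner n L (L X) Y)"

text \<open>the (a,b),N norm; 2r with 1/r = 1/a - 1/b (2r = \<infinity> if a = b)\<close>
definition abnorm :: "nat \<Rightarrow> (complex mat \<Rightarrow> complex mat) \<Rightarrow> ereal \<Rightarrow> ereal \<Rightarrow> complex mat \<Rightarrow> real" where
  "abnorm n L a b X = (let q = (if einv a - einv b = 0 then \<infinity> else ereal (2 / (einv a - einv b)))
     in Inf {wnorm n L q A * wnorm n L q B * wnorm n L b Y | A B Y.
              A \<in> dfa n L \<and> B \<in> dfa n L \<and> Y \<in> carrier_mat n n \<and> X = A * Y * B})"

text \<open>Dirichlet form (real-valued on positive X for reversible L; we take the real part)\<close>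
definition dirichlet2 :: "nat \<Rightarrow> (complex mat \<Rightarrow> complex mat) \<Rightarrow> complex mat \<Rightarrow> real" where
  "dirichlet2 n L X = - Re (winner n L X (L X))"

definition ent2 :: "nat \<Rightarrow> (complex mat \<Rightarrow> complex mat) \<Rightarrow> complex mat \<Rightarrow> real" where
  "ent2 n L X = (let Z = Gam n L (1/2) X; \<sigma> = sigTr n L in
     Re (tr (Z * Z * (mln Z
        - (1/2) \<cdot>\<^sub>m mln (EN n L (mpow (-1/2) \<sigma> * (Z * Z) * mpow (-1/2) \<sigma>))
        - (1/2) \<cdot>\<^sub>m mln \<sigma>))))"

definition LSI2 :: "nat \<Rightarrow> (complex mat \<Rightarrow> complex mat) \<Rightarrow> real \<Rightarrow> real \<Rightarrow> bool" where
  "LSI2 n L c d \<longleftrightarrow> (\<forall>X. pd n X \<longrightarrow>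
     ent2 n L X \<le> c * dirichlet2 n L X + d * (wnorm n L 2 X)\<^sup>2)"

definition pfac :: "ereal \<Rightarrow> real" where
  "pfac p = (if p = \<infinity> then 1 else real_of_ereal p / (real_of_ereal p - 2))"

end

theory Submission
  imports "HOL-Complex_Analysis.Conformal_Mappings" "Jordan_Normal_Form.Determinant" Defs
begin

text \<open>
  Write \<open>\<kappa> = 1 - 2/p\<close>, \<open>Z = \<sigma>\<^sup>1\<^sup>/\<^sup>4 X \<sigma>\<^sup>1\<^sup>/\<^sup>4\<close>, \<open>R = E(\<sigma>\<^sup>-\<^sup>1\<^sup>/\<^sup>2 Z\<^sup>2 \<sigma>\<^sup>-\<^sup>1\<^sup>/\<^sup>2)\<close> and \<open>D = \<sigma> R\<close>; the two factors of
  \<open>D\<close> commute because \<open>\<sigma>\<close> commutes with \<open>N\<close>. Reversibility makes the semigroup, transported by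
  \<open>Y \<mapsto> \<sigma>\<^sup>1\<^sup>/\<^sup>4 Y \<sigma>\<^sup>1\<^sup>/\<^sup>4\<close>, self-adjoint for the Hilbert-Schmidt inner product, so that it
  extends to complex times: \<open>V(z) = e\<^bsup>ztL\<^esup> Z\<close>. The function
  \<open>F(z) = Tr (Z\<^bsup>1+\<kappa>z\<^esup> D\<^bsup>-\<kappa>z/4\<^esup> V(z) D\<^bsup>-\<kappa>z/4\<^esup>)\<close> satisfies \<open>F(0) = Tr Z\<^sup>2\<close>, and its derivative at \<open>0\<close> is \<open>\<kappa>\<close>
  times the entropy minus \<open>t\<close> times the Dirichlet form. Since \<open>|F| \<le> Tr Z\<^sup>2\<close> on \<open>Re z = 0\<close>
  and, by the hypothesis, \<open>|F| \<le> M Tr Z\<^sup>2\<close> on \<open>Re z = 1\<close>, the three lines theorem gives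
  \<open>F(\<theta>) \<le> M\<^sup>\<theta> Tr Z\<^sup>2\<close>; comparing derivatives at \<open>\<theta> = 0\<close> yields the inequality.

  On the line \<open>Re z = 1\<close> the duality between the \<open>(2,p)\<close> norm and the powers of \<open>Z\<close> and \<open>D\<close> is a
  second application of the three lines theorem, between the Cauchy-Schwarz inequality and the
  case \<open>p = \<infinity>\<close>, where it rests on \<open>Tr (Z\<^sup>2 A) = Tr (D A)\<close> for \<open>A\<close> in \<open>N\<close>.

  The matrix \<open>\<sigma>\<close> is only defined through \<open>E\<close>, so \<open>E\<close> has to be constructed without reversibility:
  it is a limit point of the semigroup along times tending to infinity.
\<close>

text \<open>The \<open>(2,p)\<close> norm is an infimum over factorisations and offers no direct
  derivative in \<open>p\<close>; the inequality is therefore read off from a scalar entire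
  function. The exponents in \<open>F\<close> are dictated by the entropy: the two powers of
  \<open>D\<close> together carry \<open>-\<kappa>z/2\<close>, and
  \<open>ln D = ln \<sigma> + ln R\<close> because the factors commute, so one derivative yields
  exactly the two subtracted logarithms. On \<open>Re z = 0\<close> all varying powers are
  imaginary, hence contractions, and the transported semigroup is an isometry; this is what
  self-adjointness provides. The obstacle is the line \<open>Re z = 1\<close>. The hypothesis speaks
  of positive matrices, whereas \<open>V\<close> takes values that are not self-adjoint; complete
  positivity bridges this gap. Moreover the factors \<open>a, Y, b\<close> of a factorisation are
  arbitrary, so they have no complex powers of their own. They are replaced by families
  \<open>a(a*a)^u\<close>, which pass through \<open>a\<close>, stay in \<open>N\<close> with
  \<open>a\<close>, and are partial isometries for \<open>Re u = -1/2\<close>.\<close>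

unbundle no vec_syntax
no_notation fps_nth (infixl "$" 75)
declare index_mult_mat(1) [simp del]
declare carrier_matI [rule del] and carrier_matD [rule del]
hide_const (open) Finite_Cartesian_Product.vec Finite_Cartesian_Product.mat Determinants.det
  Finite_Cartesian_Product.row Finite_Cartesian_Product.column
hide_type (open) Finite_Cartesian_Product.vec

section \<open>Square matrices of a fixed size\<close>

locale sqmat =
  fixes n :: nat
begin

abbreviation M :: "complex mat set" where "M \<equiv> carrier_mat n n"

lemma M_closed [simp]:
  "A \<in> M \<Longrightarrow> B \<in> M \<Longrightarrow> A * B \<in> M"
  "A \<in> M \<Longrightarrow> B \<in> M \<Longrightarrow> A + B \<in> M"
  "A \<in> M \<Longrightarrow> B \<in> M \<Longrightarrow> A - B \<in> M"
  "A \<in> M \<Longrightarrow> c \<cdot>\<^sub>m A \<in> M"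
  "A \<in> M \<Longrightarrow> adj A \<in> M"
  by (rule mult_carrier_mat add_carrier_mat minus_carrier_mat smult_carrier_mat | assumption
      | simp add: adj_def)+

lemma mult_ij: "A \<in> M \<Longrightarrow> B \<in> M \<Longrightarrow> i < n \<Longrightarrow> j < n \<Longrightarrow>
    (A * B) $$ (i,j) = (\<Sum>k<n. A $$ (i,k) * B $$ (k,j))"
  by (simp add: index_mult_mat scalar_prod_def atLeast0LessThan)

lemma add_ij: "A \<in> M \<Longrightarrow> B \<in> M \<Longrightarrow> i < n \<Longrightarrow> j < n \<Longrightarrow> (A + B) $$ (i,j) = A $$ (i,j) + B $$ (i,j)"
  by auto

lemma minus_ij: "A \<in> M \<Longrightarrow> B \<in> M \<Longrightarrow> i < n \<Longrightarrow> j < n \<Longrightarrow> (A - B) $$ (i,j) = A $$ (i,j) - B $$ (i,j)"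
  by auto

lemma smult_ij: "A \<in> M \<Longrightarrow> i < n \<Longrightarrow> j < n \<Longrightarrow> (c \<cdot>\<^sub>m A) $$ (i,j) = c * A $$ (i,j)"
  by auto

lemma adj_ij: "A \<in> M \<Longrightarrow> i < n \<Longrightarrow> j < n \<Longrightarrow> adj A $$ (i,j) = cnj (A $$ (j,i))"
  by (auto simp: adj_def)

lemma M_eqI: "A \<in> M \<Longrightarrow> B \<in> M \<Longrightarrow> (\<And>i j. i < n \<Longrightarrow> j < n \<Longrightarrow> A $$ (i,j) = B $$ (i,j)) \<Longrightarrow> A = B"
  by (intro eq_matI) auto

lemma minus_zeroD:
  assumes "A \<in> M" "B \<in> M" "A - B = 0\<^sub>m n n" shows "A = B"
proof (rule M_eqI[OF assms(1,2)])
  fix i j assume "i < n" "j < n"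
  then show "A $$ (i,j) = B $$ (i,j)"
    using minus_ij[OF assms(1,2), of i j] assms(3) by simp
qed

lemma M_assoc: "A \<in> M \<Longrightarrow> B \<in> M \<Longrightarrow> C \<in> M \<Longrightarrow> A * B * C = A * (B * C)"
  by (rule assoc_mult_mat)

lemma M_distrib:
  "A \<in> M \<Longrightarrow> B \<in> M \<Longrightarrow> C \<in> M \<Longrightarrow> A * (B + C) = A * B + A * C"
  "A \<in> M \<Longrightarrow> B \<in> M \<Longrightarrow> C \<in> M \<Longrightarrow> (A + B) * C = A * C + B * C"
  "A \<in> M \<Longrightarrow> B \<in> M \<Longrightarrow> C \<in> M \<Longrightarrow> A * (B - C) = A * B - A * C"
  "A \<in> M \<Longrightarrow> B \<in> M \<Longrightarrow> C \<in> M \<Longrightarrow> (A - B) * C = A * C - B * C"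
  by (auto simp: mult_add_distrib_mat add_mult_distrib_mat mult_minus_distrib_mat minus_mult_distrib_mat)

lemma M_smult:
  "A \<in> M \<Longrightarrow> B \<in> M \<Longrightarrow> A * (c \<cdot>\<^sub>m B) = c \<cdot>\<^sub>m (A * B)"
  "A \<in> M \<Longrightarrow> B \<in> M \<Longrightarrow> (c \<cdot>\<^sub>m A) * B = c \<cdot>\<^sub>m (A * B)"
  by (auto simp: mult_smult_distrib mult_smult_assoc_mat)

lemma M_one [simp]: "A \<in> M \<Longrightarrow> 1\<^sub>m n * A = A" "A \<in> M \<Longrightarrow> A * 1\<^sub>m n = A"
  by auto

lemma M_zero [simp]: "A \<in> M \<Longrightarrow> 0\<^sub>m n n * A = 0\<^sub>m n n" "A \<in> M \<Longrightarrow> A * 0\<^sub>m n n = 0\<^sub>m n n"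
  by (rule M_eqI; simp add: mult_ij)+

lemma tr_zero [simp]: "tr (0\<^sub>m n n) = 0"
  by (simp add: tr_def)

lemma adj_adj [simp]: "adj (adj A) = A"
  by (rule eq_matI) (auto simp: adj_def)

lemma adj_mult: "A \<in> M \<Longrightarrow> B \<in> M \<Longrightarrow> adj (A * B) = adj B * adj A"
  by (rule M_eqI) (simp_all add: adj_ij mult_ij mult.commute)

lemma adj_add: "A \<in> M \<Longrightarrow> B \<in> M \<Longrightarrow> adj (A + B) = adj A + adj B"
  by (rule M_eqI) (simp_all add: adj_ij add_ij)

lemma adj_minus: "A \<in> M \<Longrightarrow> B \<in> M \<Longrightarrow> adj (A - B) = adj A - adj B"
  by (rule M_eqI) (simp_all add: adj_ij minus_ij)

lemma adj_smult: "A \<in> M \<Longrightarrow> adj (c \<cdot>\<^sub>m A) = cnj c \<cdot>\<^sub>m adj A"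
  by (rule M_eqI) (simp_all add: adj_ij smult_ij)

lemma adj_one [simp]: "adj (1\<^sub>m n) = 1\<^sub>m n"
  by (rule M_eqI) (auto simp: adj_ij)

lemma adj_zero [simp]: "adj (0\<^sub>m n n) = 0\<^sub>m n n"
  by (rule M_eqI) (auto simp: adj_ij)

lemma tr_sum: "A \<in> M \<Longrightarrow> tr A = (\<Sum>i<n. A $$ (i,i))"
  by (auto simp: tr_def)

lemma tr_mult: "A \<in> M \<Longrightarrow> B \<in> M \<Longrightarrow> tr (A * B) = (\<Sum>i<n. \<Sum>j<n. A $$ (i,j) * B $$ (j,i))"
  by (simp add: tr_sum mult_ij)

lemma tr_comm: "A \<in> M \<Longrightarrow> B \<in> M \<Longrightarrow> tr (A * B) = tr (B * A)"
  unfolding tr_mult by (subst sum.swap) (simp add: mult.commute tr_mult)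

lemma tr_add: "A \<in> M \<Longrightarrow> B \<in> M \<Longrightarrow> tr (A + B) = tr A + tr B"
  by (simp add: tr_sum add_ij sum.distrib)

lemma tr_minus: "A \<in> M \<Longrightarrow> B \<in> M \<Longrightarrow> tr (A - B) = tr A - tr B"
  by (simp add: tr_sum minus_ij sum_subtractf)

lemma tr_smult: "A \<in> M \<Longrightarrow> tr (c \<cdot>\<^sub>m A) = c * tr A"
  by (simp add: tr_sum smult_ij sum_distrib_left)

lemma tr_adj: "A \<in> M \<Longrightarrow> tr (adj A) = cnj (tr A)"
  by (simp add: tr_sum adj_ij)

text \<open>The Hilbert-Schmidt norm. As an \<open>L2_set\<close> over index pairs it takes
  Cauchy-Schwarz from \<open>L2_set_mult_ineq\<close>.\<close>

definition nrm :: "complex mat \<Rightarrow> real" where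
  "nrm A = L2_set (\<lambda>x. cmod (A $$ x)) ({..<n} \<times> {..<n})"

lemma nrm_nonneg [simp]: "0 \<le> nrm A"
  by (simp add: nrm_def)

lemma nrm_sq: "(nrm A)\<^sup>2 = (\<Sum>i<n. \<Sum>j<n. (cmod (A $$ (i,j)))\<^sup>2)"
  unfolding nrm_def L2_set_def by (simp add: sum_nonneg sum.cartesian_product case_prod_beta)

lemma tr_adj_mult_self: "A \<in> M \<Longrightarrow> tr (adj A * A) = complex_of_real ((nrm A)\<^sup>2)"
  unfolding nrm_sq
  by (simp add: tr_mult adj_ij) (subst sum.swap, simp add: complex_norm_square[symmetric] mult.commute)

lemma nrm_adj: "A \<in> M \<Longrightarrow> nrm (adj A) = nrm A"
proof -
  assume A: "A \<in> M"
  have "(nrm (adj A))\<^sup>2 = (nrm A)\<^sup>2"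
    unfolding nrm_sq using A by (subst sum.swap) (simp add: adj_ij)
  then show ?thesis by simp
qed

lemma nrm_eq_0: "A \<in> M \<Longrightarrow> nrm A = 0 \<Longrightarrow> A = 0\<^sub>m n n"
proof (rule M_eqI)
  fix i j assume A: "A \<in> M" "nrm A = 0" and ij: "i < n" "j < n"
  then show "A $$ (i,j) = 0\<^sub>m n n $$ (i,j)"
    by (auto simp: nrm_def L2_set_eq_0_iff)
qed auto

lemma cmod_tr_mult_le: 
  assumes "A \<in> M" "B \<in> M" shows "cmod (tr (A * B)) \<le> nrm A * nrm B"
proof -
  have "cmod (tr (A * B)) \<le> (\<Sum>i<n. \<Sum>j<n. cmod (A $$ (i,j)) * cmod (adj B $$ (i,j)))"
    unfolding tr_mult[OF assms]
    by (intro sum_norm_le) (use assms in \<open>simp add: norm_mult adj_ij\<close>)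
  also have "\<dots> = (\<Sum>x\<in>{..<n}\<times>{..<n}. \<bar>cmod (A $$ x)\<bar> * \<bar>cmod (adj B $$ x)\<bar>)"
    by (simp add: sum.cartesian_product case_prod_beta)
  also have "\<dots> \<le> L2_set (\<lambda>x. cmod (A $$ x)) ({..<n}\<times>{..<n}) * L2_set (\<lambda>x. cmod (adj B $$ x)) ({..<n}\<times>{..<n})"
    by (rule L2_set_mult_ineq)
  also have "\<dots> = nrm A * nrm (adj B)"
    by (simp add: nrm_def case_prod_beta)
  finally show ?thesis using assms by (simp add: nrm_adj)
qed

lemma entry_le_nrm: "i < n \<Longrightarrow> j < n \<Longrightarrow> cmod (A $$ (i,j)) \<le> nrm A"
  unfolding nrm_def 
  using member_le_L2_set[of "{..<n}\<times>{..<n}" "(i,j)" "\<lambda>x. cmod (A $$ x)"] by auto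

lemma nrm_mult_le: "A \<in> M \<Longrightarrow> B \<in> M \<Longrightarrow> nrm (A * B) \<le> nrm A * nrm B"
proof -
  assume A: "A \<in> M" and B: "B \<in> M"
  have "(nrm (A * B))\<^sup>2 \<le> (nrm A * nrm B)\<^sup>2"
  proof -
    have ent: "(cmod ((A * B) $$ (i,j)))\<^sup>2 \<le> (\<Sum>k<n. (cmod (A $$ (i,k)))\<^sup>2) * (\<Sum>k<n. (cmod (B $$ (k,j)))\<^sup>2)"
      if "i < n" "j < n" for i j
    proof -
      have "cmod ((A * B) $$ (i,j)) \<le> (\<Sum>k<n. \<bar>cmod (A $$ (i,k))\<bar> * \<bar>cmod (B $$ (k,j))\<bar>)"
        using A B that by (auto simp: mult_ij norm_mult intro!: sum_norm_le)
      also have "\<dots> \<le> L2_set (\<lambda>k. cmod (A $$ (i,k))) {..<n} * L2_set (\<lambda>k. cmod (B $$ (k,j))) {..<n}"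
        by (rule L2_set_mult_ineq)
      finally have "(cmod ((A * B) $$ (i,j)))\<^sup>2 \<le> (L2_set (\<lambda>k. cmod (A $$ (i,k))) {..<n} * L2_set (\<lambda>k. cmod (B $$ (k,j))) {..<n})\<^sup>2"
        by (intro power_mono) auto
      then show ?thesis by (simp add: power_mult_distrib L2_set_def sum_nonneg)
    qed
    have "(nrm (A * B))\<^sup>2 \<le> (\<Sum>i<n. \<Sum>j<n. (\<Sum>k<n. (cmod (A $$ (i,k)))\<^sup>2) * (\<Sum>k<n. (cmod (B $$ (k,j)))\<^sup>2))"
      unfolding nrm_sq by (intro sum_mono ent) auto
    also have "\<dots> = (\<Sum>i<n. \<Sum>k<n. (cmod (A $$ (i,k)))\<^sup>2) * (\<Sum>j<n. \<Sum>k<n. (cmod (B $$ (k,j)))\<^sup>2)"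
      by (simp add: sum_product)
    also have "(\<Sum>j<n. \<Sum>k<n. (cmod (B $$ (k,j)))\<^sup>2) = (nrm B)\<^sup>2" unfolding nrm_sq by (rule sum.swap)
    finally show ?thesis by (simp add: nrm_sq[of A, symmetric] power_mult_distrib)
  qed
  then show ?thesis by (simp add: power2_le_iff_abs_le)
qed

subsection \<open>Positivity through traces\<close>

definition herm :: "complex mat \<Rightarrow> bool" where "herm A \<longleftrightarrow> A \<in> M \<and> adj A = A"

lemma hermD: "herm A \<Longrightarrow> A \<in> M" "herm A \<Longrightarrow> adj A = A" by (auto simp: herm_def)

lemma cinner_col:
  assumes "A \<in> M" "S \<in> M" "k < n"
  shows "cinner (col S k) (A *\<^sub>v col S k) = (adj S * A * S) $$ (k,k)"
proof -
  have "cinner (col S k) (A *\<^sub>v col S k) = (\<Sum>i<n. cnj (S $$ (i,k)) * (\<Sum>j<n. A $$ (i,j) * S $$ (j,k)))"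
    using assms by (auto simp: cinner_def scalar_prod_def atLeast0LessThan intro!: sum.cong)
  also have "\<dots> = (adj S * (A * S)) $$ (k,k)"
    using assms by (simp add: mult_ij adj_ij)
  finally show ?thesis using assms by (simp add: M_assoc)
qed

lemma tr_conj_cols:
  assumes "A \<in> M" "S \<in> M"
  shows "tr (adj S * A * S) = (\<Sum>k<n. cinner (col S k) (A *\<^sub>v col S k))"
  using assms by (subst tr_sum) (auto simp: cinner_col)

lemma cinner_as_tr:
  assumes "A \<in> M" "v \<in> carrier_vec n" 
  defines "S \<equiv> mat n n (\<lambda>(i,j). if j = 0 then v $ i else 0)"
  shows "cinner v (A *\<^sub>v v) = tr (adj S * A * S)"
proof (cases "n = 0")
  case True
  then show ?thesis using assms by (auto simp: cinner_def tr_def adj_def)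
next
  case False
  have S: "S \<in> M" by (auto simp: S_def)
  have c0: "col S 0 = v" using False assms by (auto simp: S_def)
  have ck: "cinner (col S k) (A *\<^sub>v col S k) = 0" if "k < n" "k \<noteq> 0" for k
    unfolding cinner_def using that by (intro sum.neutral) (auto simp: S_def)
  have "tr (adj S * A * S) = (\<Sum>k\<in>{..<n}. if k = 0 then cinner v (A *\<^sub>v v) else 0)"
    unfolding tr_conj_cols[OF assms(1) S] by (intro sum.cong) (auto simp: c0 ck)
  then show ?thesis using False by simp
qed

lemma tr_herm_real: "herm A \<Longrightarrow> S \<in> M \<Longrightarrow> Im (tr (adj S * A * S)) = 0"
proof -
  assume A: "herm A" "S \<in> M"
  then have "cnj (tr (adj S * A * S)) = tr (adj S * A * S)"
    by (subst tr_adj[symmetric]) (auto simp: adj_mult M_assoc hermD)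
  then show ?thesis by (auto simp: complex_eq_iff)
qed

text \<open>The trace sums the quadratic form over the columns of \<open>S\<close>, and a single
  vector is a matrix with one nonzero column. Positivity thereby becomes a statement inside the
  matrix algebra, where it combines with cyclicity of the trace.\<close>

lemma psd_iff: "psd n A \<longleftrightarrow> herm A \<and> (\<forall>S\<in>M. 0 \<le> Re (tr (adj S * A * S)))"
proof
  assume "psd n A"
  then show "herm A \<and> (\<forall>S\<in>M. 0 \<le> Re (tr (adj S * A * S)))"
    by (auto simp: psd_def herm_def tr_conj_cols intro!: sum_nonneg)
next
  assume r: "herm A \<and> (\<forall>S\<in>M. 0 \<le> Re (tr (adj S * A * S)))"
  have "Im (cinner v (A *\<^sub>v v)) = 0 \<and> 0 \<le> Re (cinner v (A *\<^sub>v v))" if "v \<in> carrier_vec n" for v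
    using r that cinner_as_tr[of A v] tr_herm_real by (auto simp: hermD)
  then show "psd n A" using r by (auto simp: psd_def hermD)
qed

lemma psdD: "psd n A \<Longrightarrow> A \<in> M" "psd n A \<Longrightarrow> adj A = A" "psd n A \<Longrightarrow> herm A"
  "psd n A \<Longrightarrow> S \<in> M \<Longrightarrow> 0 \<le> Re (tr (adj S * A * S))"
  unfolding psd_iff by (auto simp: hermD)

lemma pd_iff: "pd n A \<longleftrightarrow> herm A \<and> (\<forall>S\<in>M. S \<noteq> 0\<^sub>m n n \<longrightarrow> 0 < Re (tr (adj S * A * S)))"
proof
  assume pd: "pd n A"
  then have p: "psd n A" by (simp add: pd_def)
  have "0 < Re (tr (adj S * A * S))" if S: "S \<in> M" "S \<noteq> 0\<^sub>m n n" for S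
  proof -
    obtain i k where ik: "i < n" "k < n" "S $$ (i,k) \<noteq> 0"
      using S M_eqI[of S "0\<^sub>m n n"] by auto
    then have "col S k \<noteq> 0\<^sub>v n" using S
      by (metis carrier_matD(1) carrier_matD(2) index_col index_zero_vec(1))
    then have "0 < Re (cinner (col S k) (A *\<^sub>v col S k))"
      using pd col_carrier_vec[OF ik(2) S(1)] unfolding pd_def by blast
    moreover have "0 \<le> Re (cinner (col S j) (A *\<^sub>v col S j))" if "j < n" for j
      using p col_carrier_vec[OF that S(1)] unfolding psd_def by blast
    ultimately show ?thesis using S ik p
      by (auto simp: tr_conj_cols psdD intro!: sum_pos2[of _ k])
  qed
  then show "herm A \<and> (\<forall>S\<in>M. S \<noteq> 0\<^sub>m n n \<longrightarrow> 0 < Re (tr (adj S * A * S)))"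
    using p by (auto simp: psdD)
next
  assume r: "herm A \<and> (\<forall>S\<in>M. S \<noteq> 0\<^sub>m n n \<longrightarrow> 0 < Re (tr (adj S * A * S)))"
  have "0 \<le> Re (tr (adj S * A * S))" if "S \<in> M" for S
  proof (cases "S = 0\<^sub>m n n")
    case True
    then show ?thesis using hermD(1)[of A] r by simp
  next
    case False
    then show ?thesis using r that by force
  qed
  then have p: "psd n A" using r by (auto simp: psd_iff)
  have "0 < Re (cinner v (A *\<^sub>v v))" if v: "v \<in> carrier_vec n" "v \<noteq> 0\<^sub>v n" for v
  proof -
    define S where "S = mat n n (\<lambda>(i,j). if j = 0 then v $ i else 0)"
    obtain i where i: "i < n" "v $ i \<noteq> 0" using v by (metis carrier_vecD eq_vecI index_zero_vec)
    then have "S $$ (i,0) \<noteq> 0" by (auto simp: S_def)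
    then have "S \<noteq> 0\<^sub>m n n" using i by auto
    moreover have "S \<in> M" by (auto simp: S_def)
    ultimately show ?thesis using r cinner_as_tr[of A v] v by (auto simp: hermD S_def)
  qed
  then show "pd n A" using p by (auto simp: pd_def)
qed

lemma pdD: "pd n A \<Longrightarrow> psd n A" by (simp add: pd_def)

lemma psd_conj: assumes "psd n A" "B \<in> M" shows "psd n (adj B * A * B)"
  unfolding psd_iff
proof (intro conjI ballI)
  show "herm (adj B * A * B)" using assms by (auto simp: herm_def psdD adj_mult M_assoc)
next
  fix S assume S: "S \<in> M"
  then have "adj S * (adj B * A * B) * S = adj (B * S) * A * (B * S)"
    using assms by (simp add: psdD adj_mult M_assoc)
  then show "0 \<le> Re (tr (adj S * (adj B * A * B) * S))" using psdD(4)[OF assms(1), of "B * S"] assms S by auto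
qed

lemma psd_one: "psd n (1\<^sub>m n)"
  unfolding psd_iff by (auto simp: herm_def tr_adj_mult_self)

lemma psd_adj_mult: "B \<in> M \<Longrightarrow> psd n (adj B * B)"
  using psd_conj[OF psd_one, of B] by simp

end

section \<open>The spectral theorem\<close>

text \<open>The subsequence is thinned once per coordinate. It serves both the attained maximum of
  the Rayleigh quotient and the limit points of the semigroup.\<close>

lemma Bolzano_Weierstrass_finite:
  fixes x :: "nat \<Rightarrow> 'i \<Rightarrow> complex"
  assumes "finite I" "\<And>i. i \<in> I \<Longrightarrow> bounded (range (\<lambda>k. x k i))"
  shows "\<exists>r l. strict_mono r \<and> (\<forall>i\<in>I. (\<lambda>k. x (r k) i) \<longlonglongrightarrow> l i)"
  using assms
proof (induction I rule: finite_induct)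
  case empty
  show ?case using strict_mono_id by auto
next
  case (insert j I)
  then obtain r l where r: "strict_mono r" "\<forall>i\<in>I. (\<lambda>k. x (r k) i) \<longlonglongrightarrow> l i" by auto
  have "bounded (range (\<lambda>k. x (r k) j))"
    using insert.prems[of j] by (auto intro: bounded_subset)
  then obtain l' r' where r': "strict_mono r'" "((\<lambda>k. x (r k) j) \<circ> r') \<longlonglongrightarrow> l'"
    using bounded_imp_convergent_subsequence by blast
  have "strict_mono (r \<circ> r')" using r r' by (simp add: strict_mono_o)
  moreover have "(\<lambda>k. x ((r \<circ> r') k) i) \<longlonglongrightarrow> (l(j := l')) i" if "i \<in> insert j I" for i
    using that r' r(2) insert.hyps LIMSEQ_subseq_LIMSEQ[OF _ r'(1), of "\<lambda>k. x (r k) i" "l i"]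
    by (auto simp: o_def)
  ultimately show ?case by blast
qed

lemma cnj_mult_cmod: "cnj z * z = (complex_of_real (cmod z))\<^sup>2" "z * cnj z = (complex_of_real (cmod z))\<^sup>2"
  using complex_norm_square[of z] by (simp_all add: mult.commute)

text \<open>A real affine function of \<open>c\<close> that is bounded below has no linear part.
  This is the first-order condition both at the Rayleigh maximum and for the defect of the Schwarz
  inequality.\<close>

lemma complex_affine_nonneg_imp_zero:
  fixes b :: complex
  assumes "\<And>c. 0 \<le> a + 2 * Re (c * b)"
  shows "b = 0"
proof (rule ccontr)
  assume "b \<noteq> 0"
  \<comment> \<open>Chosen so that \<open>c = -t * cnj b\<close> gives
    \<open>2 * Re (c * b) = -(a + 1)\<close>, one less than the bound permits.\<close>
  define t where "t = (a + 1) / (2 * (cmod b)\<^sup>2)"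
  have "(- complex_of_real t * cnj b) * b = complex_of_real (- t * (cmod b)\<^sup>2)"
    by (simp add: mult.assoc cnj_mult_cmod)
  then have "Re ((- complex_of_real t * cnj b) * b) = - t * (cmod b)\<^sup>2"
    by (simp only: Re_complex_of_real)
  also have "\<dots> = - (a + 1) / 2" using \<open>b \<noteq> 0\<close> by (simp add: t_def field_simps)
  finally show False using assms[of "- complex_of_real t * cnj b"] by simp
qed

context sqmat
begin

section \<open>Vectors as functions, and the maximum of the Rayleigh quotient\<close>

definition ip :: "(nat \<Rightarrow> complex) \<Rightarrow> (nat \<Rightarrow> complex) \<Rightarrow> complex" where
  "ip f g = (\<Sum>i<n. cnj (f i) * g i)"

definition app :: "complex mat \<Rightarrow> (nat \<Rightarrow> complex) \<Rightarrow> nat \<Rightarrow> complex" where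
  "app A f i = (\<Sum>j<n. A $$ (i,j) * f j)"

lemma ip_lin:
  "ip f (\<lambda>i. g i + c * h i) = ip f g + c * ip f h"
  "ip (\<lambda>i. g i + c * h i) f = ip g f + cnj c * ip h f"
  by (simp_all add: ip_def algebra_simps sum.distrib sum_distrib_left)

lemma app_lin: "app A (\<lambda>i. g i + c * h i) = (\<lambda>i. app A g i + c * app A h i)"
  by (rule ext) (simp add: app_def algebra_simps sum.distrib sum_distrib_left)

lemma ip_cnj: "ip g f = cnj (ip f g)"
  by (simp add: ip_def mult.commute)

lemma ip_self: "ip f f = complex_of_real (\<Sum>i<n. (cmod (f i))\<^sup>2)"
  by (simp add: ip_def cnj_mult_cmod)

lemma ip_self_zero: "ip f f = 0 \<Longrightarrow> i < n \<Longrightarrow> f i = 0"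
  unfolding ip_self of_real_eq_0_iff by (subst (asm) sum_nonneg_eq_0_iff) auto

lemma ip_pos:
  assumes "ip f f \<noteq> 0" obtains s where "ip f f = complex_of_real s" "s > 0"
proof (rule that)
  show "ip f f = complex_of_real (\<Sum>i<n. (cmod (f i))\<^sup>2)" by (rule ip_self)
  then have "(\<Sum>i<n. (cmod (f i))\<^sup>2) \<noteq> 0" using assms by (metis of_real_0)
  moreover have "(\<Sum>i<n. (cmod (f i))\<^sup>2) \<ge> 0" by (intro sum_nonneg) auto
  ultimately show "(\<Sum>i<n. (cmod (f i))\<^sup>2) > 0" by simp
qed

lemma ip_herm: 
  assumes "herm A" shows "ip f (app A g) = cnj (ip g (app A f))"
proof -
  have *: "A $$ (i,j) = cnj (A $$ (j,i))" if "i < n" "j < n" for i j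
    using that assms adj_ij[of A i j] by (auto simp: herm_def)
  have "ip f (app A g) = (\<Sum>i<n. \<Sum>j<n. cnj (f i) * A $$ (i,j) * g j)"
    by (simp add: ip_def app_def sum_distrib_left mult.assoc)
  also have "\<dots> = (\<Sum>j<n. \<Sum>i<n. cnj (f i) * A $$ (i,j) * g j)" by (rule sum.swap)
  also have "\<dots> = (\<Sum>j<n. \<Sum>i<n. cnj (cnj (g j) * (A $$ (j,i) * f i)))"
    by (intro sum.cong refl) (subst *, auto)
  finally show ?thesis by (simp add: ip_def app_def sum_distrib_left)
qed

text \<open>The subspace is an orthogonal complement so that eigenvectors can be split off one by
  one; the quotient attains its maximum on its unit sphere. Stationarity says that
  \<open>A g - \<mu> g\<close> is orthogonal to the subspace, to which it belongs itself.\<close>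

lemma Rayleigh_maximum:
  assumes A: "herm A"
    and inv: "\<And>f. \<forall>k<m. ip (v k) f = 0 \<Longrightarrow> \<forall>k<m. ip (v k) (app A f) = 0"
    and f0: "\<forall>k<m. ip (v k) f0 = 0" "ip f0 f0 \<noteq> 0"
  shows "\<exists>g \<mu>::real. (\<forall>k<m. ip (v k) g = 0) \<and> ip g g = 1 \<and> (\<forall>i<n. app A g i = of_real \<mu> * g i)"
proof -
  define P where "P f \<longleftrightarrow> (\<forall>k<m. ip (v k) f = 0)" for f
  define h where "h f = Re (ip f (app A f))" for f
  define V where "V = h ` {f. P f \<and> ip f f = 1}"
  have scale: "P (\<lambda>i. c * f i)" "ip (\<lambda>i. c * f i) (\<lambda>i. c * f i) = of_real ((cmod c)\<^sup>2) * ip f f"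
    "h (\<lambda>i. c * f i) = (cmod c)\<^sup>2 * h f" if "P f" for c f
  proof -
    have 1: "ip g (\<lambda>i. c * f i) = c * ip g f" for g f by (simp add: ip_def sum_distrib_left algebra_simps)
    have 2: "ip (\<lambda>i. c * f i) g = cnj c * ip f g" for g f by (simp add: ip_def sum_distrib_left algebra_simps)
    have 3: "app A (\<lambda>i. c * f i) = (\<lambda>i. c * app A f i)"
      by (rule ext) (simp add: app_def sum_distrib_left algebra_simps)
    show "P (\<lambda>i. c * f i)" using that by (simp add: P_def 1)
    show "ip (\<lambda>i. c * f i) (\<lambda>i. c * f i) = of_real ((cmod c)\<^sup>2) * ip f f"
      by (simp add: 1 2 cnj_mult_cmod mult.assoc[symmetric])
    show "h (\<lambda>i. c * f i) = (cmod c)\<^sup>2 * h f"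
      unfolding h_def 1 2 3
      by (simp add: cnj_mult_cmod mult.assoc[symmetric] flip: of_real_power)
  qed
  have le1: "cmod (f i) \<le> 1" if "ip f f = 1" "i < n" for f i
  proof -
    have "(\<Sum>i<n. (cmod (f i))\<^sup>2) = 1" using that(1) unfolding ip_self by (metis of_real_eq_1_iff)
    moreover have "(cmod (f i))\<^sup>2 \<le> (\<Sum>i<n. (cmod (f i))\<^sup>2)" using that by (intro member_le_sum) auto
    ultimately show ?thesis using abs_square_le_1[of "cmod (f i)"] by simp
  qed
  have hb: "h f \<le> (\<Sum>i<n. \<Sum>j<n. cmod (A $$ (i,j)))" if "ip f f = 1" for f
  proof -
    have "h f \<le> cmod (ip f (app A f))" by (simp add: h_def complex_Re_le_cmod)
    also have "\<dots> \<le> (\<Sum>i<n. \<Sum>j<n. cmod (A $$ (i,j)))"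
      unfolding ip_def app_def sum_distrib_left
    proof (intro sum_norm_le)
      fix i j assume "i \<in> {..<n}" "j \<in> {..<n}"
      then have "cmod (f i) * (cmod (A $$ (i,j)) * cmod (f j)) \<le> 1 * (cmod (A $$ (i,j)) * 1)"
        using le1[OF that] by (intro mult_mono) auto
      then show "cmod (cnj (f i) * (A $$ (i,j) * f j)) \<le> cmod (A $$ (i,j))" by (simp add: norm_mult)
    qed
    finally show ?thesis .
  qed
  have ne: "V \<noteq> {}"
  proof -
    obtain s where s: "ip f0 f0 = complex_of_real s" "s > 0"
      using ip_pos[OF f0(2)] by blast
    have "P f0" using f0(1) by (simp add: P_def)
    from scale(1,2)[OF this, of "complex_of_real (1 / sqrt s)"] s
    have "\<exists>f. P f \<and> ip f f = 1"
      by (intro exI[of _ "\<lambda>i. complex_of_real (1 / sqrt s) * f0 i"]) (auto simp: norm_divide power_divide)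
    then show ?thesis by (auto simp: V_def)
  qed
  have bdd: "bdd_above V" using hb by (auto simp: V_def intro!: bdd_aboveI)
  define \<mu> where "\<mu> = Sup V"
  have "\<exists>f. P f \<and> ip f f = 1 \<and> \<mu> - 1 / real (Suc k) < h f" for k
  proof -
    have "\<mu> - 1 / real (Suc k) < Sup V" by (simp add: \<mu>_def)
    then obtain y where "y \<in> V" "\<mu> - 1 / real (Suc k) < y" using less_cSupD[OF ne] by blast
    then show ?thesis by (auto simp: V_def)
  qed
  then obtain F where F: "\<And>k. P (F k)" "\<And>k. ip (F k) (F k) = 1" "\<And>k. \<mu> - 1 / real (Suc k) < h (F k)"
    by metis
  have "bounded (range (\<lambda>k. F k i))" if "i \<in> {..<n}" for i
    using le1[OF F(2)] that by (auto simp: bounded_iff)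
  then obtain r g where r: "strict_mono r" and g: "\<And>i. i < n \<Longrightarrow> (\<lambda>k. F (r k) i) \<longlonglongrightarrow> g i"
    using Bolzano_Weierstrass_finite[of "{..<n}" F] by auto
  have Pg: "P g" unfolding P_def
  proof (intro allI impI)
    fix k assume k: "k < m"
    have "(\<lambda>j. ip (v k) (F (r j))) \<longlonglongrightarrow> ip (v k) g"
      unfolding ip_def by (intro tendsto_intros g) auto
    moreover have "ip (v k) (F (r j)) = 0" for j using F(1) k by (simp add: P_def)
    ultimately show "ip (v k) g = 0" by (simp add: LIMSEQ_const_iff)
  qed
  have g1: "ip g g = 1"
  proof -
    have "(\<lambda>j. ip (F (r j)) (F (r j))) \<longlonglongrightarrow> ip g g"
      unfolding ip_def by (intro tendsto_intros g) auto
    then show ?thesis by (simp add: F LIMSEQ_const_iff)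
  qed
  have "(\<lambda>j. h (F (r j))) \<longlonglongrightarrow> h g"
    unfolding h_def ip_def app_def by (intro tendsto_intros g) auto
  moreover have "(\<lambda>j. \<mu> - 1 / real (Suc (r j))) \<longlonglongrightarrow> \<mu> - 0"
    by (intro tendsto_intros LIMSEQ_subseq_LIMSEQ[OF LIMSEQ_inverse_real_of_nat r, unfolded o_def inverse_eq_divide])
  ultimately have "\<mu> \<le> h g" using F(3) LIMSEQ_le[of "\<lambda>j. \<mu> - 1 / real (Suc (r j))" \<mu> "\<lambda>j. h (F (r j))" "h g"]
    by (force intro: less_imp_le)
  moreover have "h g \<le> \<mu>" unfolding \<mu>_def using Pg g1 bdd by (auto intro!: cSup_upper simp: V_def)
  ultimately have hg: "h g = \<mu>" by simp
  have le: "h f \<le> \<mu> * Re (ip f f)" if "P f" for f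
  proof (cases "ip f f = 0")
    case True
    then have "h f = 0" using ip_self_zero[OF True] by (simp add: h_def ip_def)
    then show ?thesis using True by simp
  next
    case False
    obtain s where s: "ip f f = complex_of_real s" "s > 0"
      using ip_pos[OF False] by blast
    define u where "u = (\<lambda>i. complex_of_real (1 / sqrt s) * f i)"
    have "P u" "ip u u = 1" "h u = h f / s"
      using scale[OF that, of "complex_of_real (1 / sqrt s)"] s
      by (auto simp: u_def norm_divide power_divide)
    then have "h f / s \<le> \<mu>" unfolding \<mu>_def using bdd by (metis (mono_tags, lifting) V_def cSup_upper imageI mem_Collect_eq)
    then show ?thesis using s by (simp add: field_simps)
  qed
  \<comment> \<open>Perturbing \<open>w\<close> by multiples of \<open>g\<close>, rather than
    \<open>g\<close> by multiples of \<open>w\<close>, makes the terms in \<open>|c|^2\<close>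
    cancel since \<open>h g = \<mu>\<close>; what remains is affine in \<open>c\<close>.\<close>
  have orth: "of_real \<mu> * ip w g - ip w (app A g) = 0" if "P w" for w
  proof (rule complex_affine_nonneg_imp_zero)
    fix c :: complex
    have "P (\<lambda>i. w i + c * g i)" using that Pg by (simp add: P_def ip_lin)
    from le[OF this] have "0 \<le> \<mu> * Re (ip (\<lambda>i. w i + c * g i) (\<lambda>i. w i + c * g i)) - h (\<lambda>i. w i + c * g i)" by simp
    also have "ip (\<lambda>i. w i + c * g i) (\<lambda>i. w i + c * g i) = ip w w + c * ip w g + cnj (c * ip w g) + of_real ((cmod c)\<^sup>2)"
      unfolding ip_lin g1 ip_cnj[of g w] by (simp add: cnj_mult_cmod algebra_simps)
    also have "h (\<lambda>i. w i + c * g i) = h w + 2 * Re (c * ip w (app A g)) + (cmod c)\<^sup>2 * \<mu>"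
    proof -
      have "ip g (app A g) = of_real \<mu>" using hg ip_herm[OF A, of g g]
        by (auto simp: h_def complex_eq_iff)
      then have "ip (\<lambda>i. w i + c * g i) (app A (\<lambda>i. w i + c * g i))
         = ip w (app A w) + c * ip w (app A g) + cnj (c * ip w (app A g)) + of_real ((cmod c)\<^sup>2 * \<mu>)"
        unfolding app_lin ip_lin ip_herm[OF A, of g w]
        by (simp add: algebra_simps) (simp add: cnj_mult_cmod mult.assoc[symmetric])
      then show ?thesis by (simp add: h_def)
    qed
    finally show "0 \<le> (\<mu> * Re (ip w w) - h w) + 2 * Re (c * (of_real \<mu> * ip w g - ip w (app A g)))"
      by (simp add: algebra_simps)
  qed
  define w where "w = (\<lambda>i. app A g i + (- of_real \<mu>) * g i)"
  have "P w" unfolding w_def P_def ip_lin using Pg inv[of g] by (auto simp: P_def)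
  have "ip w w = ip w (app A g) + (- of_real \<mu>) * ip w g"
    by (subst (2) w_def) (rule ip_lin)
  then have "ip w w = 0" using orth[OF \<open>P w\<close>] by simp
  then have "app A g i = of_real \<mu> * g i" if "i < n" for i
    using ip_self_zero[of w i] that by (simp add: w_def)
  then show ?thesis using Pg g1 by (auto simp: P_def)
qed

text \<open>The \<open>m\<close> conditions, padded by zero rows, form a square matrix. Its row
  \<open>m\<close> vanishes, so Laplace expansion gives determinant zero and a kernel vector
  exists.\<close>

lemma exists_orthogonal:
  assumes "m < n" shows "\<exists>f. (\<forall>k<m. ip (v k) f = 0) \<and> ip f f \<noteq> 0"
proof -
  define B where "B = mat n n (\<lambda>(k,i). if k < m then cnj (v k i) else 0)"
  have B: "B \<in> M" by (simp add: B_def)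
  have "det B = (\<Sum>j<n. B $$ (m,j) * cofactor B m j)"
    by (rule laplace_expansion_row[OF B assms])
  also have "\<dots> = 0" using assms by (intro sum.neutral) (auto simp: B_def)
  finally obtain x where x: "x \<in> carrier_vec n" "x \<noteq> 0\<^sub>v n" "B *\<^sub>v x = 0\<^sub>v n"
    using det_0_iff_vec_prod_zero[OF B] by auto
  define f where "f = (\<lambda>i. x $ i)"
  have "ip (v k) f = 0" if "k < m" for k
  proof -
    have "(B *\<^sub>v x) $ k = ip (v k) f"
      using that assms x(1) by (auto simp: B_def ip_def f_def scalar_prod_def atLeast0LessThan)
    then show ?thesis using x(3) that assms by simp
  qed
  moreover have "ip f f \<noteq> 0"
  proof
    assume "ip f f = 0"
    then have "x $ i = 0" if "i < n" for i using ip_self_zero[of f i] that by (simp add: f_def)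
    then show False using x by (metis carrier_vecD eq_vecI index_zero_vec)
  qed
  ultimately show ?thesis by blast
qed

lemma orthonormal_eigenvectors:
  assumes A: "herm A" and "m \<le> n"
  shows "\<exists>v l. (\<forall>k<m. \<forall>i<n. app A (v k) i = complex_of_real (l k) * v k i) \<and>
     (\<forall>k<m. \<forall>j<m. ip (v k) (v j) = (if k = j then 1 else 0))"
  using assms(2)
proof (induction m)
  case 0
  show ?case by simp
next
  case (Suc m)
  then have "\<exists>v l. (\<forall>k<m. \<forall>i<n. app A (v k) i = complex_of_real (l k) * v k i) \<and>
     (\<forall>k<m. \<forall>j<m. ip (v k) (v j) = (if k = j then 1 else 0))" by simp
  then obtain v l where ev: "\<And>k i. k < m \<Longrightarrow> i < n \<Longrightarrow> app A (v k) i = complex_of_real (l k) * v k i"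
    and on: "\<And>k j. k < m \<Longrightarrow> j < m \<Longrightarrow> ip (v k) (v j) = (if k = j then 1 else 0)" by blast
  have inv: "\<forall>k<m. ip (v k) (app A f) = 0" if f: "\<forall>k<m. ip (v k) f = 0" for f
  proof (intro allI impI)
    fix k assume k: "k < m"
    have "ip f (app A (v k)) = of_real (l k) * ip f (v k)"
      using ev[OF k] by (simp add: ip_def sum_distrib_left algebra_simps)
    also have "\<dots> = 0" using f k by (simp add: ip_cnj[of f])
    finally show "ip (v k) (app A f) = 0" using ip_herm[OF A, of "v k" f] by simp
  qed
  obtain f0 where f0: "\<forall>k<m. ip (v k) f0 = 0" "ip f0 f0 \<noteq> 0"
    using exists_orthogonal[of m v] Suc.prems by auto
  obtain g \<mu> where g: "\<forall>k<m. ip (v k) g = 0" "ip g g = 1" "\<forall>i<n. app A g i = complex_of_real \<mu> * g i"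
    using Rayleigh_maximum[of A m v, OF A inv f0] by blast
  have "ip g (v k) = 0" if "k < m" for k using g(1) that by (simp add: ip_cnj[of g])
  then show ?case using g ev on
    by (intro exI[of _ "v(m := g)"] exI[of _ "l(m := \<mu>)"]) (auto simp: less_Suc_eq)
qed

lemma unitaryD: "unitary n U \<Longrightarrow> U \<in> M" "unitary n U \<Longrightarrow> adj U * U = 1\<^sub>m n" "unitary n U \<Longrightarrow> U * adj U = 1\<^sub>m n"
  using mat_mult_left_right_inverse[of "adj U" n U] by (auto simp: unitary_def)

definition ud :: "complex mat \<Rightarrow> (nat \<Rightarrow> complex) \<Rightarrow> complex mat" where
  "ud U d = U * mat_diag n d * adj U"

lemma ud_closed [simp]: "U \<in> M \<Longrightarrow> ud U d \<in> M"
  by (simp add: ud_def)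

lemma diag_ij: "i < n \<Longrightarrow> j < n \<Longrightarrow> mat_diag n d $$ (i,j) = (if i = j then d i else 0)"
  by (auto simp: mat_diag_def)

lemma diag_left: "A \<in> M \<Longrightarrow> i < n \<Longrightarrow> j < n \<Longrightarrow> (mat_diag n d * A) $$ (i,j) = d i * A $$ (i,j)"
  by (simp add: mult_ij diag_ij if_distrib[of "\<lambda>x. x * _"] sum.delta' cong: if_cong)

lemma diag_right: "A \<in> M \<Longrightarrow> i < n \<Longrightarrow> j < n \<Longrightarrow> (A * mat_diag n d) $$ (i,j) = A $$ (i,j) * d j"
  by (simp add: mult_ij diag_ij if_distrib[of "\<lambda>x. _ * x"] sum.delta cong: if_cong)

lemma ud_ij: "U \<in> M \<Longrightarrow> i < n \<Longrightarrow> j < n \<Longrightarrow> ud U d $$ (i,j) = (\<Sum>k<n. U $$ (i,k) * d k * cnj (U $$ (j,k)))"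
  unfolding ud_def by (subst mult_ij) (auto simp: diag_right adj_ij)

lemma spectral_theorem: 
  assumes A: "herm A"
  shows "\<exists>U l. unitary n U \<and> A = ud U (\<lambda>i. complex_of_real (l i))"
proof -
  obtain v l where ev: "\<And>k i. k < n \<Longrightarrow> i < n \<Longrightarrow> app A (v k) i = complex_of_real (l k) * v k i"
    and on: "\<And>k j. k < n \<Longrightarrow> j < n \<Longrightarrow> ip (v k) (v j) = (if k = j then 1 else 0)"
    using orthonormal_eigenvectors[OF A order_refl] by blast
  define U where "U = mat n n (\<lambda>(i,k). v k i)"
  have U: "U \<in> M" by (simp add: U_def)
  have Uij: "U $$ (i,j) = v j i" if "i < n" "j < n" for i j using that by (simp add: U_def)
  have "adj U * U = 1\<^sub>m n"
    by (rule M_eqI) (use U on in \<open>auto simp: mult_ij adj_ij Uij ip_def\<close>)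
  then have un: "unitary n U" using U by (simp add: unitary_def)
  have "A * U = U * mat_diag n (\<lambda>i. complex_of_real (l i))"
    by (rule M_eqI, simp_all add: U hermD[OF A], subst diag_right)
      (use U hermD[OF A] ev in \<open>auto simp: mult_ij Uij app_def mult.commute\<close>)
  then have "ud U (\<lambda>i. complex_of_real (l i)) = A * U * adj U" by (simp add: ud_def)
  also have "\<dots> = A" using unitaryD[OF un] hermD[OF A] by (simp add: M_assoc)
  finally show ?thesis using un by metis
qed

end

section \<open>Functional calculus\<close>

context sqmat
begin

lemma diag_closed [simp]: "mat_diag n d \<in> M" by simp

lemma smult_smult_M [simp]: "A \<in> M \<Longrightarrow> c \<cdot>\<^sub>m (d \<cdot>\<^sub>m A) = (c * d) \<cdot>\<^sub>m A"
  by (rule M_eqI) (simp_all add: smult_ij)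

lemma zero_smult_M: "A \<in> M \<Longrightarrow> 0 \<cdot>\<^sub>m A = 0\<^sub>m n n"
  by (rule M_eqI) (simp_all add: smult_ij)

lemma diag_mult: "mat_diag n d * mat_diag n e = mat_diag n (\<lambda>i. d i * e i)"
  by simp

lemma ud_mult:
  assumes "unitary n U" shows "ud U d * ud U e = ud U (\<lambda>i. d i * e i)"
proof -
  note U = unitaryD[OF assms]
  have "ud U d * ud U e = U * (mat_diag n d * ((adj U * U) * (mat_diag n e * adj U)))"
    using U(1) by (simp add: ud_def M_assoc)
  also have "\<dots> = U * ((mat_diag n d * mat_diag n e) * adj U)"
    using U(1) by (simp add: U(2) M_assoc del: mat_diag_diag)
  finally show ?thesis using U(1) by (simp add: ud_def diag_mult M_assoc)
qed

lemma ud_add: "U \<in> M \<Longrightarrow> ud U d + ud U e = ud U (\<lambda>i. d i + e i)"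
  by (rule M_eqI) (simp_all add: ud_ij add_ij sum.distrib algebra_simps)

lemma ud_smult: "U \<in> M \<Longrightarrow> c \<cdot>\<^sub>m ud U d = ud U (\<lambda>i. c * d i)"
  by (rule M_eqI) (simp_all add: ud_ij smult_ij sum_distrib_left algebra_simps)

lemma ud_adj: "U \<in> M \<Longrightarrow> adj (ud U d) = ud U (\<lambda>i. cnj (d i))"
  by (rule M_eqI) (simp_all add: ud_ij adj_ij mult.commute mult.left_commute)

lemma ud_one: "unitary n U \<Longrightarrow> ud U (\<lambda>i. 1) = 1\<^sub>m n"
proof -
  assume U: "unitary n U"
  have "mat_diag n (\<lambda>i. 1) = (1\<^sub>m n :: complex mat)" by simp
  then show ?thesis using unitaryD[OF U] by (simp add: ud_def)
qed

lemma ud_cong: "U \<in> M \<Longrightarrow> (\<And>i. i < n \<Longrightarrow> d i = e i) \<Longrightarrow> ud U d = ud U e"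
  by (rule M_eqI) (simp_all add: ud_ij)

text \<open>In the two eigenbases the hypothesis reads \<open>(a i - b j) * Y $$ (i,j) = 0\<close>,
  so a nonzero entry forces equal eigenvalues and hence equal values of \<open>f\<close>. With
  \<open>X\<close> the identity this makes the calculus independent of the diagonalisation; with
  equal matrices on both sides it gives commutation.\<close>

lemma ud_intertwine:
  assumes U: "unitary n U" and V: "unitary n V" and X: "X \<in> M"
    and eq: "ud U (\<lambda>i. complex_of_real (a i)) * X = X * ud V (\<lambda>i. complex_of_real (b i))"
  shows "ud U (\<lambda>i. f (a i)) * X = X * ud V (\<lambda>i. f (b i))"
proof -
  note u = unitaryD[OF U] and v = unitaryD[OF V]
  define Y where "Y = adj U * X * V"
  have Y: "Y \<in> M" using u v X by (simp add: Y_def)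
  have X': "X = U * Y * adj V"
  proof -
    have "U * Y * adj V = (U * adj U) * X * (V * adj V)" using u(1) v(1) X by (simp add: Y_def M_assoc)
    then show ?thesis using u v X by simp
  qed
  have l: "ud U d * X = U * (mat_diag n d * Y) * adj V" for d
  proof -
    have "ud U d * X = U * (mat_diag n d * ((adj U * U) * (Y * adj V)))"
      unfolding X' ud_def using u(1) v(1) Y by (simp add: M_assoc)
    then show ?thesis using u v Y by (simp add: M_assoc)
  qed
  have r: "X * ud V d = U * (Y * mat_diag n d) * adj V" for d
  proof -
    have "X * ud V d = U * (Y * ((adj V * V) * (mat_diag n d * adj V)))"
      unfolding X' ud_def using u(1) v(1) Y by (simp add: M_assoc)
    then show ?thesis using u v Y by (simp add: M_assoc)
  qed
  have inv: "adj U * (U * C * adj V) * V = C" if "C \<in> M" for C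
  proof -
    have "adj U * (U * C * adj V) * V = (adj U * U) * C * (adj V * V)"
      using \<open>C \<in> M\<close> u(1) v(1) by (simp add: M_assoc)
    then show ?thesis using \<open>C \<in> M\<close> by (simp add: u(2) v(2))
  qed
  have canc: "A = B" if "U * A * adj V = U * B * adj V" "A \<in> M" "B \<in> M" for A B
    using inv[OF that(2)] inv[OF that(3)] unfolding that(1) by (rule trans[OF sym])
  have *: "mat_diag n (\<lambda>i. complex_of_real (a i)) * Y = Y * mat_diag n (\<lambda>i. complex_of_real (b i))"
    by (rule canc[OF eq[unfolded l r]]) (simp_all add: Y)
  have "mat_diag n (\<lambda>i. f (a i)) * Y = Y * mat_diag n (\<lambda>i. f (b i))"
  proof (rule M_eqI)
    fix i j assume ij: "i < n" "j < n"
    have "complex_of_real (a i) * Y $$ (i,j) = Y $$ (i,j) * complex_of_real (b j)"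
      using arg_cong[OF *, of "\<lambda>A. A $$ (i,j)"] ij Y by (simp only: diag_left diag_right)
    then have "Y $$ (i,j) = 0 \<or> a i = b j" by auto
    then show "(mat_diag n (\<lambda>i. f (a i)) * Y) $$ (i,j) = (Y * mat_diag n (\<lambda>i. f (b i))) $$ (i,j)"
      unfolding diag_left[OF Y ij] diag_right[OF Y ij] by auto
  qed (use Y in auto)
  then show ?thesis unfolding l r by simp
qed

text \<open>The calculus for complex-valued functions, which complex powers require. It makes the
  same choice of diagonalisation as \<open>mfun\<close>, so the two agree on real functions.\<close>

definition cfun :: "(real \<Rightarrow> complex) \<Rightarrow> complex mat \<Rightarrow> complex mat" where
  "cfun f A = (let p = (SOME p. spec_decomp A p) in ud (fst p) (\<lambda>i. f (snd p i)))"

lemma mfun_cfun: "A \<in> M \<Longrightarrow> mfun f A = cfun (\<lambda>x. complex_of_real (f x)) A"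
  by (simp add: mfun_def cfun_def ud_def Let_def)

lemma cfun_spec: 
  assumes "herm A"
  obtains U l where "unitary n U" "A = ud U (\<lambda>i. complex_of_real (l i))" "\<And>f. cfun f A = ud U (\<lambda>i. f (l i))"
proof -
  define p where "p = (SOME p. spec_decomp A p)"
  have "\<exists>p. spec_decomp A p"
    using spectral_theorem[OF assms] hermD[OF assms] by (auto simp: spec_decomp_def ud_def)
  then have "spec_decomp A p" unfolding p_def by (rule someI_ex)
  then have "unitary n (fst p)" "A = ud (fst p) (\<lambda>i. complex_of_real (snd p i))"
    using hermD[OF assms] by (auto simp: spec_decomp_def ud_def)
  moreover have "cfun f A = ud (fst p) (\<lambda>i. f (snd p i))" for f
    by (simp add: cfun_def p_def Let_def)
  ultimately show ?thesis using that by blast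
qed

lemma ud_herm: "unitary n U \<Longrightarrow> herm (ud U (\<lambda>i. complex_of_real (l i)))"
  by (simp add: herm_def ud_adj unitaryD)

lemma cfun_closed [simp]: "herm A \<Longrightarrow> cfun f A \<in> M"
  by (metis cfun_spec ud_closed unitaryD(1))

lemma cfun_intertwine:
  assumes "herm A" "herm B" "X \<in> M" "A * X = X * B"
  shows "cfun f A * X = X * cfun f B"
proof -
  obtain U l where U: "unitary n U" "A = ud U (\<lambda>i. complex_of_real (l i))" "\<And>f. cfun f A = ud U (\<lambda>i. f (l i))"
    using cfun_spec[OF assms(1)] by metis
  obtain V m where V: "unitary n V" "B = ud V (\<lambda>i. complex_of_real (m i))" "\<And>f. cfun f B = ud V (\<lambda>i. f (m i))"
    using cfun_spec[OF assms(2)] by metis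
  show ?thesis using ud_intertwine[OF U(1) V(1) assms(3), of l m f] assms(4) U V by auto
qed

lemma cfun_ud:
  assumes U: "unitary n U" shows "cfun f (ud U (\<lambda>i. complex_of_real (l i))) = ud U (\<lambda>i. f (l i))"
proof -
  let ?A = "ud U (\<lambda>i. complex_of_real (l i))"
  obtain V m where V: "unitary n V" "?A = ud V (\<lambda>i. complex_of_real (m i))" "\<And>f. cfun f ?A = ud V (\<lambda>i. f (m i))"
    using cfun_spec[OF ud_herm[OF U, of l]] by metis
  have "ud U (\<lambda>i. f (l i)) * 1\<^sub>m n = 1\<^sub>m n * ud V (\<lambda>i. f (m i))"
    by (rule ud_intertwine[OF U V(1)]) (use U V in \<open>simp_all add: unitaryD\<close>)
  then show ?thesis using U V by (simp add: unitaryD)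
qed

lemma cfun_mult: "herm A \<Longrightarrow> cfun f A * cfun g A = cfun (\<lambda>x. f x * g x) A"
  by (rule cfun_spec[of A]) (simp_all add: ud_mult)

lemma cfun_add: "herm A \<Longrightarrow> cfun f A + cfun g A = cfun (\<lambda>x. f x + g x) A"
  by (rule cfun_spec[of A]) (simp_all add: ud_add unitaryD)

lemma cfun_smult: "herm A \<Longrightarrow> c \<cdot>\<^sub>m cfun f A = cfun (\<lambda>x. c * f x) A"
  by (rule cfun_spec[of A]) (simp_all add: ud_smult unitaryD)

lemma cfun_adj: "herm A \<Longrightarrow> adj (cfun f A) = cfun (\<lambda>x. cnj (f x)) A"
  by (rule cfun_spec[of A]) (simp_all add: ud_adj unitaryD)

lemma cfun_one: "herm A \<Longrightarrow> cfun (\<lambda>x. 1) A = 1\<^sub>m n"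
  by (rule cfun_spec[of A]) (simp_all add: ud_one)

lemma cfun_zero: "herm A \<Longrightarrow> cfun (\<lambda>x. 0) A = 0\<^sub>m n n"
  using cfun_smult[of A 0 "\<lambda>x. 1"] by (simp add: cfun_one zero_smult_M)

lemma cfun_id: "herm A \<Longrightarrow> cfun complex_of_real A = A"
  by (rule cfun_spec[of A]) auto

lemma cfun_herm: "herm A \<Longrightarrow> herm (cfun (\<lambda>x. complex_of_real (g x)) A)"
  by (simp add: herm_def cfun_adj[unfolded herm_def])

lemma cfun_cfun: "herm A \<Longrightarrow> cfun f (cfun (\<lambda>x. complex_of_real (g x)) A) = cfun (\<lambda>x. f (g x)) A"
  by (rule cfun_spec[of A]) (simp_all add: cfun_ud[where l = "\<lambda>i. g (_ i)"])

lemma cfun_commute: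
  assumes "herm A" "B \<in> M" "A * B = B * A" shows "cfun f A * B = B * cfun f A"
  using cfun_intertwine[OF assms(1,1,2,3)] .

lemma cfun_commute2:
  assumes "herm A" "herm B" "A * B = B * A" shows "cfun f A * cfun g B = cfun g B * cfun f A"
proof -
  have "B * cfun f A = cfun f A * B" using cfun_commute[OF assms(1) hermD(1)[OF assms(2)] assms(3)] by simp
  then show ?thesis using cfun_commute[of B "cfun f A" g] assms by simp
qed

lemma psd_spec:
  assumes "psd n A"
  obtains U l where "unitary n U" "A = ud U (\<lambda>i. complex_of_real (l i))" "\<And>f. cfun f A = ud U (\<lambda>i. f (l i))"
    "\<And>i. i < n \<Longrightarrow> 0 \<le> l i" "\<And>i. pd n A \<Longrightarrow> i < n \<Longrightarrow> 0 < l i"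
proof -
  obtain U l where U: "unitary n U" "A = ud U (\<lambda>i. complex_of_real (l i))" "\<And>f. cfun f A = ud U (\<lambda>i. f (l i))"
    using cfun_spec[OF psdD(3)[OF assms]] by metis
  note u = unitaryD[OF U(1)]
  have *: "\<exists>S\<in>M. S \<noteq> 0\<^sub>m n n \<and> Re (tr (adj S * A * S)) = l k" if k: "k < n" for k
  proof -
    define E where "E = mat_diag n (\<lambda>i. if i = k then 1 else 0 :: complex)"
    have E: "E \<in> M" "E $$ (k,k) = 1" "adj E = E" 
      using k by (auto simp: E_def diag_ij adj_ij intro!: M_eqI)
    \<comment> \<open>The only nonzero column of \<open>S\<close> is the \<open>k\<close>-th
      eigenvector, so the form at \<open>S\<close> is the eigenvalue \<open>l k\<close>.\<close>
    define S where "S = U * E"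
    have S: "S \<in> M" using u E by (simp add: S_def)
    have "adj U * S = E" using u E by (simp add: S_def M_assoc[symmetric])
    then have "S \<noteq> 0\<^sub>m n n" using u E k by (metis M_closed(5) M_zero(2) index_zero_mat(1) zero_neq_one)
    moreover have "adj S * A * S = E * (adj U * U) * mat_diag n (\<lambda>i. complex_of_real (l i)) * (adj U * U) * E"
      using u(1) E U(2) by (simp add: S_def adj_mult M_assoc ud_def)
    then have "adj S * A * S = mat_diag n (\<lambda>i. if i = k then complex_of_real (l k) else 0)"
      using E u by (simp add: E_def diag_mult if_distrib[of "\<lambda>x. x * _"] cong: if_cong)
    then have "Re (tr (adj S * A * S)) = l k" using k by (simp add: tr_sum diag_ij)
    ultimately show ?thesis using S by blast
  qed
  show ?thesis
  proof (rule that[OF U])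
    show "0 \<le> l i" if "i < n" for i using *[OF that] psdD(4)[OF assms] by metis
    show "0 < l i" if "pd n A" "i < n" for i using *[OF that(2)] that(1) unfolding pd_iff by metis
  qed
qed

lemma cfun_cong_psd: "psd n A \<Longrightarrow> (\<And>x. 0 \<le> x \<Longrightarrow> f x = g x) \<Longrightarrow> cfun f A = cfun g A"
  by (rule psd_spec[of A]) (auto intro!: ud_cong simp: unitaryD)

lemma cfun_cong_pd: "pd n A \<Longrightarrow> (\<And>x. 0 < x \<Longrightarrow> f x = g x) \<Longrightarrow> cfun f A = cfun g A"
  by (rule psd_spec[of A]) (auto intro!: ud_cong simp: unitaryD pdD)

lemma ud_psd:
  assumes U: "unitary n U" and d: "\<And>i. i < n \<Longrightarrow> 0 \<le> d i"
  shows "psd n (ud U (\<lambda>i. complex_of_real (d i)))"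
proof -
  define B where "B = ud U (\<lambda>i. complex_of_real (sqrt (d i)))"
  have B: "B \<in> M" using U by (simp add: B_def unitaryD)
  have "adj B * B = ud U (\<lambda>i. complex_of_real (sqrt (d i)) * complex_of_real (sqrt (d i)))"
    using U by (simp add: B_def ud_adj ud_mult unitaryD)
  also have "\<dots> = ud U (\<lambda>i. complex_of_real (d i))"
    using U d by (intro ud_cong) (auto simp: unitaryD simp flip: of_real_mult)
  finally show ?thesis using psd_adj_mult[OF B] by simp
qed

lemma cfun_psd:
  assumes "psd n A" "\<And>x. 0 \<le> x \<Longrightarrow> 0 \<le> g x" 
  shows "psd n (cfun (\<lambda>x. complex_of_real (g x)) A)"
  using assms by (auto elim!: psd_spec[of A] intro!: ud_psd)

lemma psd_sqrt: assumes "psd n A" obtains B where "psd n B" "A = B * B"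
proof
  show "psd n (cfun (\<lambda>x. complex_of_real (sqrt \<bar>x\<bar>)) A)" using assms by (intro cfun_psd) auto
  have "cfun (\<lambda>x. complex_of_real (sqrt \<bar>x\<bar>)) A * cfun (\<lambda>x. complex_of_real (sqrt \<bar>x\<bar>)) A = cfun complex_of_real A"
    using assms by (subst cfun_mult) (auto intro!: cfun_cong_psd simp: psdD simp flip: of_real_mult)
  then show "A = cfun (\<lambda>x. complex_of_real (sqrt \<bar>x\<bar>)) A * cfun (\<lambda>x. complex_of_real (sqrt \<bar>x\<bar>)) A"
    using assms by (simp add: cfun_id psdD)
qed

lemma cfun_pd:
  assumes "pd n A" "\<And>x. 0 < x \<Longrightarrow> 0 < g x" 
  shows "pd n (cfun (\<lambda>x. complex_of_real (g x)) A)"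
proof -
  have h: "herm A" using assms by (simp add: pdD psdD)
  define g' where "g' x = sqrt \<bar>g x\<bar>" for x
  have g': "g' x * g' x = g x" "g' x \<noteq> 0" if "0 < x" for x
    using assms(2)[OF that] by (auto simp: g'_def)
  let ?B = "cfun (\<lambda>x. complex_of_real (g' x)) A" and ?C = "cfun (\<lambda>x. complex_of_real (1 / g' x)) A"
  have B: "?B \<in> M" "?C \<in> M" "adj ?B = ?B" using h by (auto simp: cfun_adj)
  have BB: "cfun (\<lambda>x. complex_of_real (g x)) A = ?B * ?B"
    using assms h g' by (subst cfun_mult) (auto intro!: cfun_cong_pd simp flip: of_real_mult)
  have CB: "?C * ?B = 1\<^sub>m n"
  proof -
    have "?C * ?B = cfun (\<lambda>x. 1) A" using assms h g'
      by (subst cfun_mult) (auto intro!: cfun_cong_pd simp flip: of_real_mult of_real_divide)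
    then show ?thesis using h by (simp add: cfun_one)
  qed
  show ?thesis unfolding pd_iff
  proof (intro conjI ballI impI)
    show "herm (cfun (\<lambda>x. complex_of_real (g x)) A)" using h by (rule cfun_herm)
    fix S assume S: "S \<in> M" "S \<noteq> 0\<^sub>m n n"
    have "adj S * cfun (\<lambda>x. complex_of_real (g x)) A * S = adj (?B * S) * (?B * S)"
      using S B by (simp add: BB adj_mult M_assoc)
    then have *: "Re (tr (adj S * cfun (\<lambda>x. complex_of_real (g x)) A * S)) = (nrm (?B * S))\<^sup>2"
      using S B by (simp add: tr_adj_mult_self)
    have "nrm (?B * S) \<noteq> 0"
    proof
      assume "nrm (?B * S) = 0"
      then have "?C * (?B * S) = 0\<^sub>m n n" using nrm_eq_0[of "?B * S"] S B by simp
      then show False using S B CB M_assoc[of ?C ?B S] by simp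
    qed
    then show "0 < Re (tr (adj S * cfun (\<lambda>x. complex_of_real (g x)) A * S))" unfolding * by simp
  qed
qed

text \<open>The indicator of \<open>t\<close> gives the spectral projection of \<open>A\<close> at
  \<open>t\<close>; the eigenvectors span, so a matrix that kills all of these projections is zero.
  Identities can thus be checked on eigenspaces.\<close>

lemma cfun_mult_eq_zeroD:
  assumes "herm A" "D \<in> M" "\<And>t. D * cfun (\<lambda>x. if x = t then 1 else 0) A = 0\<^sub>m n n"
  shows "D = 0\<^sub>m n n"
proof -
  obtain U l where U: "unitary n U" "A = ud U (\<lambda>i. complex_of_real (l i))" "\<And>f. cfun f A = ud U (\<lambda>i. f (l i))"
    using cfun_spec[OF assms(1)] by metis
  note u = unitaryD[OF U(1)]
  have "D * U = 0\<^sub>m n n"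
  proof (rule M_eqI)
    fix i j assume ij: "i < n" "j < n"
    let ?d = "mat_diag n (\<lambda>i. if l i = l j then 1 else 0 :: complex)"
    have "0\<^sub>m n n * U = D * ud U (\<lambda>i. if l i = l j then 1 else 0) * U" using assms(3)[of "l j"] U by simp
    also have "\<dots> = D * U * ?d * (adj U * U)" using u(1) assms(2) by (simp add: ud_def M_assoc)
    also have "\<dots> = D * U * ?d" using u assms(2) by simp
    finally have "D * U * ?d = 0\<^sub>m n n" using u by simp
    then have "(D * U * ?d) $$ (i,j) = 0" using ij by simp
    then show "(D * U) $$ (i,j) = 0\<^sub>m n n $$ (i,j)" using ij u(1) assms(2) by (subst (asm) diag_right) auto
  qed (use u assms in auto)
  then have "D * (U * adj U) = 0\<^sub>m n n" using u(1) assms(2) by (simp add: M_assoc[symmetric])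
  then show ?thesis using u assms(2) by simp
qed

text \<open>On the joint spectral projections \<open>P s * Q t\<close> the product
  \<open>A * B\<close> acts as the scalar \<open>s * t\<close>, and there the claim is the
  multiplicativity of \<open>f\<close>. For negative \<open>s\<close> or \<open>t\<close> a
  projection vanishes, by positivity.\<close>

lemma cfun_mult_commuting:
  assumes A: "psd n A" and B: "psd n B" and comm: "A * B = B * A"
    and f: "\<And>x y. 0 \<le> x \<Longrightarrow> 0 \<le> y \<Longrightarrow> f (x * y) = f x * f y"
  shows "cfun f (A * B) = cfun f A * cfun f B"
proof -
  note a = psdD(1-3)[OF A] and b = psdD(1-3)[OF B]
  have C: "herm (A * B)" using a b comm by (simp add: herm_def adj_mult)
  define P Q where "P s = cfun (\<lambda>x. if x = s then 1 else 0) A" 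
    and "Q t = cfun (\<lambda>x. if x = t then 1 else 0) B" for s t
  have PQ: "P s \<in> M" "Q t \<in> M" "herm (of_real x \<cdot>\<^sub>m 1\<^sub>m n)" for s t x using a b
    by (auto simp: P_def Q_def herm_def adj_smult cfun_closed[unfolded herm_def])
  have fP: "cfun g A * P s = g s \<cdot>\<^sub>m P s" and fQ: "cfun g B * Q t = g t \<cdot>\<^sub>m Q t" for g s t
    unfolding P_def Q_def using a b 
    by (auto simp: cfun_mult cfun_smult intro!: arg_cong[of _ _ "\<lambda>h. cfun h _"])
  have AP: "A * P s = of_real s \<cdot>\<^sub>m P s" and BQ: "B * Q t = of_real t \<cdot>\<^sub>m Q t" for s t
    using fP[of complex_of_real s] fQ[of complex_of_real t] a b by (auto simp: cfun_id)
  have BP: "cfun g B * P s = P s * cfun g B" for g s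
    unfolding P_def using cfun_commute2[of A B] a b comm by simp
  have neg: "P s = 0\<^sub>m n n" if "s < 0" for s
    unfolding P_def using A a that by (subst cfun_cong_psd[where g = "\<lambda>x. 0"]) (auto simp: cfun_zero)
  have negQ: "Q s = 0\<^sub>m n n" if "s < 0" for s
    unfolding Q_def using B b that by (subst cfun_cong_psd[where g = "\<lambda>x. 0"]) (auto simp: cfun_zero)
  define D where "D = cfun f (A * B) - cfun f A * cfun f B"
  have D: "D \<in> M" using a b C by (simp add: D_def)
  have "D * P s * Q t = 0\<^sub>m n n" for s t
  proof (cases "s < 0 \<or> t < 0")
    case True
    then show ?thesis using neg[of s] negQ[of t] D PQ by auto
  next
    case False
    define X where "X = P s * Q t"
    have X: "X \<in> M" using PQ by (simp add: X_def)
    have "A * B * X = A * ((B * P s) * Q t)" using a b PQ by (simp add: X_def M_assoc)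
    also have "\<dots> = A * (P s * (B * Q t))"
      using BP[of complex_of_real s] a b PQ by (simp add: cfun_id M_assoc)
    also have "\<dots> = of_real t \<cdot>\<^sub>m ((A * P s) * Q t)" using a PQ by (simp add: BQ M_smult M_assoc)
    also have "\<dots> = X * (of_real (s * t) \<cdot>\<^sub>m 1\<^sub>m n)" 
      using PQ X by (simp add: AP M_smult X_def mult.commute)
    \<comment> \<open>\<open>X\<close> intertwines \<open>A * B\<close> with a scalar matrix, so
      every function of \<open>A * B\<close> acts on \<open>X\<close> as a scalar.\<close>
    finally have "cfun f (A * B) * X = X * cfun f (of_real (s * t) \<cdot>\<^sub>m 1\<^sub>m n)"
      using C X PQ(3)[of "s * t"] by (intro cfun_intertwine) auto
    also have "cfun f (of_real (s * t) \<cdot>\<^sub>m 1\<^sub>m n) = f (s * t) \<cdot>\<^sub>m 1\<^sub>m n"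
    proof -
      have u: "unitary n (1\<^sub>m n)" by (simp add: unitary_def)
      have *: "c \<cdot>\<^sub>m 1\<^sub>m n = ud (1\<^sub>m n) (\<lambda>i. c)" for c
        using ud_one[OF u] ud_smult[of "1\<^sub>m n" c "\<lambda>i. 1"] by simp
      show ?thesis unfolding * by (subst cfun_ud[OF u]) simp
    qed
    finally have 1: "cfun f (A * B) * X = f (s * t) \<cdot>\<^sub>m X" using X by (simp add: M_smult)
    have "cfun f A * cfun f B * X = cfun f A * ((cfun f B * P s) * Q t)" using a b PQ by (simp add: X_def M_assoc)
    also have "\<dots> = cfun f A * (P s * (cfun f B * Q t))" using a b PQ by (simp add: BP M_assoc)
    also have "\<dots> = f t \<cdot>\<^sub>m ((cfun f A * P s) * Q t)" using a PQ by (simp add: fQ M_smult M_assoc)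
    also have "\<dots> = f (s * t) \<cdot>\<^sub>m X" using False PQ X f[of s t] by (simp add: fP M_smult X_def mult.commute)
    finally have "D * X = 0\<^sub>m n n" using 1 a b C X by (simp add: D_def M_distrib minus_r_inv_mat)
    then show ?thesis using D PQ by (simp add: X_def M_assoc)
  qed
  then have "D * P s = 0\<^sub>m n n" for s
    using cfun_mult_eq_zeroD[OF b(3), of "D * P s"] D PQ by (simp add: Q_def)
  then have "D = 0\<^sub>m n n" using cfun_mult_eq_zeroD[OF a(3), of D] D by (simp add: P_def)
  have "cfun f (A * B) $$ (i,j) = (cfun f A * cfun f B) $$ (i,j)" if "i < n" "j < n" for i j
    using that \<open>D = 0\<^sub>m n n\<close> minus_ij[of "cfun f (A * B)" "cfun f A * cfun f B" i j] a b C by (simp add: D_def)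
  then show ?thesis using a b C by (intro M_eqI) auto
qed

text \<open>On the finite spectrum of \<open>A\<close> the function agrees with an interpolation
  polynomial, built in Newton form one node at a time, and polynomials in \<open>A\<close> stay in
  the algebra. Applied to \<open>N\<close>, it keeps the complex powers of positive elements of
  \<open>N\<close> inside \<open>N\<close>.\<close>

lemma cfun_subalgebra:
  assumes S: "S \<subseteq> M" "1\<^sub>m n \<in> S" "\<And>X Y. X \<in> S \<Longrightarrow> Y \<in> S \<Longrightarrow> X + Y \<in> S"
    "\<And>X Y. X \<in> S \<Longrightarrow> Y \<in> S \<Longrightarrow> X * Y \<in> S" "\<And>c X. X \<in> S \<Longrightarrow> c \<cdot>\<^sub>m X \<in> S"
    and A: "herm A" "A \<in> S"
  shows "cfun f A \<in> S"
proof -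
  have const: "cfun (\<lambda>x. c) A \<in> S" for c
    using S(5)[OF S(2), of c] cfun_smult[OF A(1), of c "\<lambda>x. 1"] cfun_one[OF A(1)] by simp
  have lin: "cfun (\<lambda>x. of_real x - c) A \<in> S" for c
    using S(3)[OF A(2) const[of "- c"]] cfun_add[OF A(1), of complex_of_real "\<lambda>x. - c"] cfun_id[OF A(1)] by simp
  have van: "cfun (\<lambda>x. \<Prod>y\<in>T. of_real x - of_real y) A \<in> S" if "finite T" for T :: "real set"
    using that
  proof (induction T rule: finite_induct)
    case empty
    show ?case using const[of 1] by simp
  next
    case (insert y T)
    then show ?case using S(4)[OF lin[of "of_real y"] insert.IH] by (simp add: cfun_mult A)
  qed
  have int: "\<exists>q. (\<forall>x\<in>T. q x = f x) \<and> cfun q A \<in> S" if "finite T" for T :: "real set"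
    using that
  proof (induction T rule: finite_induct)
    case empty
    show ?case using const[of 0] by auto
  next
    case (insert y T)
    then obtain q where q: "\<forall>x\<in>T. q x = f x" "cfun q A \<in> S" by auto
    define r where "r x = (\<Prod>y\<in>T. complex_of_real x - of_real y)" for x
    have ry: "r y \<noteq> 0" using insert.hyps by (auto simp: r_def)
    have rx: "r x = 0" if "x \<in> T" for x using insert.hyps that by (auto simp: r_def)
    define c where "c = (f y - q y) / r y"
    have "cfun (\<lambda>x. q x + c * r x) A \<in> S"
      using S(3)[OF q(2) S(5)[OF van[OF insert.hyps(1)], of c]] A
      by (simp add: cfun_add cfun_smult r_def)
    then show ?case using q ry rx by (intro exI[of _ "\<lambda>x. q x + c * r x"]) (auto simp: c_def)
  qed
  obtain U l where U: "unitary n U" "A = ud U (\<lambda>i. complex_of_real (l i))" "\<And>f. cfun f A = ud U (\<lambda>i. f (l i))"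
    using cfun_spec[OF A(1)] by metis
  obtain q where q: "\<forall>x\<in>l ` {..<n}. q x = f x" "cfun q A \<in> S" using int[of "l ` {..<n}"] by auto
  have "cfun q A = cfun f A" unfolding U(3) using q by (intro ud_cong) (auto simp: unitaryD U)
  then show ?thesis using q by simp
qed

subsection \<open>Contractions\<close>

text \<open>Operator-norm contraction, tested by left multiplication in Hilbert-Schmidt norm, the
  form in which traces are estimated.\<close>

definition contr :: "complex mat \<Rightarrow> bool" where
  "contr C \<longleftrightarrow> C \<in> M \<and> (\<forall>B\<in>M. nrm (C * B) \<le> nrm B)"

lemma contrD: "contr C \<Longrightarrow> C \<in> M" "contr C \<Longrightarrow> B \<in> M \<Longrightarrow> nrm (C * B) \<le> nrm B"
  by (auto simp: contr_def)

lemma contr_mult: "contr C \<Longrightarrow> contr D \<Longrightarrow> contr (C * D)"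
  unfolding contr_def by (auto simp: M_assoc) (meson M_closed(1) order_trans)

text \<open>The square of \<open>nrm (adj C * B)\<close> is the trace of \<open>adj B\<close> times
  \<open>C * (adj C * B)\<close>; Cauchy-Schwarz and the contraction property of \<open>C\<close>
  leave one factor to cancel.\<close>

lemma contr_adj: assumes "contr C" shows "contr (adj C)"
  unfolding contr_def
proof (intro conjI ballI)
  note C = contrD(1)[OF assms]
  show "adj C \<in> M" using C by simp
  fix B assume B: "B \<in> M"
  let ?x = "nrm (adj C * B)"
  have "?x\<^sup>2 = cmod (tr (adj (adj C * B) * (adj C * B)))" using B C
    by (simp add: tr_adj_mult_self norm_power)
  also have "adj (adj C * B) * (adj C * B) = adj B * (C * (adj C * B))" using B C by (simp add: adj_mult M_assoc)
  also have "cmod (tr \<dots>) \<le> nrm B * nrm (C * (adj C * B))"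
    using cmod_tr_mult_le[of "adj B" "C * (adj C * B)"] B C by (simp add: nrm_adj)
  also have "\<dots> \<le> nrm B * ?x" using contrD(2)[OF assms, of "adj C * B"] B C by (intro mult_left_mono) auto
  finally have "?x * ?x \<le> nrm B * ?x" by (simp add: power2_eq_square)
  then show "?x \<le> nrm B" using nrm_nonneg[of "adj C * B"] nrm_nonneg[of B]
    by (cases "?x = 0") (auto simp: mult_le_cancel_right)
qed

lemma contr_right: assumes "contr C" "B \<in> M" shows "nrm (B * C) \<le> nrm B"
proof -
  have "nrm (B * C) = nrm (adj (B * C))" using assms contrD(1)[of C] by (simp add: nrm_adj)
  also have "\<dots> = nrm (adj C * adj B)" using assms contrD(1)[of C] by (simp add: adj_mult)
  also have "\<dots> \<le> nrm (adj B)" using contrD(2)[OF contr_adj[OF assms(1)]] assms by simp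
  finally show ?thesis using assms by (simp add: nrm_adj)
qed

lemma contrI:
  assumes C: "C \<in> M" and A: "psd n A" and eq: "adj C * C = cfun (\<lambda>x. complex_of_real (g x)) A"
    and le: "\<And>x. 0 \<le> x \<Longrightarrow> g x \<le> 1"
  shows "contr C"
  unfolding contr_def
proof (intro conjI ballI)
  fix B assume B: "B \<in> M"
  note a = psdD(1-3)[OF A]
  have p: "psd n (cfun (\<lambda>x. complex_of_real (1 - g x)) A)" using A le by (intro cfun_psd) auto
  have "adj B * B = adj B * cfun (\<lambda>x. complex_of_real (g x) + complex_of_real (1 - g x)) A * B"
    using a B by (simp add: cfun_one)
  also have "\<dots> = adj B * (adj C * C) * B + adj B * cfun (\<lambda>x. complex_of_real (1 - g x)) A * B"
    using a B C by (subst cfun_add[symmetric]) (simp_all add: eq M_distrib)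
  also have "adj B * (adj C * C) * B = adj (C * B) * (C * B)" using B C by (simp add: adj_mult M_assoc)
  finally have "Re (tr (adj B * B)) = Re (tr (adj (C * B) * (C * B))) + Re (tr (adj B * cfun (\<lambda>x. complex_of_real (1 - g x)) A * B))"
    using a B C by (simp add: tr_add)
  then have "(nrm (C * B))\<^sup>2 \<le> (nrm B)\<^sup>2" using psdD(4)[OF p B] B C by (simp add: tr_adj_mult_self)
  then show "nrm (C * B) \<le> nrm B" by (simp add: power2_le_iff_abs_le)
qed (use C in simp)

subsection \<open>Complex powers\<close>

text \<open>As \<open>0 powr z = 0\<close>, a power of a positive semidefinite \<open>A\<close>
  vanishes on the kernel for every \<open>z\<close>. In particular \<open>pw 0 A\<close> is the
  support projection, which is the identity when \<open>A\<close> is definite.\<close>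

definition pw :: "complex \<Rightarrow> complex mat \<Rightarrow> complex mat" where
  "pw z A = cfun (\<lambda>x. complex_of_real x powr z) A"

lemma pw_closed [simp]: "psd n A \<Longrightarrow> pw z A \<in> M"
  by (simp add: pw_def psdD)

lemma pw_mult: "psd n A \<Longrightarrow> pw z A * pw w A = pw (z + w) A"
  by (simp add: pw_def cfun_mult psdD powr_add)

lemma pw_adj: "psd n A \<Longrightarrow> adj (pw z A) = pw (cnj z) A"
  unfolding pw_def by (subst cfun_adj) (auto simp: psdD cnj_powr intro!: cfun_cong_psd)

lemma pw_0: "pd n A \<Longrightarrow> pw 0 A = 1\<^sub>m n"
  unfolding pw_def by (subst cfun_cong_pd[where g = "\<lambda>x. 1"]) (auto simp: cfun_one psdD pdD)

lemma pw_1: "psd n A \<Longrightarrow> pw 1 A = A"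
  unfolding pw_def by (subst cfun_cong_psd[where g = complex_of_real]) (auto simp: cfun_id psdD)

lemma pw_2: "psd n A \<Longrightarrow> pw 2 A = A * A"
  using pw_mult[of A 1 1] by (simp add: pw_1)

lemma mpow_pw: "psd n A \<Longrightarrow> mpow s A = pw (complex_of_real s) A"
  unfolding mpow_def pw_def
  by (subst mfun_cfun) (auto simp: psdD powr_of_real intro!: cfun_cong_psd)

lemma mpow_mpow: "psd n A \<Longrightarrow> mpow s (mpow t A) = mpow (t * s) A"
  unfolding mpow_def
  by (simp add: psdD mfun_cfun cfun_cfun powr_powr)

lemma pw_real_psd: "psd n A \<Longrightarrow> psd n (pw (complex_of_real s) A)"
  by (subst mpow_pw[symmetric]) (auto simp: mpow_def mfun_cfun psdD intro: cfun_psd)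

lemma pw_real_pd: "pd n A \<Longrightarrow> pd n (pw (complex_of_real s) A)"
  by (subst mpow_pw[symmetric]) (auto simp: mpow_def mfun_cfun psdD pdD intro: cfun_pd)

lemma pw_commute:
  assumes "psd n A" "B \<in> M" "A * B = B * A" shows "pw z A * B = B * pw z A"
  unfolding pw_def using assms by (simp add: cfun_commute psdD)

lemma pw_mult_commuting:
  assumes "psd n A" "psd n B" "A * B = B * A" shows "pw z (A * B) = pw z A * pw z B"
  unfolding pw_def using assms by (intro cfun_mult_commuting) (auto simp: powr_times_real)

text \<open>The exponents in \<open>adj (pw z A) * pw z A\<close> cancel and leave the support
  projection: the power is a partial isometry.\<close>

lemma contr_pw_imag: assumes "psd n A" "Re z = 0" shows "contr (pw z A)"
proof (rule contrI[OF _ assms(1)])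
  have z: "cnj z + z = 0" using assms(2) by (simp add: complex_eq_iff)
  show "adj (pw z A) * pw z A = cfun (\<lambda>x. complex_of_real (if x = 0 then 0 else 1)) A"
    using assms unfolding pw_adj[OF assms(1)] pw_mult[OF assms(1)]
    by (auto simp: pw_def powr_def z intro!: cfun_cong_psd)
qed (use assms in auto)

end

section \<open>Linear maps on matrices and their exponentials\<close>

text \<open>The double family \<open>s^m/m! * t^k/k! * a (m + k)\<close> is absolutely summable by
  the geometric bound on \<open>a\<close>. Row sums give the iterated exponential, antidiagonal sums
  the exponential at \<open>s + t\<close> by the binomial theorem. Entry by entry this is the
  semigroup law.\<close>

lemma exp_double_sums:
  fixes a b :: "nat \<Rightarrow> complex" and s t C K :: real
  assumes a: "\<And>N. cmod (a N) \<le> K * C ^ N" and C: "0 \<le> C"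
    and b: "\<And>m. (\<lambda>k. of_real (t ^ k / fact k) * a (m + k)) sums b m"
    and S: "(\<lambda>N. of_real ((s + t) ^ N / fact N) * a N) sums S"
  shows "(\<lambda>m. of_real (s ^ m / fact m) * b m) sums S"
proof -
  define e where "e x k = x ^ k / fact k" for x :: real and k :: nat
  have K: "0 \<le> K" using a[of 0] order_trans[OF norm_ge_zero] by fastforce
  have e_nn: "0 \<le> e x k" if "0 \<le> x" for x k using that by (simp add: e_def)
  have e_sums: "e x sums exp x" for x
    using exp_converges[of x] by (simp add: e_def[abs_def] scaleR_conv_of_real field_simps)
  have e_hs: "(e x has_sum exp x) UNIV" if "0 \<le> x" for x
    using e_sums[of x] e_nn[OF that] by (intro norm_summable_imp_has_sum) (auto simp: sums_iff)
  have e_abs: "\<bar>e x k\<bar> = e \<bar>x\<bar> k" for x k by (simp add: e_def power_abs)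
  have e_C: "e \<bar>x\<bar> k * C ^ k = e (\<bar>x\<bar> * C) k" for x k by (simp add: e_def power_mult_distrib)
  define f where "f = (\<lambda>(m,k). complex_of_real (e s m) * complex_of_real (e t k) * a (m + k))"
  define g where "g = (\<lambda>(m,k). K * e (\<bar>s\<bar> * C) m * e (\<bar>t\<bar> * C) k)"
  have fg: "cmod (f (m,k)) \<le> g (m,k)" for m k
  proof -
    have "cmod (f (m,k)) = e \<bar>s\<bar> m * e \<bar>t\<bar> k * cmod (a (m + k))" by (simp add: f_def norm_mult e_abs)
    also have "\<dots> \<le> e \<bar>s\<bar> m * e \<bar>t\<bar> k * (K * C ^ (m + k))" using a by (intro mult_left_mono) (auto simp: e_nn)
    also have "\<dots> = K * (e \<bar>s\<bar> m * C ^ m) * (e \<bar>t\<bar> k * C ^ k)" by (simp add: power_add)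
    finally show ?thesis by (simp add: e_C g_def)
  qed
  have g_in: "((\<lambda>k. g (m,k)) has_sum K * e (\<bar>s\<bar> * C) m * exp (\<bar>t\<bar> * C)) UNIV" for m
    unfolding g_def using has_sum_cmult_right[OF e_hs[of "\<bar>t\<bar> * C"]] C by simp
  have "g summable_on (UNIV \<times> UNIV)"
  proof (rule summable_on_SigmaI[OF g_in])
    have "((\<lambda>m. K * exp (\<bar>t\<bar> * C) * e (\<bar>s\<bar> * C) m) has_sum K * exp (\<bar>t\<bar> * C) * exp (\<bar>s\<bar> * C)) UNIV"
      using C by (intro has_sum_cmult_right e_hs) auto
    then show "(\<lambda>m. K * e (\<bar>s\<bar> * C) m * exp (\<bar>t\<bar> * C)) summable_on UNIV"
      by (auto simp: summable_on_def mult_ac)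
  qed (use C K e_nn in \<open>auto simp: g_def\<close>)
  then have "(\<lambda>x. norm (f x)) summable_on (UNIV \<times> UNIV)"
    by (rule Infinite_Sum.abs_summable_on_comparison_test') (use fg in auto)
  then have "f summable_on (UNIV \<times> UNIV)" by (rule abs_summable_summable)
  then obtain S0 where S0: "(f has_sum S0) (UNIV \<times> UNIV)" by (auto simp: summable_on_def)
  have "((\<lambda>k. f (m,k)) has_sum of_real (e s m) * b m) UNIV" for m
  proof (rule norm_summable_imp_has_sum)
    have "summable (\<lambda>k. g (m,k))" using has_sum_imp_sums[OF g_in] by (simp add: sums_iff)
    then show "summable (\<lambda>k. cmod (f (m,k)))"
      by (rule summable_comparison_test'[where N = 0]) (use fg in auto)
    show "(\<lambda>k. f (m,k)) sums (of_real (e s m) * b m)"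
      using sums_mult[OF b[of m], of "of_real (e s m)"] by (simp add: f_def e_def mult_ac)
  qed
  then have "((\<lambda>m. of_real (e s m) * b m) has_sum S0) UNIV"
    using has_sum_SigmaD[OF S0] by simp
  then have 1: "(\<lambda>m. of_real (e s m) * b m) sums S0" by (rule has_sum_imp_sums)
  have bij: "bij_betw (\<lambda>(N,i). (i, N - i)) (SIGMA N:UNIV. {..N}) ((UNIV :: nat set) \<times> (UNIV :: nat set))"
    by (rule bij_betw_byWitness[where f' = "\<lambda>(i,j). (i + j, i)"]) auto
  have "((\<lambda>x. f (case x of (N,i) \<Rightarrow> (i, N - i))) has_sum S0) (SIGMA N:UNIV. {..N})"
    using S0 has_sum_reindex_bij_betw[OF bij, of f S0] by simp
  then have "((\<lambda>N. \<Sum>i\<le>N. f (i, N - i)) has_sum S0) UNIV"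
    by (rule has_sum_SigmaD) auto
  moreover have "(\<Sum>i\<le>N. f (i, N - i)) = of_real (e (s + t) N) * a N" for N
  proof -
    have "e (s + t) N = (\<Sum>i\<le>N. e s i * e t (N - i))"
      using exp_series_add_commuting[of s t N] by (simp add: e_def scaleR_conv_of_real field_simps)
    then show ?thesis by (simp add: f_def sum_distrib_right)
  qed
  ultimately have "(\<lambda>N. of_real (e (s + t) N) * a N) sums S0" using has_sum_imp_sums by auto
  then have "S = S0" using S by (auto simp: e_def intro: sums_unique2)
  then show ?thesis using 1 by (simp add: e_def)
qed

context sqmat
begin

section \<open>Superoperators in the basis of matrix units, with entrywise limits\<close>

definition Eu :: "nat \<Rightarrow> nat \<Rightarrow> complex mat" where
  "Eu k l = mat n n (\<lambda>(i,j). if i = k \<and> j = l then 1 else 0)"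

lemma Eu_closed [simp]: "Eu k l \<in> M" by (simp add: Eu_def)

lemma lin_closed: "lin_map n \<Phi> \<Longrightarrow> X \<in> M \<Longrightarrow> \<Phi> X \<in> M"
  by (auto simp: lin_map_def)

lemma one_smult_M [simp]: "A \<in> M \<Longrightarrow> 1 \<cdot>\<^sub>m A = A"
  by (rule M_eqI) (simp_all add: smult_ij)

lemma lin_add: "lin_map n \<Phi> \<Longrightarrow> X \<in> M \<Longrightarrow> Y \<in> M \<Longrightarrow> \<Phi> (X + Y) = \<Phi> X + \<Phi> Y"
  unfolding lin_map_def by (metis one_smult_M)

lemma lin_zero: assumes "lin_map n \<Phi>" shows "\<Phi> (0\<^sub>m n n) = 0\<^sub>m n n"
proof -
  have "\<Phi> (0\<^sub>m n n + 0\<^sub>m n n) = \<Phi> (0\<^sub>m n n) + \<Phi> (0\<^sub>m n n)" using assms by (intro lin_add) auto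
  then have "\<Phi> (0\<^sub>m n n) $$ (i,j) = \<Phi> (0\<^sub>m n n) $$ (i,j) + \<Phi> (0\<^sub>m n n) $$ (i,j)" if "i < n" "j < n" for i j
    using that lin_closed[OF assms, of "0\<^sub>m n n"] add_ij[of "\<Phi> (0\<^sub>m n n)" "\<Phi> (0\<^sub>m n n)" i j] by simp
  then show ?thesis using lin_closed[OF assms, of "0\<^sub>m n n"] by (intro M_eqI) auto
qed

lemma lin_smult: "lin_map n \<Phi> \<Longrightarrow> X \<in> M \<Longrightarrow> \<Phi> (c \<cdot>\<^sub>m X) = c \<cdot>\<^sub>m \<Phi> X"
proof -
  assume *: "lin_map n \<Phi>" "X \<in> M"
  then have "\<Phi> (c \<cdot>\<^sub>m X + 0\<^sub>m n n) = c \<cdot>\<^sub>m \<Phi> X + \<Phi> (0\<^sub>m n n)"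
    unfolding lin_map_def using zero_carrier_mat by blast
  then show ?thesis using * lin_closed[OF *] right_add_zero_mat[of "c \<cdot>\<^sub>m X" n n] right_add_zero_mat[of "c \<cdot>\<^sub>m \<Phi> X" n n]
    by (simp add: lin_zero)
qed

lemma minus_M: "A \<in> M \<Longrightarrow> B \<in> M \<Longrightarrow> A - B = A + (- 1) \<cdot>\<^sub>m B"
  by (rule M_eqI) (simp_all add: smult_ij add_ij minus_ij)

lemma lin_minus: "lin_map n \<Phi> \<Longrightarrow> X \<in> M \<Longrightarrow> Y \<in> M \<Longrightarrow> \<Phi> (X - Y) = \<Phi> X - \<Phi> Y"
  by (simp add: minus_M lin_add lin_smult lin_closed)

text \<open>Induction over the support of \<open>X\<close>. Convergence and compactness of
  superoperators reduce in this way to those of \<open>n^4\<close> scalars.\<close>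

lemma lin_expand:
  assumes "lin_map n \<Phi>" "X \<in> M" "i < n" "j < n"
  shows "\<Phi> X $$ (i,j) = (\<Sum>(k,l)\<in>{..<n}\<times>{..<n}. X $$ (k,l) * \<Phi> (Eu k l) $$ (i,j))"
proof -
  define Y where "Y T = mat n n (\<lambda>(i,j). if (i,j) \<in> T then X $$ (i,j) else 0)" for T
  have Y: "Y T \<in> M" for T by (simp add: Y_def)
  have claim: "\<Phi> (Y T) $$ (i,j) = (\<Sum>(k,l)\<in>T. X $$ (k,l) * \<Phi> (Eu k l) $$ (i,j))" if "finite T" "T \<subseteq> {..<n}\<times>{..<n}" for T
    using that
  proof (induction T rule: finite_induct)
    case empty
    have "Y {} = 0\<^sub>m n n" by (rule M_eqI) (auto simp: Y_def)
    then show ?case using assms by (simp add: lin_zero)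
  next
    case (insert p T)
    obtain k l where p: "p = (k,l)" by (cases p)
    have kl: "k < n" "l < n" using insert.prems p by auto
    have "Y (insert p T) = X $$ (k,l) \<cdot>\<^sub>m Eu k l + Y T"
      by (rule M_eqI) (use insert.hyps p kl in \<open>auto simp: Y_def Eu_def\<close>)
    then have "\<Phi> (Y (insert p T)) = X $$ (k,l) \<cdot>\<^sub>m \<Phi> (Eu k l) + \<Phi> (Y T)"
      using assms(1) Y by (simp add: lin_add lin_smult)
    then have "\<Phi> (Y (insert p T)) $$ (i,j) = X $$ (k,l) * \<Phi> (Eu k l) $$ (i,j) + \<Phi> (Y T) $$ (i,j)"
      using assms Y lin_closed[OF assms(1)] by (simp add: add_ij smult_ij)
    then show ?case using insert p by simp
  qed
  have "Y ({..<n}\<times>{..<n}) = X" by (rule M_eqI) (use assms in \<open>auto simp: Y_def\<close>)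
  then show ?thesis using claim[of "{..<n}\<times>{..<n}"] by simp
qed

definition mlim :: "('a \<Rightarrow> complex mat) \<Rightarrow> complex mat \<Rightarrow> 'a filter \<Rightarrow> bool" where
  "mlim X Y F \<longleftrightarrow> (\<forall>i<n. \<forall>j<n. ((\<lambda>t. X t $$ (i,j)) \<longlongrightarrow> Y $$ (i,j)) F)"

lemma mlimD: "mlim X Y F \<Longrightarrow> i < n \<Longrightarrow> j < n \<Longrightarrow> ((\<lambda>t. X t $$ (i,j)) \<longlongrightarrow> Y $$ (i,j)) F"
  by (simp add: mlim_def)

lemma mlim_superop:
  assumes "\<And>t. lin_map n (\<Phi> t)" "lin_map n \<Psi>" "\<And>Z. Z \<in> M \<Longrightarrow> mlim (\<lambda>t. \<Phi> t Z) (\<Psi> Z) F"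
    "\<And>t. X t \<in> M" "Y \<in> M" "mlim X Y F"
  shows "mlim (\<lambda>t. \<Phi> t (X t)) (\<Psi> Y) F"
  unfolding mlim_def
proof (intro allI impI)
  fix i j assume ij: "i < n" "j < n"
  show "((\<lambda>t. \<Phi> t (X t) $$ (i,j)) \<longlongrightarrow> \<Psi> Y $$ (i,j)) F"
    unfolding lin_expand[OF assms(1,4) ij] lin_expand[OF assms(2,5) ij] case_prod_beta
    by (intro tendsto_sum tendsto_mult mlimD[OF assms(6)] mlimD[OF assms(3)]) (use ij in auto)
qed

lemma mlim_const: "mlim (\<lambda>t. Y) Y F" by (simp add: mlim_def)

lemma mlim_lin: "lin_map n \<Phi> \<Longrightarrow> (\<And>t. X t \<in> M) \<Longrightarrow> Y \<in> M \<Longrightarrow> mlim X Y F \<Longrightarrow> mlim (\<lambda>t. \<Phi> (X t)) (\<Phi> Y) F"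
  by (rule mlim_superop) (auto intro: mlim_const)

lemma mlim_mult:
  assumes "\<And>t. X t \<in> M" "Y \<in> M" "mlim X Y F" "\<And>t. X' t \<in> M" "Y' \<in> M" "mlim X' Y' F"
  shows "mlim (\<lambda>t. X t * X' t) (Y * Y') F"
  unfolding mlim_def
proof (intro allI impI)
  fix i j assume ij: "i < n" "j < n"
  show "((\<lambda>t. (X t * X' t) $$ (i,j)) \<longlongrightarrow> (Y * Y') $$ (i,j)) F"
    unfolding mult_ij[OF assms(1,4) ij] mult_ij[OF assms(2,5) ij]
    by (intro tendsto_sum tendsto_mult mlimD[OF assms(3)] mlimD[OF assms(6)]) (use ij in auto)
qed

lemma mlim_adj:
  assumes "\<And>t. X t \<in> M" "Y \<in> M" "mlim X Y F" shows "mlim (\<lambda>t. adj (X t)) (adj Y) F"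
  unfolding mlim_def
proof (intro allI impI)
  fix i j assume ij: "i < n" "j < n"
  show "((\<lambda>t. adj (X t) $$ (i,j)) \<longlongrightarrow> adj Y $$ (i,j)) F"
    unfolding adj_ij[OF assms(1) ij] adj_ij[OF assms(2) ij]
    by (intro tendsto_cnj mlimD[OF assms(3)] ij)
qed

lemma mlim_tr:
  assumes "\<And>t. X t \<in> M" "Y \<in> M" "mlim X Y F" shows "((\<lambda>t. tr (X t)) \<longlongrightarrow> tr Y) F"
  unfolding tr_sum[OF assms(1)] tr_sum[OF assms(2)]
  by (intro tendsto_sum mlimD[OF assms(3)]) auto

lemma mlim_unique:
  assumes "mlim X Y F" "mlim X Y' F" "Y \<in> M" "Y' \<in> M" "F \<noteq> bot" shows "Y = Y'"
  by (rule M_eqI) (use assms in \<open>auto intro: tendsto_unique dest: mlimD\<close>)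

lemma mlim_nrm_zero:
  assumes "((\<lambda>t. nrm (X t)) \<longlongrightarrow> 0) F" shows "mlim X (0\<^sub>m n n) F"
  unfolding mlim_def
proof (intro allI impI)
  fix i j assume ij: "i < n" "j < n"
  have "((\<lambda>t. X t $$ (i,j)) \<longlongrightarrow> 0) F"
    by (rule Lim_null_comparison[OF _ assms]) (use ij entry_le_nrm in \<open>auto intro!: always_eventually\<close>)
  then show "((\<lambda>t. X t $$ (i,j)) \<longlongrightarrow> 0\<^sub>m n n $$ (i,j)) F" using ij by simp
qed

lemma mlim_psd:
  assumes "\<And>t. psd n (X t)" "Y \<in> M" "mlim X Y F" "F \<noteq> bot" shows "psd n Y"
  unfolding psd_iff herm_def
proof (intro conjI ballI)
  have X: "\<And>t. X t \<in> M" "\<And>t. adj (X t) = X t" using assms(1) psdD by auto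
  show "Y \<in> M" by fact
  show "adj Y = Y" using mlim_unique[OF mlim_adj[OF X(1) assms(2,3)], of Y] assms X by simp
  fix S assume S: "S \<in> M"
  have "((\<lambda>t. Re (tr (adj S * X t * S))) \<longlongrightarrow> Re (tr (adj S * Y * S))) F"
    by (intro tendsto_Re mlim_tr mlim_mult mlim_const) (use S X assms in auto)
  then show "0 \<le> Re (tr (adj S * Y * S))"
    by (rule tendsto_lowerbound[OF _ _ assms(4)]) (use psdD(4)[OF assms(1) S] in auto)
qed

lemma superop_compact:
  assumes lin: "\<And>k. lin_map n (\<Phi> k)"
    and bd: "\<And>X. X \<in> M \<Longrightarrow> \<exists>B. \<forall>k. nrm (\<Phi> k X) \<le> B"
  shows "\<exists>r \<Psi>. strict_mono (r :: nat \<Rightarrow> nat) \<and> lin_map n \<Psi> \<and> (\<forall>X\<in>M. mlim (\<lambda>k. \<Phi> (r k) X) (\<Psi> X) sequentially)"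
proof -
  let ?I = "{..<n}\<times>{..<n}\<times>{..<n}\<times>{..<n}"
  let ?x = "\<lambda>k (a,b,i,j). \<Phi> k (Eu a b) $$ (i,j)"
  have "bounded (range (\<lambda>k. ?x k p))" if p: "p \<in> ?I" for p
  proof -
    obtain a b i j where pe: "p = (a,b,i,j)" by (metis prod_cases4)
    obtain B where "\<forall>k. nrm (\<Phi> k (Eu a b)) \<le> B" using bd[of "Eu a b"] by auto
    then have "\<forall>k. cmod (\<Phi> k (Eu a b) $$ (i,j)) \<le> B" using p pe entry_le_nrm order_trans
      by (metis SigmaE2 lessThan_iff)
    then show ?thesis by (auto simp: bounded_iff pe)
  qed
  then have "\<exists>r l. strict_mono r \<and> (\<forall>p\<in>?I. (\<lambda>k. ?x (r k) p) \<longlonglongrightarrow> l p)"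
    by (intro Bolzano_Weierstrass_finite) simp_all
  then obtain r l where r: "strict_mono r" and l: "\<And>p. p \<in> ?I \<Longrightarrow> (\<lambda>k. ?x (r k) p) \<longlonglongrightarrow> l p"
    by blast
  define \<Psi> where "\<Psi> X = mat n n (\<lambda>(i,j). \<Sum>(a,b)\<in>{..<n}\<times>{..<n}. X $$ (a,b) * l (a,b,i,j))" for X
  have P: "\<Psi> X \<in> M" for X by (simp add: \<Psi>_def)
  have lim: "mlim (\<lambda>k. \<Phi> (r k) X) (\<Psi> X) sequentially" if X: "X \<in> M" for X
    unfolding mlim_def
  proof (intro allI impI)
    fix i j assume ij: "i < n" "j < n"
    have "(\<lambda>k. \<Phi> (r k) (Eu a b) $$ (i,j)) \<longlonglongrightarrow> l (a,b,i,j)" if "a < n" "b < n" for a b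
      using l[of "(a,b,i,j)"] that ij by simp
    then have "(\<lambda>k. \<Phi> (r k) X $$ (i,j)) \<longlonglongrightarrow> (\<Sum>(a,b)\<in>{..<n}\<times>{..<n}. X $$ (a,b) * l (a,b,i,j))"
      unfolding lin_expand[OF lin X ij] case_prod_beta
      by (intro tendsto_sum tendsto_mult tendsto_const) auto
    then show "(\<lambda>k. \<Phi> (r k) X $$ (i,j)) \<longlonglongrightarrow> \<Psi> X $$ (i,j)" using ij by (simp add: \<Psi>_def)
  qed
  have "lin_map n \<Psi>"
    unfolding lin_map_def
  proof (intro conjI ballI allI)
    fix X Y c assume XY: "X \<in> M" "Y \<in> M"
    have "(\<Sum>(a,b)\<in>{..<n}\<times>{..<n}. (c \<cdot>\<^sub>m X + Y) $$ (a,b) * l (a,b,i,j)) =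
      (\<Sum>(a,b)\<in>{..<n}\<times>{..<n}. c * (X $$ (a,b) * l (a,b,i,j)) + Y $$ (a,b) * l (a,b,i,j))" for i j
      by (intro sum.cong) (use XY in \<open>auto simp: add_ij smult_ij algebra_simps\<close>)
    then show "\<Psi> (c \<cdot>\<^sub>m X + Y) = c \<cdot>\<^sub>m \<Psi> X + \<Psi> Y"
      by (intro M_eqI) (simp_all add: P add_ij smult_ij, simp add: \<Psi>_def case_prod_beta sum.distrib sum_distrib_left)
  qed (simp add: P)
  then show ?thesis using r lim by blast
qed

end

section \<open>The semigroup given by the exponential series of a linear map\<close>

locale gen = sqmat +
  fixes L :: "complex mat \<Rightarrow> complex mat"
  assumes L: "lin_map n L"
begin

lemma L_closed [simp]: "X \<in> M \<Longrightarrow> L X \<in> M" using lin_closed[OF L] .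

lemma Lpow_closed [simp]: "X \<in> M \<Longrightarrow> (L ^^ k) X \<in> M"
  by (induction k) auto

lemma Lpow_lin: "lin_map n (L ^^ k)"
proof (induction k)
  case 0
  then show ?case by (auto simp: lin_map_def)
next
  case (Suc k)
  then show ?case using L by (auto simp: lin_map_def)
qed

lemma Lpow_bound: "\<exists>K C. 0 \<le> C \<and> (\<forall>k. \<forall>i<n. \<forall>j<n. cmod ((L ^^ k) X $$ (i,j)) \<le> K * C ^ k)" if X: "X \<in> M"
proof -
  let ?I = "{..<n}\<times>{..<n}"
  define sn where "sn Y = (\<Sum>p\<in>?I. cmod (Y $$ p))" for Y :: "complex mat"
  define C where "C = (\<Sum>p\<in>?I. \<Sum>(k,l)\<in>?I. cmod (L (Eu k l) $$ p))"
  have C: "0 \<le> C" by (auto simp: C_def intro!: sum_nonneg)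
  have step: "sn (L Y) \<le> C * sn Y" if Y: "Y \<in> M" for Y
  proof -
    have "sn (L Y) \<le> (\<Sum>p\<in>?I. sn Y * (\<Sum>(k,l)\<in>?I. cmod (L (Eu k l) $$ p)))"
      unfolding sn_def[of "L Y"]
    proof (rule sum_mono)
      fix p assume p: "p \<in> ?I"
      obtain i j where ij: "p = (i,j)" by (cases p)
      have "cmod (L Y $$ p) \<le> (\<Sum>(k,l)\<in>?I. cmod (Y $$ (k,l)) * cmod (L (Eu k l) $$ p))"
        using lin_expand[OF L Y, of i j] p ij
        by (auto simp: case_prod_beta norm_mult intro!: sum_norm_le)
      also have "\<dots> \<le> (\<Sum>(k,l)\<in>?I. sn Y * cmod (L (Eu k l) $$ p))"
        by (auto intro!: sum_mono mult_right_mono member_le_sum simp: sn_def)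
      finally show "cmod (L Y $$ p) \<le> sn Y * (\<Sum>(k,l)\<in>?I. cmod (L (Eu k l) $$ p))"
        by (simp add: sum_distrib_left case_prod_beta)
    qed
    then show ?thesis by (simp add: C_def sum_distrib_left[symmetric] mult.commute)
  qed
  have it: "sn ((L ^^ k) X) \<le> sn X * C ^ k" for k
  proof (induction k)
    case (Suc k)
    have "sn ((L ^^ Suc k) X) \<le> C * sn ((L ^^ k) X)" using step[of "(L ^^ k) X"] X by simp
    also have "\<dots> \<le> C * (sn X * C ^ k)" using Suc C by (intro mult_left_mono) auto
    finally show ?case by (simp add: mult_ac)
  qed simp
  have "cmod ((L ^^ k) X $$ (i,j)) \<le> sn X * C ^ k" if "i < n" "j < n" for k i j
  proof -
    have "cmod ((L ^^ k) X $$ (i,j)) \<le> sn ((L ^^ k) X)"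
      unfolding sn_def using that by (intro member_le_sum) auto
    then show ?thesis using it[of k] by linarith
  qed
  then show ?thesis using C by blast
qed

lemma sg_closed [simp]: "X \<in> M \<Longrightarrow> sg L t X \<in> M"
  by (simp add: sg_def)

lemma sg_sums:
  assumes X: "X \<in> M" and ij: "i < n" "j < n"
  shows "(\<lambda>k. complex_of_real (t ^ k / fact k) * (L ^^ k) X $$ (i,j)) sums (sg L t X $$ (i,j))"
proof -
  obtain K C where KC: "0 \<le> C" "\<And>k. cmod ((L ^^ k) X $$ (i,j)) \<le> K * C ^ k"
    using Lpow_bound[OF X] ij by blast
  have "summable (\<lambda>k. complex_of_real (t ^ k / fact k) * (L ^^ k) X $$ (i,j))"
  proof (rule summable_comparison_test'[where N = 0])
    have "summable (\<lambda>k. K * ((\<bar>t\<bar> * C) ^ k /\<^sub>R fact k))"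
      by (intro summable_mult summable_exp_generic)
    then show "summable (\<lambda>k. K * ((\<bar>t\<bar> * C) ^ k / fact k))"
      by (simp add: scaleR_conv_of_real field_simps)
    fix k
    have "cmod (complex_of_real (t ^ k / fact k) * (L ^^ k) X $$ (i,j)) = (\<bar>t\<bar> ^ k / fact k) * cmod ((L ^^ k) X $$ (i,j))"
      by (simp add: norm_mult norm_divide norm_power)
    also have "\<dots> \<le> (\<bar>t\<bar> ^ k / fact k) * (K * C ^ k)" using KC by (intro mult_left_mono) auto
    finally show "cmod (complex_of_real (t ^ k / fact k) * (L ^^ k) X $$ (i,j)) \<le> K * ((\<bar>t\<bar> * C) ^ k / fact k)"
      by (simp add: power_mult_distrib mult_ac)
  qed
  then show ?thesis using X ij by (simp add: sg_def summable_sums)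
qed

lemma lin_sg_sums:
  assumes \<Phi>: "lin_map n \<Phi>" and X: "X \<in> M" and ij: "i < n" "j < n"
  shows "(\<lambda>k. complex_of_real (t ^ k / fact k) * \<Phi> ((L ^^ k) X) $$ (i,j)) sums (\<Phi> (sg L t X) $$ (i,j))"
proof -
  have "(\<lambda>k. \<Sum>p\<in>{..<n}\<times>{..<n}. (complex_of_real (t ^ k / fact k) * (L ^^ k) X $$ p) * \<Phi> (Eu (fst p) (snd p)) $$ (i,j))
    sums (\<Sum>p\<in>{..<n}\<times>{..<n}. sg L t X $$ p * \<Phi> (Eu (fst p) (snd p)) $$ (i,j))"
    by (intro sums_sum sums_mult2) (use sg_sums[OF X] in auto)
  then show ?thesis
    unfolding lin_expand[OF \<Phi> Lpow_closed[OF X] ij] lin_expand[OF \<Phi> sg_closed[OF X] ij]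
      case_prod_beta sum_distrib_left prod.collapse mult.assoc .
qed

lemma sg_add: 
  assumes X: "X \<in> M" shows "sg L s (sg L t X) = sg L (s + t) X"
proof (rule M_eqI)
  fix i j assume ij: "i < n" "j < n"
  obtain K C where KC: "0 \<le> C" "\<And>k. cmod ((L ^^ k) X $$ (i,j)) \<le> K * C ^ k"
    using Lpow_bound[OF X] ij by blast
  have "(\<lambda>k. complex_of_real (t ^ k / fact k) * (L ^^ (m + k)) X $$ (i,j)) sums ((L ^^ m) (sg L t X) $$ (i,j))" for m
    using lin_sg_sums[OF Lpow_lin[of m] X ij, of t] by (simp add: funpow_add)
  from exp_double_sums[OF KC(2,1) this sg_sums[OF X ij, of "s + t"]]
  have "(\<lambda>m. complex_of_real (s ^ m / fact m) * (L ^^ m) (sg L t X) $$ (i,j)) sums (sg L (s + t) X $$ (i,j))" .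
  moreover have "(\<lambda>m. complex_of_real (s ^ m / fact m) * (L ^^ m) (sg L t X) $$ (i,j)) sums (sg L s (sg L t X) $$ (i,j))"
    using sg_sums[of "sg L t X" i j s] X ij by simp
  ultimately show "sg L s (sg L t X) $$ (i,j) = sg L (s + t) X $$ (i,j)" by (rule sums_unique2[symmetric])
qed (use X in auto)

end

section \<open>Unital completely positive maps\<close>

lemma sum_lessThan_add: "(\<Sum>i<a + b. f i) = (\<Sum>i<a. f i) + (\<Sum>i<b. f (a + i))"
  for f :: "nat \<Rightarrow> 'a::comm_monoid_add"
  by (induction b) (auto simp: add.assoc)

lemma adj_dims: "dim_row (adj A) = dim_col A" "dim_col (adj A) = dim_row A"
  by (simp_all add: adj_def)

lemma adj_index: "i < dim_col A \<Longrightarrow> j < dim_row A \<Longrightarrow> adj A $$ (i,j) = cnj (A $$ (j,i))"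
  by (simp add: adj_def)

context sqmat
begin

text \<open>The block matrix is the product of the column of blocks \<open>G i\<close> with its
  adjoint, so its form is a sum of squares. The positive block matrices fed to complete positivity
  later are of this kind.\<close>

lemma blockmat_Gram_psd:
  assumes G: "\<And>i. i < m \<Longrightarrow> G i \<in> M"
  shows "psd (m * n) (blockmat m n (\<lambda>i j. G i * adj (G j)))" (is "psd _ ?B")
proof -
  define g where "g i k = G (i div n) $$ (i mod n, k)" for i k
  have dm: "i div n < m" "i mod n < n" if "i < m * n" for i
    using that by (auto simp: less_mult_imp_div_less) (metis mod_less_divisor mult_0_right not_less0 gr0I)
  have B: "?B \<in> carrier_mat (m * n) (m * n)" by (simp add: blockmat_def)
  have Bij: "?B $$ (i,j) = (\<Sum>k<n. g i k * cnj (g j k))" if "i < m * n" "j < m * n" for i j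
    using that dm[OF that(1)] dm[OF that(2)] G by (simp add: blockmat_def mult_ij adj_ij g_def)
  have "cinner v (?B *\<^sub>v v) = complex_of_real (\<Sum>k<n. (cmod (\<Sum>j<m * n. cnj (g j k) * v $ j))\<^sup>2)"
    if v: "v \<in> carrier_vec (m * n)" for v
  proof -
    have "cinner v (?B *\<^sub>v v) = (\<Sum>i<m * n. cnj (v $ i) * (\<Sum>j<m * n. (\<Sum>k<n. g i k * cnj (g j k)) * v $ j))"
      using v B by (auto simp: cinner_def scalar_prod_def atLeast0LessThan Bij intro!: sum.cong)
    also have "\<dots> = (\<Sum>i<m * n. \<Sum>j<m * n. \<Sum>k<n. (cnj (v $ i) * g i k) * (cnj (g j k) * v $ j))"
      by (simp add: sum_distrib_left sum_distrib_right mult_ac)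
    also have "\<dots> = (\<Sum>i<m * n. \<Sum>k<n. \<Sum>j<m * n. (cnj (v $ i) * g i k) * (cnj (g j k) * v $ j))"
      by (intro sum.cong refl sum.swap)
    also have "\<dots> = (\<Sum>k<n. \<Sum>i<m * n. \<Sum>j<m * n. (cnj (v $ i) * g i k) * (cnj (g j k) * v $ j))"
      by (rule sum.swap)
    also have "\<dots> = (\<Sum>k<n. (\<Sum>i<m * n. cnj (v $ i) * g i k) * (\<Sum>j<m * n. cnj (g j k) * v $ j))"
      by (simp add: sum_product)
    also have "\<dots> = (\<Sum>k<n. cnj (\<Sum>j<m * n. cnj (g j k) * v $ j) * (\<Sum>j<m * n. cnj (g j k) * v $ j))"
      by (simp add: mult.commute)
    finally show ?thesis by (simp only: cnj_mult_cmod of_real_sum of_real_power)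
  qed
  moreover have "?B = adj ?B"
  proof (rule eq_matI)
    show "dim_row ?B = dim_row (adj ?B)" "dim_col ?B = dim_col (adj ?B)"
      using B by (simp_all only: adj_dims carrier_matD[OF B])
    fix i j assume "i < dim_row (adj ?B)" "j < dim_col (adj ?B)"
    then have ij: "i < m * n" "j < m * n" by (simp_all only: adj_dims carrier_matD[OF B])
    then have "adj ?B $$ (i,j) = cnj (?B $$ (j,i))" by (subst adj_index) (simp_all only: carrier_matD[OF B])
    then show "?B $$ (i,j) = adj ?B $$ (i,j)" using ij by (simp add: Bij mult.commute)
  qed
  ultimately show ?thesis using B by (auto simp: psd_def intro!: sum_nonneg)
qed

lemma tr_adj3:
  assumes "S \<in> M" "A \<in> M" "T \<in> M"
  shows "tr (adj S * A * T) = (\<Sum>k<n. \<Sum>i<n. cnj (S $$ (i,k)) * (\<Sum>j<n. A $$ (i,j) * T $$ (j,k)))"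
  using assms by (simp add: M_assoc tr_sum mult_ij[of "adj S" "A * T"] adj_ij mult_ij[of A T])

text \<open>Column \<open>k\<close> of \<open>S\<close> stacked on column \<open>k\<close> of
  \<open>T\<close> is a vector for the block matrix; summing its form over \<open>k\<close> gives
  the traces.\<close>

lemma blockmat2_form:
  assumes psd: "psd (2 * n) (blockmat 2 n C)" and C: "\<And>i j. C i j \<in> M"
  shows "C 1 0 = adj (C 0 1)"
    and "S \<in> M \<Longrightarrow> T \<in> M \<Longrightarrow> 0 \<le> Re (tr (adj S * C 0 0 * S) + tr (adj S * C 0 1 * T)
           + tr (adj T * C 1 0 * S) + tr (adj T * C 1 1 * T))"
proof -
  let ?B = "blockmat 2 n C"
  have B: "?B \<in> carrier_mat (2 * n) (2 * n)" by (simp add: blockmat_def)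
  have Bij: "?B $$ (i,j) = C 0 0 $$ (i,j)" "?B $$ (i,n + j) = C 0 1 $$ (i,j)"
    "?B $$ (n + i,j) = C 1 0 $$ (i,j)" "?B $$ (n + i,n + j) = C 1 1 $$ (i,j)" if "i < n" "j < n" for i j
    using that by (auto simp: blockmat_def div_add_self1)
  have adjB: "?B = adj ?B" using psd by (simp add: psd_def)
  show "C 1 0 = adj (C 0 1)"
  proof (rule M_eqI)
    fix i j assume ij: "i < n" "j < n"
    have "?B $$ (n + i, j) = adj ?B $$ (n + i, j)" using adjB by simp
    also have "\<dots> = cnj (?B $$ (j, n + i))" using ij B by (simp add: adj_def)
    finally show "C 1 0 $$ (i,j) = adj (C 0 1) $$ (i,j)" using ij C by (simp add: Bij adj_ij)
  qed (use C in auto)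
  assume S: "S \<in> M" and T: "T \<in> M"
  define w where "w k = vec (2 * n) (\<lambda>i. if i < n then S $$ (i,k) else T $$ (i - n,k))" for k
  have w: "w k \<in> carrier_vec (2 * n)" "\<And>i. i < n \<Longrightarrow> w k $ i = S $$ (i,k)" "\<And>i. i < n \<Longrightarrow> w k $ (n + i) = T $$ (i,k)" for k
    by (auto simp: w_def)
  have form: "cinner (w k) (?B *\<^sub>v w k) =
      (\<Sum>i<n. cnj (S $$ (i,k)) * (\<Sum>j<n. C 0 0 $$ (i,j) * S $$ (j,k))) + (\<Sum>i<n. cnj (S $$ (i,k)) * (\<Sum>j<n. C 0 1 $$ (i,j) * T $$ (j,k)))
    + (\<Sum>i<n. cnj (T $$ (i,k)) * (\<Sum>j<n. C 1 0 $$ (i,j) * S $$ (j,k))) + (\<Sum>i<n. cnj (T $$ (i,k)) * (\<Sum>j<n. C 1 1 $$ (i,j) * T $$ (j,k)))"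
    for k
  proof -
    have row: "(?B *\<^sub>v w k) $ i = (\<Sum>j<n + n. ?B $$ (i,j) * w k $ j)" if "i < 2 * n" for i
      using that B w(1)[of k] by (simp add: scalar_prod_def atLeast0LessThan mult_2)
    have "cinner (w k) (?B *\<^sub>v w k) = (\<Sum>i<n + n. cnj (w k $ i) * (\<Sum>j<n + n. ?B $$ (i,j) * w k $ j))"
      using w(1)[of k] by (auto simp: cinner_def mult_2 row intro!: sum.cong)
    also have "\<dots> = (\<Sum>i<n. cnj (S $$ (i,k)) * ((\<Sum>j<n. C 0 0 $$ (i,j) * S $$ (j,k)) + (\<Sum>j<n. C 0 1 $$ (i,j) * T $$ (j,k))))
       + (\<Sum>i<n. cnj (T $$ (i,k)) * ((\<Sum>j<n. C 1 0 $$ (i,j) * S $$ (j,k)) + (\<Sum>j<n. C 1 1 $$ (i,j) * T $$ (j,k))))"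
      unfolding sum_lessThan_add by (intro arg_cong2[of _ _ _ _ "(+)"] sum.cong refl) (auto simp: w Bij)
    finally show ?thesis by (simp add: distrib_left sum.distrib)
  qed
  have "0 \<le> Re (\<Sum>k<n. cinner (w k) (?B *\<^sub>v w k))"
    using psd w(1) by (auto simp: psd_def intro!: sum_nonneg)
  also have "(\<Sum>k<n. cinner (w k) (?B *\<^sub>v w k)) = tr (adj S * C 0 0 * S) + tr (adj S * C 0 1 * T)
           + tr (adj T * C 1 0 * S) + tr (adj T * C 1 1 * T)"
    unfolding form using S T C by (simp add: tr_adj3 sum.distrib)
  finally show "0 \<le> Re (tr (adj S * C 0 0 * S) + tr (adj S * C 0 1 * T)
           + tr (adj T * C 1 0 * S) + tr (adj T * C 1 1 * T))" .
qed

section \<open>Consequences of complete positivity on 2 by 2 blocks\<close>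

lemma ucp_lin: "ucp n \<Phi> \<Longrightarrow> lin_map n \<Phi>" by (simp add: ucp_def)
lemma ucp_one: "ucp n \<Phi> \<Longrightarrow> \<Phi> (1\<^sub>m n) = 1\<^sub>m n" by (simp add: ucp_def)
lemma ucp_closed: "ucp n \<Phi> \<Longrightarrow> X \<in> M \<Longrightarrow> \<Phi> X \<in> M" by (simp add: ucp_lin lin_closed)

text \<open>Complete positivity on the Gram block of \<open>g\<close> and \<open>h\<close>.
  Everything it contributes is drawn from here: hermiticity, positivity, the Schwarz inequality, and
  the bound of an off-diagonal corner on the line \<open>Re z = 1\<close>.\<close>

lemma ucp_block:
  assumes u: "ucp n \<Phi>" and g: "g \<in> M" and h: "h \<in> M"
  shows "\<Phi> (h * adj g) = adj (\<Phi> (g * adj h))"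
    and "S \<in> M \<Longrightarrow> T \<in> M \<Longrightarrow> 0 \<le> Re (tr (adj S * \<Phi> (g * adj g) * S) + tr (adj S * \<Phi> (g * adj h) * T)
           + tr (adj T * \<Phi> (h * adj g) * S) + tr (adj T * \<Phi> (h * adj h) * T))"
proof -
  define G where "G i = (if i = (0::nat) then g else h)" for i
  have G: "G i \<in> M" for i using g h by (simp add: G_def)
  have cp: "cp_map n \<Phi>" using u by (simp add: ucp_def)
  have "psd (2 * n) (blockmat 2 n (\<lambda>i j. G i * adj (G j)))" using G by (intro blockmat_Gram_psd) auto
  then have p: "psd (2 * n) (blockmat 2 n (\<lambda>i j. \<Phi> (G i * adj (G j))))"
    using cp[unfolded cp_map_def, rule_format, of 2 "\<lambda>i j. G i * adj (G j)"] G by simp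
  note f = blockmat2_form[OF p]
  show "\<Phi> (h * adj g) = adj (\<Phi> (g * adj h))" using f(1) G u by (simp add: ucp_closed) (simp add: G_def)
  show "0 \<le> Re (tr (adj S * \<Phi> (g * adj g) * S) + tr (adj S * \<Phi> (g * adj h) * T)
           + tr (adj T * \<Phi> (h * adj g) * S) + tr (adj T * \<Phi> (h * adj h) * T))" if "S \<in> M" "T \<in> M"
    using f(2)[OF _ that] G u by (simp add: ucp_closed) (simp add: G_def)
qed

lemma ucp_adj: "ucp n \<Phi> \<Longrightarrow> X \<in> M \<Longrightarrow> \<Phi> (adj X) = adj (\<Phi> X)"
  using ucp_block(1)[of \<Phi> X "1\<^sub>m n"] by simp

lemma ucp_psd: assumes u: "ucp n \<Phi>" and A: "psd n A" shows "psd n (\<Phi> A)"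
  unfolding psd_iff herm_def
proof (intro conjI ballI)
  note a = psdD(1,2)[OF A]
  show "\<Phi> A \<in> M" "adj (\<Phi> A) = \<Phi> A" using ucp_closed[OF u a(1)] ucp_adj[OF u a(1)] a by auto
  obtain B where B: "psd n B" "A = B * B" using psd_sqrt[OF A] by blast
  note b = psdD(1,2)[OF B(1)]
  fix S assume S: "S \<in> M"
  show "0 \<le> Re (tr (adj S * \<Phi> A * S))"
    using ucp_block(2)[OF u b(1) zero_carrier_mat S zero_carrier_mat] S b B u lin_zero[OF ucp_lin[OF u]]
    by (simp add: ucp_closed)
qed

text \<open>With \<open>g\<close> the identity and \<open>h = adj X\<close>, the choice
  \<open>S = - \<Phi> X * T\<close> minimises the block form in \<open>S\<close> and leaves the
  Schur complement.\<close>

lemma Kadison_Schwarz: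
  assumes u: "ucp n \<Phi>" and X: "X \<in> M" shows "psd n (\<Phi> (adj X * X) - adj (\<Phi> X) * \<Phi> X)"
  unfolding psd_iff herm_def
proof (intro conjI ballI)
  have c: "\<Phi> X \<in> M" "\<Phi> (adj X) \<in> M" "\<Phi> (adj X * X) \<in> M" "adj (\<Phi> X) = \<Phi> (adj X)" "adj (\<Phi> (adj X * X)) = \<Phi> (adj X * X)"
    using u X ucp_adj[OF u, of X] ucp_adj[OF u, of "adj X * X"] by (auto simp: ucp_closed adj_mult)
  let ?D = "\<Phi> (adj X * X) - adj (\<Phi> X) * \<Phi> X"
  show "?D \<in> M" using c by simp
  show "adj ?D = ?D" using c by (simp add: adj_minus adj_mult) (metis adj_adj)
  fix T assume T: "T \<in> M"
  let ?Y = "\<Phi> X * T"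
  let ?S = "(- 1) \<cdot>\<^sub>m ?Y"
  have Y: "?Y \<in> M" "?S \<in> M" using c T by auto
  have adjS: "adj ?S = (- 1) \<cdot>\<^sub>m (adj T * \<Phi> (adj X))" using c T Y by (simp add: adj_smult adj_mult)
  have "0 \<le> Re (tr (adj ?S * \<Phi> (1\<^sub>m n) * ?S) + tr (adj ?S * \<Phi> X * T)
           + tr (adj T * \<Phi> (adj X) * ?S) + tr (adj T * \<Phi> (adj X * X) * T))"
    using ucp_block(2)[OF u, of "1\<^sub>m n" "adj X" ?S T] X T Y by simp
  also have "tr (adj ?S * \<Phi> (1\<^sub>m n) * ?S) + tr (adj ?S * \<Phi> X * T)
           + tr (adj T * \<Phi> (adj X) * ?S) + tr (adj T * \<Phi> (adj X * X) * T)
     = tr (adj T * \<Phi> (adj X * X) * T) - tr (adj T * (\<Phi> (adj X) * \<Phi> X) * T)"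
    unfolding adjS using c T u by (simp add: ucp_one M_smult tr_smult M_assoc)
  also have "\<dots> = tr (adj T * ?D * T)" using c T by (simp add: M_distrib tr_minus)
  finally show "0 \<le> Re (tr (adj T * ?D * T))" .
qed

lemma form_zero:
  assumes D: "D \<in> M" and z: "\<And>T. T \<in> M \<Longrightarrow> tr (adj T * D * T) = 0"
  shows "D = 0\<^sub>m n n"
proof -
  have pol: "c * tr (adj S * D * T) + cnj c * tr (adj T * D * S) = 0" if "S \<in> M" "T \<in> M" for S T c
  proof -
    have "tr (adj (S + c \<cdot>\<^sub>m T) * D * (S + c \<cdot>\<^sub>m T)) = tr (adj S * D * S) + c * tr (adj S * D * T)
      + cnj c * tr (adj T * D * S) + c * cnj c * tr (adj T * D * T)"
      using that D by (simp add: adj_add adj_smult M_distrib M_smult tr_add tr_smult distrib_left)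
    then show ?thesis using z that by simp
  qed
  have "tr (adj S * D * T) = 0" if "S \<in> M" "T \<in> M" for S T
    using pol[OF that, of 1] pol[OF that, of \<i>] by (simp add: complex_eq_iff)
  from this[of D "1\<^sub>m n"] have "nrm D = 0" using D by (simp add: tr_adj_mult_self)
  then show ?thesis using D nrm_eq_0 by blast
qed

text \<open>By the Schwarz inequality the matrix-valued sesquilinear form \<open>D U V\<close> is
  positive. Since \<open>D A A = 0\<close>, its value at \<open>adj X + c A\<close> is affine in
  \<open>c\<close>, so the mixed part vanishes: equality for \<open>A\<close> alone makes
  \<open>\<Phi>\<close> multiplicative against every \<open>X\<close>.\<close>

lemma multiplicative_domain:
  assumes u: "ucp n \<Phi>" and A: "A \<in> M" and X: "X \<in> M" and eq: "\<Phi> (adj A * A) = adj (\<Phi> A) * \<Phi> A"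
  shows "\<Phi> (X * A) = \<Phi> X * \<Phi> A"
proof -
  note lin = ucp_lin[OF u]
  define D where "D U V = \<Phi> (adj U * V) - adj (\<Phi> U) * \<Phi> V" for U V
  have D: "D U V \<in> M" if "U \<in> M" "V \<in> M" for U V using that u by (simp add: D_def ucp_closed)
  have adjD: "adj (D U V) = D V U" if "U \<in> M" "V \<in> M" for U V
    using that u ucp_adj[OF u, of "adj U * V"] by (simp add: D_def adj_minus adj_mult ucp_closed)
  let ?Y = "adj X"
  have Y: "?Y \<in> M" using X by simp
  have "D ?Y A = 0\<^sub>m n n"
  proof (rule form_zero)
    fix T assume T: "T \<in> M"
    show "tr (adj T * D ?Y A * T) = 0"
    proof (rule complex_affine_nonneg_imp_zero[where a = "Re (tr (adj T * D ?Y ?Y * T))"])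
      fix c :: complex
      let ?Z = "?Y + c \<cdot>\<^sub>m A"
      have Z: "?Z \<in> M" using Y A by simp
      have DAA: "D A A = 0\<^sub>m n n" using eq A u by (simp add: D_def ucp_closed minus_r_inv_mat)
      have "D ?Z ?Z = D ?Y ?Y + c \<cdot>\<^sub>m D ?Y A + (cnj c \<cdot>\<^sub>m D A ?Y + (c * cnj c) \<cdot>\<^sub>m D A A)"
        unfolding D_def
        by (rule M_eqI) (use X Y A u lin in \<open>simp_all add: adj_add adj_smult M_distrib M_smult lin_add lin_smult lin_closed add_ij minus_ij smult_ij algebra_simps\<close>)
      also have "\<dots> = D ?Y ?Y + c \<cdot>\<^sub>m D ?Y A + cnj c \<cdot>\<^sub>m D A ?Y"
        using DAA Y A D by (intro M_eqI) (auto simp: add_ij smult_ij)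
      finally have "tr (adj T * D ?Z ?Z * T) = tr (adj T * D ?Y ?Y * T) + c * tr (adj T * D ?Y A * T) + cnj c * tr (adj T * D A ?Y * T)"
        using T D[OF Y Y] D[OF Y A] D[OF A Y] by (simp add: M_distrib M_smult tr_add tr_smult)
      also have "tr (adj T * D A ?Y * T) = cnj (tr (adj T * D ?Y A * T))"
        using T D[OF Y A] adjD[OF Y A] by (subst tr_adj[symmetric]) (simp_all add: adj_mult M_assoc)
      finally have e: "Re (tr (adj T * D ?Z ?Z * T)) = Re (tr (adj T * D ?Y ?Y * T)) + 2 * Re (c * tr (adj T * D ?Y A * T))"
        by simp
      have "0 \<le> Re (tr (adj T * D ?Z ?Z * T))"
        using psdD(4)[OF Kadison_Schwarz[OF u Z] T] by (simp add: D_def)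
      then show "0 \<le> Re (tr (adj T * D ?Y ?Y * T)) + 2 * Re (c * tr (adj T * D ?Y A * T))" using e by simp
    qed
  qed (use D Y A in simp)
  then have "\<Phi> (X * A) - \<Phi> X * \<Phi> A = 0\<^sub>m n n"
    using X A ucp_adj[OF u X] by (simp add: D_def)
  then show ?thesis by (rule minus_zeroD[rotated 2]) (use X A u in \<open>simp_all add: ucp_closed\<close>)
qed

lemma tr_psd_mult: assumes "psd n A" "psd n B" shows "0 \<le> Re (tr (A * B))"
proof -
  obtain C where C: "psd n C" "B = C * C" using psd_sqrt[OF assms(2)] by blast
  note c = psdD(1,2)[OF C(1)] and a = psdD(1)[OF assms(1)]
  have "tr (A * B) = tr (C * (A * C))" using tr_comm[of "A * C" C] C c a by (simp add: M_assoc)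
  then show ?thesis using psdD(4)[OF assms(1) c(1)] c a by (simp add: M_assoc)
qed

lemma tr_pd_mult_zero: assumes "pd n A" "psd n B" "Re (tr (A * B)) = 0" shows "B = 0\<^sub>m n n"
proof -
  obtain C where C: "psd n C" "B = C * C" using psd_sqrt[OF assms(2)] by blast
  note c = psdD(1,2)[OF C(1)] and a = psdD(1)[OF pdD[OF assms(1)]]
  have "tr (A * B) = tr (adj C * A * C)" using tr_comm[of "A * C" C] C c a by (simp add: M_assoc)
  then have "C = 0\<^sub>m n n" using assms(1,3) c unfolding pd_iff by force
  then show ?thesis using C by simp
qed

lemma pd_lower_bound: 
  assumes "pd n A" obtains \<delta> where "0 < \<delta>" "psd n (A - complex_of_real \<delta> \<cdot>\<^sub>m 1\<^sub>m n)"
proof -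
  obtain U l where U: "unitary n U" "A = ud U (\<lambda>i. complex_of_real (l i))" and l: "\<And>i. i < n \<Longrightarrow> 0 < l i"
    using psd_spec[OF pdD[OF assms]] assms by metis
  \<comment> \<open>The lowest eigenvalue, capped by 1 so that the minimum is over a nonempty set
    when \<open>n = 0\<close>.\<close>
  define \<delta> where "\<delta> = Min (insert 1 (l ` {..<n}))"
  have d: "0 < \<delta>" using l by (auto simp: \<delta>_def)
  have dl: "\<delta> \<le> l i" if "i < n" for i using that by (auto simp: \<delta>_def intro!: Min_le)
  have u: "U \<in> M" using U by (simp add: unitaryD)
  have "A - complex_of_real \<delta> \<cdot>\<^sub>m 1\<^sub>m n = ud U (\<lambda>i. complex_of_real (l i)) + (- complex_of_real \<delta>) \<cdot>\<^sub>m ud U (\<lambda>i. 1)"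
    using U u by (simp add: ud_one minus_M)
  also have "\<dots> = ud U (\<lambda>i. complex_of_real (l i - \<delta>))" using u by (simp add: ud_smult ud_add)
  finally show ?thesis using that[OF d] ud_psd[OF U(1), of "\<lambda>i. l i - \<delta>"] dl by simp
qed

end

section \<open>The decoherence-free algebra and its conditional expectation\<close>

locale decoh = gen +
  fixes \<rho> :: "complex mat"
  assumes qms: "qms n L"
    and rho: "pd n \<rho>"
    and inv: "\<And>t X. 0 \<le> t \<Longrightarrow> X \<in> M \<Longrightarrow> tr (\<rho> * sg L t X) = tr (\<rho> * X)"
begin

abbreviation P :: "real \<Rightarrow> complex mat \<Rightarrow> complex mat" where "P \<equiv> sg L"
abbreviation N :: "complex mat set" where "N \<equiv> dfa n L"

lemma P_ucp: "0 \<le> t \<Longrightarrow> ucp n (P t)" using qms by (simp add: qms_def)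

lemma P_lin: "0 \<le> t \<Longrightarrow> lin_map n (P t)" using P_ucp ucp_lin by blast

lemma rho_M [simp]: "\<rho> \<in> M" using rho by (simp add: pdD psdD)

lemma P_adj: "0 \<le> t \<Longrightarrow> X \<in> M \<Longrightarrow> P t (adj X) = adj (P t X)" using P_ucp ucp_adj by blast

section \<open>The decoherence-free algebra is a star-algebra\<close>

lemma N_M: "A \<in> N \<Longrightarrow> A \<in> M" by (simp add: dfa_def)

lemma N_right: assumes "A \<in> N" "X \<in> M" "0 \<le> t" shows "P t (X * A) = P t X * P t A"
  using assms by (intro multiplicative_domain P_ucp) (auto simp: dfa_def)

lemma N_adj: "A \<in> N \<Longrightarrow> adj A \<in> N"
  using P_adj by (auto simp: dfa_def)

lemma N_left: assumes "A \<in> N" "X \<in> M" "0 \<le> t" shows "P t (A * X) = P t A * P t X"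
proof -
  note a = N_M[OF assms(1)]
  have "P t (adj X * adj A) = P t (adj X) * P t (adj A)" using N_right[OF N_adj[OF assms(1)], of "adj X"] assms by simp
  then have "P t (adj (A * X)) = adj (P t A * P t X)" using a assms by (simp add: adj_mult P_adj)
  then have "adj (P t (A * X)) = adj (P t A * P t X)" using a assms by (simp add: P_adj)
  then show ?thesis by (metis adj_adj)
qed

lemma N_I:
  assumes "A \<in> M" "\<And>t. 0 \<le> t \<Longrightarrow> P t (adj A * A) = adj (P t A) * P t A" "\<And>t. 0 \<le> t \<Longrightarrow> P t (A * adj A) = P t A * adj (P t A)"
  shows "A \<in> N" using assms by (simp add: dfa_def)

lemma N_D:
  assumes "A \<in> N" "0 \<le> t" shows "P t (adj A * A) = adj (P t A) * P t A" "P t (A * adj A) = P t A * adj (P t A)"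
  using assms by (simp_all add: dfa_def)

lemma N_one: "1\<^sub>m n \<in> N"
  by (rule N_I) (auto simp: ucp_one[OF P_ucp])

lemma N_mult: assumes "A \<in> N" "B \<in> N" shows "A * B \<in> N"
proof -
  have *: "P t (adj (A * B) * (A * B)) = adj (P t (A * B)) * P t (A * B)" if "A \<in> N" "B \<in> N" "0 \<le> t" for A B t
  proof -
    note m = N_M[OF that(1)] N_M[OF that(2)]
    have "P t (adj (A * B) * (A * B)) = P t (adj B * (adj A * A * B))" using m by (simp add: adj_mult M_assoc)
    also have "\<dots> = P t (adj B) * (P t (adj A * A) * P t B)"
      using N_left[OF N_adj[OF that(2)], of "adj A * A * B" t] N_right[OF that(2), of "adj A * A" t] that m by simp
    also have "\<dots> = adj (P t A * P t B) * (P t A * P t B)" using N_D[OF that(1,3)] that m by (simp add: P_adj adj_mult M_assoc)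
    finally show ?thesis using N_left[OF that(1) m(2) that(3)] by simp
  qed
  have "P t ((A * B) * adj (A * B)) = P t (A * B) * adj (P t (A * B))" if "0 \<le> t" for t
    using *[OF N_adj[OF assms(2)] N_adj[OF assms(1)] that] assms N_M that by (simp add: adj_mult flip: P_adj)
  then show ?thesis using * assms N_M by (intro N_I) auto
qed

lemma N_smult: assumes "A \<in> N" shows "c \<cdot>\<^sub>m A \<in> N"
  using N_D[OF assms] N_M[OF assms]
  by (intro N_I) (auto simp: adj_smult M_smult lin_smult[OF P_lin])

lemma N_add: assumes "A \<in> N" "B \<in> N" shows "A + B \<in> N"
proof -
  note m = N_M[OF assms(1)] N_M[OF assms(2)]
  have *: "P t (adj (A + B) * (A + B)) = adj (P t (A + B)) * P t (A + B)" if "A \<in> N" "B \<in> N" "0 \<le> t" for A B t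
    using N_right[OF that(1) _ that(3)] N_right[OF that(2) _ that(3)] N_M[OF that(1)] N_M[OF that(2)] that(3)
    by (simp add: adj_add M_distrib lin_add[OF P_lin] P_adj)
  have "P t ((A + B) * adj (A + B)) = P t (A + B) * adj (P t (A + B))" if "0 \<le> t" for t
    using *[OF N_adj[OF assms(1)] N_adj[OF assms(2)] that] assms N_M that m by (simp add: adj_add flip: P_adj)
  then show ?thesis using * assms m by (intro N_I) auto
qed

lemma N_minus: "A \<in> N \<Longrightarrow> B \<in> N \<Longrightarrow> A - B \<in> N"
  by (simp add: minus_M N_M N_add N_smult)

lemma N_cfun: "herm A \<Longrightarrow> A \<in> N \<Longrightarrow> cfun f A \<in> N"
  by (rule cfun_subalgebra[of N]) (auto simp: N_M N_one N_add N_mult N_smult)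

lemma N_pw: "psd n A \<Longrightarrow> A \<in> N \<Longrightarrow> pw z A \<in> N"
  by (simp add: pw_def N_cfun psdD)

text \<open>A Lyapunov function of the semigroup. The functional given by \<open>\<rho>\<close> need
  not be a trace, so \<open>X\<close> and its adjoint both enter, matching the two conditions that
  define \<open>N\<close>. It decreases along orbits, and it is constant exactly on the orbits that
  start in \<open>N\<close>.\<close>

definition q :: "complex mat \<Rightarrow> real" where
  "q X = Re (tr (\<rho> * (adj X * X))) + Re (tr (\<rho> * (X * adj X)))"

lemma q_terms_nonneg: "X \<in> M \<Longrightarrow> 0 \<le> Re (tr (\<rho> * (adj X * X)))" "X \<in> M \<Longrightarrow> 0 \<le> Re (tr (\<rho> * (X * adj X)))"
  using tr_psd_mult[OF pdD[OF rho]] psd_adj_mult[of X] psd_adj_mult[of "adj X"] by auto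

lemma q_nonneg: "X \<in> M \<Longrightarrow> 0 \<le> q X" using q_terms_nonneg[of X] by (simp add: q_def)

lemma q_lower: obtains \<delta> where "0 < \<delta>" "\<And>X. X \<in> M \<Longrightarrow> \<delta> * (nrm X)\<^sup>2 \<le> q X"
proof -
  obtain \<delta> where d: "0 < \<delta>" "psd n (\<rho> - complex_of_real \<delta> \<cdot>\<^sub>m 1\<^sub>m n)" using pd_lower_bound[OF rho] by blast
  have "\<delta> * (nrm X)\<^sup>2 \<le> q X" if X: "X \<in> M" for X
  proof -
    have "0 \<le> Re (tr (adj X * (\<rho> - complex_of_real \<delta> \<cdot>\<^sub>m 1\<^sub>m n) * X))" using psdD(4)[OF d(2) X] .
    also have "adj X * (\<rho> - complex_of_real \<delta> \<cdot>\<^sub>m 1\<^sub>m n) * X = adj X * (\<rho> * X) - complex_of_real \<delta> \<cdot>\<^sub>m (adj X * X)"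
      using X by (simp add: M_distrib M_smult M_assoc)
    also have "Re (tr \<dots>) = Re (tr (adj X * (\<rho> * X))) - \<delta> * (nrm X)\<^sup>2"
      using X by (simp add: tr_minus tr_smult tr_adj_mult_self flip: of_real_power of_real_mult)
    also have "tr (adj X * (\<rho> * X)) = tr (\<rho> * (X * adj X))" using X tr_comm[of "adj X" "\<rho> * X"] by (simp add: M_assoc)
    finally show ?thesis using q_terms_nonneg[OF X] by (simp add: q_def)
  qed
  then show ?thesis using that d(1) by blast
qed

lemma q_zero: "X \<in> M \<Longrightarrow> q X = 0 \<Longrightarrow> X = 0\<^sub>m n n"
proof -
  assume X: "X \<in> M" "q X = 0"
  obtain \<delta> where "0 < \<delta>" "\<delta> * (nrm X)\<^sup>2 \<le> q X" using q_lower X by metis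
  then have "nrm X = 0" using X by (simp add: mult_le_0_iff)
  then show ?thesis using X nrm_eq_0 by blast
qed

text \<open>The Schwarz defect is positive, and by invariance its pairing with \<open>\<rho>\<close>
  is the loss of the term. As \<open>\<rho>\<close> is faithful, no loss means no defect.\<close>

lemma q_terms_decrease:
  assumes "X \<in> M" "0 \<le> t"
  shows "Re (tr (\<rho> * (adj (P t X) * P t X))) \<le> Re (tr (\<rho> * (adj X * X)))"
    and "Re (tr (\<rho> * (adj (P t X) * P t X))) = Re (tr (\<rho> * (adj X * X))) \<Longrightarrow> P t (adj X * X) = adj (P t X) * P t X"
proof -
  let ?D = "P t (adj X * X) - adj (P t X) * P t X"
  have KS: "psd n ?D" using Kadison_Schwarz[OF P_ucp[OF assms(2)] assms(1)] .
  have "tr (\<rho> * ?D) = tr (\<rho> * (adj X * X)) - tr (\<rho> * (adj (P t X) * P t X))"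
    using assms by (simp add: M_distrib tr_minus inv)
  then have e: "Re (tr (\<rho> * ?D)) = Re (tr (\<rho> * (adj X * X))) - Re (tr (\<rho> * (adj (P t X) * P t X)))" by simp
  show "Re (tr (\<rho> * (adj (P t X) * P t X))) \<le> Re (tr (\<rho> * (adj X * X)))"
    using tr_psd_mult[OF pdD[OF rho] KS] e by simp
  assume "Re (tr (\<rho> * (adj (P t X) * P t X))) = Re (tr (\<rho> * (adj X * X)))"
  then have "?D = 0\<^sub>m n n" using tr_pd_mult_zero[OF rho KS] e by simp
  then show "P t (adj X * X) = adj (P t X) * P t X" by (rule minus_zeroD[rotated 2]) (use assms in simp_all)
qed

lemma q_P_le: assumes "X \<in> M" "0 \<le> t" shows "q (P t X) \<le> q X"
  using q_terms_decrease(1)[OF assms] q_terms_decrease(1)[of "adj X" t] assms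
  by (simp add: q_def P_adj)

lemma q_mono: assumes "X \<in> M" "0 \<le> s" "s \<le> t" shows "q (P t X) \<le> q (P s X)"
  using q_P_le[of "P s X" "t - s"] assms by (simp add: sg_add)

lemma N_iff_q: "X \<in> M \<Longrightarrow> X \<in> N \<longleftrightarrow> (\<forall>t\<ge>0. q (P t X) = q X)"
proof
  assume X: "X \<in> M" "X \<in> N"
  show "\<forall>t\<ge>0. q (P t X) = q X"
    using N_D[OF X(2)] X(1) inv[of _ "adj X * X"] inv[of _ "X * adj X"] by (auto simp: q_def)
next
  assume X: "X \<in> M" "\<forall>t\<ge>0. q (P t X) = q X"
  have *: "P t (adj X * X) = adj (P t X) * P t X \<and> P t (X * adj X) = P t X * adj (P t X)" if t: "0 \<le> t" for t
  proof -
    have "q (P t X) = q X" using X t by simp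
    then have "Re (tr (\<rho> * (adj (P t X) * P t X))) = Re (tr (\<rho> * (adj X * X)))"
      "Re (tr (\<rho> * (adj (P t (adj X)) * P t (adj X)))) = Re (tr (\<rho> * (adj (adj X) * adj X)))"
      using q_terms_decrease(1)[OF X(1) t] q_terms_decrease(1)[of "adj X" t] X(1) t
      by (simp_all add: q_def P_adj)
    then show ?thesis using q_terms_decrease(2)[OF X(1) t] q_terms_decrease(2)[of "adj X" t] X t by (simp add: P_adj)
  qed
  show "X \<in> N" using X * by (intro N_I) auto
qed

lemma mlim_q: assumes "\<And>t. X t \<in> M" "Y \<in> M" "mlim X Y F" shows "((\<lambda>t. q (X t)) \<longlongrightarrow> q Y) F"
  unfolding q_def
  by (intro tendsto_add tendsto_Re mlim_tr mlim_mult mlim_adj mlim_const) (use assms in auto)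

text \<open>On \<open>N\<close> the function \<open>q\<close> is constant in time, and along a null
  orbit it tends to zero. The uniqueness and the bimodule property of \<open>E\<close> rest on
  this.\<close>

lemma N_cap_null: assumes "D \<in> N" "mlim (\<lambda>t. P t D) (0\<^sub>m n n) at_top" shows "D = 0\<^sub>m n n"
proof -
  note d = N_M[OF assms(1)]
  have "((\<lambda>t. q (P t D)) \<longlongrightarrow> q (0\<^sub>m n n)) at_top" by (rule mlim_q) (use assms d in auto)
  moreover have "((\<lambda>t. q (P t D)) \<longlongrightarrow> q D) at_top"
    by (rule tendsto_eventually) (use assms N_iff_q d in \<open>auto simp: eventually_at_top_linorder\<close>)
  ultimately have "q D = q (0\<^sub>m n n)" using tendsto_unique trivial_limit_at_top_linorder by blast
  then have "q D = 0" by (simp add: q_def)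
  then show ?thesis using q_zero d by blast
qed

lemma P_bounded: assumes "X \<in> M" obtains B where "\<And>t. 0 \<le> t \<Longrightarrow> nrm (P t X) \<le> B"
proof -
  obtain \<delta> where d: "0 < \<delta>" "\<And>X. X \<in> M \<Longrightarrow> \<delta> * (nrm X)\<^sup>2 \<le> q X" using q_lower by metis
  have "nrm (P t X) \<le> sqrt (q X / \<delta>)" if "0 \<le> t" for t
  proof (rule real_le_rsqrt)
    have "\<delta> * (nrm (P t X))\<^sup>2 \<le> q X" using d(2)[of "P t X"] q_P_le[OF assms that] assms by simp
    then show "(nrm (P t X))\<^sup>2 \<le> q X / \<delta>" using d(1) by (simp add: field_simps)
  qed
  then show ?thesis using that by blast
qed

lemma null_of_q:
  assumes X: "X \<in> M" and lim: "((\<lambda>t. q (P t X)) \<longlongrightarrow> 0) at_top" shows "mlim (\<lambda>t. P t X) (0\<^sub>m n n) at_top"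
proof (rule mlim_nrm_zero)
  obtain \<delta> where d: "0 < \<delta>" "\<And>X. X \<in> M \<Longrightarrow> \<delta> * (nrm X)\<^sup>2 \<le> q X" using q_lower by metis
  have "((\<lambda>t. sqrt (q (P t X) / \<delta>)) \<longlongrightarrow> sqrt (0 / \<delta>)) at_top" using d(1) by (intro tendsto_intros lim) auto
  then have s0: "((\<lambda>t. sqrt (q (P t X) / \<delta>)) \<longlongrightarrow> 0) at_top" by simp
  have le: "nrm (P t X) \<le> sqrt (q (P t X) / \<delta>)" for t
    by (rule real_le_rsqrt) (use d(1) d(2)[of "P t X"] X in \<open>simp add: field_simps\<close>)
  show "((\<lambda>t. nrm (P t X)) \<longlongrightarrow> 0) at_top"
    by (rule tendsto_sandwich[OF _ _ tendsto_const s0]) (simp_all add: le)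
qed

text \<open>If \<open>P (r k) \<rightarrow> Q\<close> and the gaps of \<open>r\<close> tend to infinity, then a limit point \<open>E\<close> of
  \<open>P (r (k + 1) - r k)\<close> satisfies \<open>E Q = Q\<close>; this makes \<open>E\<close> the projection onto \<open>N\<close> along
  the matrices that \<open>P\<close> sends to zero.\<close>
lemma exists_projection:
  obtains E where "lin_map n E" "\<And>X. X \<in> M \<Longrightarrow> E X \<in> N" "\<And>X. psd n X \<Longrightarrow> psd n (E X)"
    "\<And>X. X \<in> M \<Longrightarrow> mlim (\<lambda>t. P t (X - E X)) (0\<^sub>m n n) at_top"
proof -
  have lin: "lin_map n (P (real k))" for k :: nat by (simp add: P_lin)
  have bd: "\<exists>B. \<forall>k. nrm (P (f k) X) \<le> B" if "X \<in> M" "\<And>k. 0 \<le> f k" for X and f :: "nat \<Rightarrow> real"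
    using P_bounded[OF that(1)] that(2) by metis
  obtain r0 Q where r0: "strict_mono r0" and Q: "lin_map n Q" "\<And>X. X \<in> M \<Longrightarrow> mlim (\<lambda>k. P (real (r0 k)) X) (Q X) sequentially"
    using superop_compact[of "\<lambda>k. P (real k)"] lin bd[of _ real] by auto
  \<comment> \<open>Thinning by squares makes the gaps grow: \<open>r0\<close> is strictly
    increasing, so \<open>r (Suc k) - r k\<close> is at least
    \<open>(k + 1)^2 - k^2 = 2k + 1\<close>.\<close>
  define r where "r k = r0 (k\<^sup>2)" for k
  have sq: "strict_mono (\<lambda>k::nat. k\<^sup>2)" by (auto simp: strict_mono_def power_strict_mono)
  have r: "strict_mono r" using r0 sq by (auto simp: strict_mono_def r_def)
  have Qr: "mlim (\<lambda>k. P (real (r k)) X) (Q X) sequentially" if "X \<in> M" for X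
    unfolding mlim_def r_def
    using LIMSEQ_subseq_LIMSEQ[OF mlimD[OF Q(2)[OF that]] sq] by (auto simp: o_def)
  define s where "s k = r (Suc k) - r k" for k
  have s_ge: "k \<le> s k" for k
  proof -
    have "r0 a + d \<le> r0 (a + d)" for a d
      by (induction d) (use r0 in \<open>auto simp: strict_mono_Suc_iff le_trans Suc_le_eq intro: le_less_trans\<close>)
    moreover have "(Suc k)\<^sup>2 = k\<^sup>2 + (2 * k + 1)" by (simp add: power2_eq_square)
    ultimately have "r k + (2 * k + 1) \<le> r (Suc k)" by (simp only: r_def)
    then show ?thesis by (simp add: s_def)
  qed
  have sr: "s k + r k = r (Suc k)" for k using r by (simp add: s_def strict_mono_less_eq)
  obtain h E where h: "strict_mono h" and E: "lin_map n E" "\<And>X. X \<in> M \<Longrightarrow> mlim (\<lambda>k. P (real (s (h k))) X) (E X) sequentially"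
    using superop_compact[of "\<lambda>k. P (real (s k))"] P_lin bd[of _ "\<lambda>k. real (s k)"] by auto
  have EM: "E X \<in> M" "Q X \<in> M" if "X \<in> M" for X using that E(1) Q(1) lin_closed by auto
  \<comment> \<open>\<open>P (s (h k))\<close> applied to \<open>P (r (h k)) X\<close> is
    \<open>P (r (Suc (h k))) X\<close>; the first form tends to \<open>E (Q X)\<close>, the second
    to \<open>Q X\<close>.\<close>
  have EQ: "E (Q X) = Q X" if X: "X \<in> M" for X
  proof (rule mlim_unique)
    have Qh: "mlim (\<lambda>k. P (real (r (h k))) X) (Q X) sequentially"
      unfolding mlim_def using LIMSEQ_subseq_LIMSEQ[OF mlimD[OF Qr[OF X]] h] by (auto simp: o_def)
    show "mlim (\<lambda>k. P (real (s (h k))) (P (real (r (h k))) X)) (E (Q X)) sequentially"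
      by (rule mlim_superop[OF _ E(1,2) _ _ Qh]) (use X EM P_lin in auto)
    have h': "strict_mono (\<lambda>k. Suc (h k))" using h by (simp add: strict_mono_def)
    have "mlim (\<lambda>k. P (real (r (Suc (h k)))) X) (Q X) sequentially"
      unfolding mlim_def using LIMSEQ_subseq_LIMSEQ[OF mlimD[OF Qr[OF X]] h'] by (auto simp: o_def)
    then show "mlim (\<lambda>k. P (real (s (h k))) (P (real (r (h k))) X)) (Q X) sequentially"
      using X by (simp add: sg_add flip: sr)
  qed (use EM X in auto)
  have PQ: "P t (Q X) = Q (P t X)" if X: "X \<in> M" and t: "0 \<le> t" for X t
  proof (rule mlim_unique)
    show "mlim (\<lambda>k. P t (P (real (r k)) X)) (P t (Q X)) sequentially"
      by (rule mlim_lin[OF P_lin[OF t] _ _ Qr[OF X]]) (use X EM in auto)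
    show "mlim (\<lambda>k. P t (P (real (r k)) X)) (Q (P t X)) sequentially"
      using Qr[of "P t X"] X by (simp add: sg_add add.commute)
  qed (use EM X in auto)
  \<comment> \<open>\<open>Q\<close> commutes with the semigroup, so
    \<open>Q (P (s (h k)) X)\<close> is \<open>P (s (h k)) (Q X)\<close>, which tends to
    \<open>E (Q X) = Q X\<close>.\<close>
  have QE: "Q (E X) = Q X" if X: "X \<in> M" for X
  proof (rule mlim_unique)
    show "mlim (\<lambda>k. Q (P (real (s (h k))) X)) (Q (E X)) sequentially"
      by (rule mlim_lin[OF Q(1) _ _ E(2)[OF X]]) (use X EM in auto)
    show "mlim (\<lambda>k. Q (P (real (s (h k))) X)) (Q X) sequentially"
      using E(2)[of "Q X"] EQ[OF X] X EM by (simp add: PQ)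
  qed (use EM X in auto)
  have s_le: "q (E X) \<le> q (P v X)" if X: "X \<in> M" and v: "0 \<le> v" for X v
  proof (rule LIMSEQ_le_const2)
    show "(\<lambda>k. q (P (real (s (h k))) X)) \<longlonglongrightarrow> q (E X)" by (rule mlim_q) (use X EM E in auto)
    obtain k0 :: nat where k0: "v \<le> real k0" using real_arch_simple by blast
    have "q (P (real (s (h k))) X) \<le> q (P v X)" if "k0 \<le> k" for k
    proof (rule q_mono[OF X v])
      have "k \<le> h k" using h by (simp add: strict_mono_imp_increasing)
      then have "k0 \<le> s (h k)" using that s_ge[of "h k"] by linarith
      then show "v \<le> real (s (h k))" using k0 by linarith
    qed
    then show "\<exists>N. \<forall>k\<ge>N. q (P (real (s (h k))) X) \<le> q (P v X)" by blast
  qed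
  \<comment> \<open>\<open>q (E X)\<close> is a lower bound of \<open>q\<close> along the orbit of
    \<open>X\<close>. At the times \<open>u + s (h k)\<close> this passes to the limit and bounds
    \<open>q (P u (E X))\<close> from below, so \<open>q\<close> cannot drop.\<close>
  have EN: "E X \<in> N" if X: "X \<in> M" for X
    unfolding N_iff_q[OF EM(1)[OF X]]
  proof (intro allI impI antisym)
    fix u :: real assume u: "0 \<le> u"
    show "q (P u (E X)) \<le> q (E X)" using q_P_le EM X u by blast
    have "(\<lambda>k. q (P u (P (real (s (h k))) X))) \<longlonglongrightarrow> q (P u (E X))"
      by (rule mlim_q[OF _ _ mlim_lin[OF P_lin[OF u] _ _ E(2)[OF X]]]) (use X EM in auto)
    moreover have "q (E X) \<le> q (P u (P (real (s (h k))) X))" for k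
      using s_le[OF X, of "u + real (s (h k))"] X u by (simp add: sg_add)
    ultimately show "q (E X) \<le> q (P u (E X))" by (intro LIMSEQ_le_const) auto
  qed
  \<comment> \<open>\<open>Q (X - E X) = 0\<close> makes \<open>q\<close> small at the times
    \<open>r k\<close>; monotonicity extends this to all later times.\<close>
  have null: "mlim (\<lambda>t. P t (X - E X)) (0\<^sub>m n n) at_top" if X: "X \<in> M" for X
  proof (rule null_of_q)
    let ?Y = "X - E X"
    have Y: "?Y \<in> M" using X EM by simp
    then show "?Y \<in> M" .
    have "Q ?Y = 0\<^sub>m n n" using lin_minus[OF Q(1) X EM(1)[OF X]] QE[OF X] EM[OF X] by (simp add: minus_r_inv_mat)
    then have "(\<lambda>k. q (P (real (r k)) ?Y)) \<longlonglongrightarrow> q (0\<^sub>m n n)"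
      using Qr[OF Y] Y by (intro mlim_q) auto
    then have lim: "(\<lambda>k. q (P (real (r k)) ?Y)) \<longlonglongrightarrow> 0" by (simp add: q_def)
    show "((\<lambda>t. q (P t ?Y)) \<longlongrightarrow> 0) at_top"
      unfolding tendsto_iff
    proof (intro allI impI)
      fix e :: real assume e: "0 < e"
      then obtain k where "dist (q (P (real (r k)) ?Y)) 0 < e"
        using lim unfolding lim_sequentially by blast
      then have k: "q (P (real (r k)) ?Y) < e" by simp
      have "dist (q (P t ?Y)) 0 < e" if "real (r k) \<le> t" for t
        using q_mono[OF Y, of "real (r k)" t] q_nonneg[of "P t ?Y"] Y k that by simp
      then show "\<forall>\<^sub>F t in at_top. dist (q (P t ?Y)) 0 < e" unfolding eventually_at_top_linorder by blast
    qed
  qed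
  have psdE: "psd n (E X)" if X: "psd n X" for X
    by (rule mlim_psd[OF _ _ E(2)]) (use X psdD EM P_ucp ucp_psd in auto)
  show ?thesis using that[OF E(1) EN psdE null] by blast
qed

section \<open>The conditional expectation: existence, uniqueness, module property\<close>

lemma null_minus:
  assumes "X \<in> M" "Y \<in> M" "mlim (\<lambda>t. P t X) (0\<^sub>m n n) at_top" "mlim (\<lambda>t. P t Y) (0\<^sub>m n n) at_top"
  shows "mlim (\<lambda>t. P t (X - Y)) (0\<^sub>m n n) at_top"
  unfolding mlim_def
proof (intro allI impI)
  fix i j assume ij: "i < n" "j < n"
  have "((\<lambda>t. P t X $$ (i,j) - P t Y $$ (i,j)) \<longlongrightarrow> 0\<^sub>m n n $$ (i,j) - 0\<^sub>m n n $$ (i,j)) at_top"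
    by (intro tendsto_diff mlimD[OF assms(3)] mlimD[OF assms(4)] ij)
  then have "((\<lambda>t. P t X $$ (i,j) - P t Y $$ (i,j)) \<longlongrightarrow> 0\<^sub>m n n $$ (i,j)) at_top" using ij by simp
  then show "((\<lambda>t. P t (X - Y) $$ (i,j)) \<longlongrightarrow> 0\<^sub>m n n $$ (i,j)) at_top"
  proof (rule Lim_transform_eventually)
    show "\<forall>\<^sub>F t in at_top. P t X $$ (i,j) - P t Y $$ (i,j) = P t (X - Y) $$ (i,j)"
      unfolding eventually_at_top_linorder
      using assms(1,2) ij by (intro exI[of _ 0]) (auto simp: lin_minus[OF P_lin] minus_ij)
  qed
qed

text \<open>Elements of \<open>N\<close> split off multiplicatively under \<open>P t\<close>, and
  their orbits stay bounded.\<close>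

lemma null_bimodule:
  assumes A: "A \<in> N" and B: "B \<in> N" and X: "X \<in> M" "mlim (\<lambda>t. P t X) (0\<^sub>m n n) at_top"
  shows "mlim (\<lambda>t. P t (A * X * B)) (0\<^sub>m n n) at_top"
proof (rule mlim_nrm_zero)
  note m = N_M[OF A] N_M[OF B]
  obtain a where a: "\<And>t. 0 \<le> t \<Longrightarrow> nrm (P t A) \<le> a" using P_bounded[OF m(1)] by blast
  obtain b where b: "\<And>t. 0 \<le> t \<Longrightarrow> nrm (P t B) \<le> b" using P_bounded[OF m(2)] by blast
  have ab: "0 \<le> a" "0 \<le> b" using order_trans[OF nrm_nonneg a[of 0]] order_trans[OF nrm_nonneg b[of 0]] by simp_all
  have le: "nrm (P t (A * X * B)) \<le> a * nrm (P t X) * b" if t: "0 \<le> t" for t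
  proof -
    have "P t (A * X * B) = P t A * P t X * P t B" using N_right[OF B, of "A * X" t] N_left[OF A X(1) t] t X m by simp
    then have "nrm (P t (A * X * B)) \<le> nrm (P t A * P t X) * nrm (P t B)" using nrm_mult_le m X by simp
    also have "\<dots> \<le> (nrm (P t A) * nrm (P t X)) * nrm (P t B)" using nrm_mult_le m X by (intro mult_right_mono) auto
    also have "\<dots> \<le> (a * nrm (P t X)) * b" using a[OF t] b[OF t] ab by (intro mult_mono) auto
    finally show ?thesis .
  qed
  have "((\<lambda>t. nrm (P t X)) \<longlongrightarrow> 0) at_top"
  proof -
    have "((\<lambda>t. tr (adj (P t X) * P t X)) \<longlongrightarrow> tr (adj (0\<^sub>m n n) * 0\<^sub>m n n)) at_top"
      by (intro mlim_tr mlim_mult mlim_adj) (use X in auto)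
    then have "((\<lambda>t. sqrt (Re (tr (adj (P t X) * P t X)))) \<longlongrightarrow> sqrt (Re 0)) at_top"
      by (intro tendsto_real_sqrt tendsto_Re) simp
    then show ?thesis using X by (simp add: tr_adj_mult_self flip: of_real_power)
  qed
  then have "((\<lambda>t. a * nrm (P t X) * b) \<longlongrightarrow> a * 0 * b) at_top" by (intro tendsto_intros)
  then have lim: "((\<lambda>t. a * nrm (P t X) * b) \<longlongrightarrow> 0) at_top" by simp
  show "((\<lambda>t. nrm (P t (A * X * B))) \<longlongrightarrow> 0) at_top"
    by (rule tendsto_sandwich[OF _ _ tendsto_const lim])
      (use le in \<open>auto simp: eventually_at_top_linorder\<close>)
qed

definition isE :: "(complex mat \<Rightarrow> complex mat) \<Rightarrow> bool" where
  "isE E \<longleftrightarrow> cond_exp n N E \<and> (\<forall>X. X \<notin> M \<longrightarrow> E X = 0\<^sub>m n n) \<and>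
     (\<forall>X\<in>M. \<forall>i<n. \<forall>j<n. ((\<lambda>t. P t (X - E X) $$ (i,j)) \<longlongrightarrow> 0) at_top)"

lemma isE_null: assumes "isE E" "X \<in> M" shows "mlim (\<lambda>t. P t (X - E X)) (0\<^sub>m n n) at_top"
  using assms by (auto simp: isE_def mlim_def)

text \<open>Both the fixing of \<open>N\<close> and the module property are obtained in one way: the
  difference of the two sides lies in \<open>N\<close> and is sent to zero, hence vanishes by
  \<open>N_cap_null\<close>. The value zero outside the matrices is the normalisation built into
  \<open>EN\<close>.\<close>

lemma isE_exists: "\<exists>E. isE E"
proof -
  obtain E where E: "lin_map n E" "\<And>X. X \<in> M \<Longrightarrow> E X \<in> N" "\<And>X. psd n X \<Longrightarrow> psd n (E X)"
    "\<And>X. X \<in> M \<Longrightarrow> mlim (\<lambda>t. P t (X - E X)) (0\<^sub>m n n) at_top"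
    by (rule exists_projection) blast
  have EM: "E X \<in> M" if "X \<in> M" for X using that E(2) N_M by blast
  define E' where "E' X = (if X \<in> M then E X else 0\<^sub>m n n)" for X
  have fixE: "E A = A" if A: "A \<in> N" for A
  proof -
    have "A - E A = 0\<^sub>m n n" using A E N_M by (intro N_cap_null) (auto intro: N_minus)
    then show ?thesis by (rule minus_zeroD[rotated 2, symmetric]) (use N_M[OF A] EM[OF N_M[OF A]] in simp_all)
  qed
  have bim: "E (A * X * B) = A * E X * B" if A: "A \<in> N" and B: "B \<in> N" and X: "X \<in> M" for A B X
  proof -
    note m = N_M[OF A] N_M[OF B] X EM[OF X]
    let ?Y = "A * X * B"
    have Y: "?Y \<in> M" "E ?Y \<in> M" using m EM by auto
    let ?D = "(?Y - A * E X * B) - (?Y - E ?Y)"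
    have "mlim (\<lambda>t. P t (A * (X - E X) * B)) (0\<^sub>m n n) at_top" by (rule null_bimodule) (use A B m E in auto)
    then have "mlim (\<lambda>t. P t (?Y - A * E X * B)) (0\<^sub>m n n) at_top" using m by (simp add: M_distrib)
    then have "mlim (\<lambda>t. P t ?D) (0\<^sub>m n n) at_top" using Y m E(4)[OF Y(1)]
      by (intro null_minus[of "?Y - A * E X * B" "?Y - E ?Y"]) auto
    moreover have eq: "?D = E ?Y - A * E X * B" using m Y by (intro M_eqI) (auto simp: minus_ij)
    moreover have "E ?Y - A * E X * B \<in> N" using A B E(2)[OF X] E(2)[OF Y(1)] by (intro N_minus N_mult)
    ultimately have "E ?Y - A * E X * B = 0\<^sub>m n n" using N_cap_null by simp
    then show ?thesis by (rule minus_zeroD[rotated 2]) (use m Y in simp_all)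
  qed
  have "lin_map n E'" using E(1) by (simp add: lin_map_def E'_def)
  then have "cond_exp n N E'" unfolding cond_exp_def using E fixE bim N_M psdD(1) by (auto simp: E'_def)
  moreover have "\<forall>X\<in>M. \<forall>i<n. \<forall>j<n. ((\<lambda>t. P t (X - E' X) $$ (i,j)) \<longlongrightarrow> 0) at_top"
    using E(4) by (auto simp: E'_def mlim_def)
  ultimately have "isE E'" by (simp add: isE_def E'_def)
  then show ?thesis by blast
qed

lemma isE_unique: assumes "isE E" "isE E'" shows "E = E'"
proof
  fix X
  show "E X = E' X"
  proof (cases "X \<in> M")
    case True
    have m: "E X \<in> N" "E' X \<in> N" using assms True by (auto simp: isE_def cond_exp_def)
    note mm = N_M[OF m(1)] N_M[OF m(2)]
    let ?D = "(X - E' X) - (X - E X)"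
    have "mlim (\<lambda>t. P t ?D) (0\<^sub>m n n) at_top"
      using isE_null[OF assms(1) True] isE_null[OF assms(2) True] True mm by (intro null_minus[of "X - E' X" "X - E X"]) auto
    moreover have "?D = E X - E' X" using mm True by (intro M_eqI) (auto simp: minus_ij)
    ultimately have "E X - E' X = 0\<^sub>m n n" using N_cap_null N_minus[OF m] by simp
    then show ?thesis by (rule minus_zeroD[rotated 2]) (use mm in simp_all)
  qed (use assms in \<open>auto simp: isE_def\<close>)
qed

abbreviation E :: "complex mat \<Rightarrow> complex mat" where "E \<equiv> EN n L"

lemma E_isE: "isE E"
proof -
  have "E = (THE E. isE E)" by (simp add: EN_def isE_def)
  moreover have "\<exists>!E. isE E" using isE_exists isE_unique by blast
  ultimately show ?thesis by (metis theI')
qed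

lemma E_lin: "lin_map n E" and E_N: "X \<in> M \<Longrightarrow> E X \<in> N" and E_fix: "A \<in> N \<Longrightarrow> E A = A"
  and E_psd: "psd n X \<Longrightarrow> psd n (E X)"
  and E_bimodule: "A \<in> N \<Longrightarrow> B \<in> N \<Longrightarrow> X \<in> M \<Longrightarrow> E (A * X * B) = A * E X * B"
  using E_isE by (auto simp: isE_def cond_exp_def)

lemma E_closed [simp]: "X \<in> M \<Longrightarrow> E X \<in> M" by (simp add: E_N N_M)

text \<open>\<open>X - E X\<close> decays while its pairing with \<open>\<rho>\<close> is constant.
  This carries faithfulness over from \<open>\<rho>\<close> to \<open>\<sigma>\<close>.\<close>

lemma rho_E: assumes X: "X \<in> M" shows "tr (\<rho> * E X) = tr (\<rho> * X)"
proof -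
  have "((\<lambda>t. tr (\<rho> * P t (X - E X))) \<longlongrightarrow> tr (\<rho> * 0\<^sub>m n n)) at_top"
    by (intro mlim_tr mlim_mult mlim_const isE_null[OF E_isE]) (use X in auto)
  moreover have "((\<lambda>t. tr (\<rho> * P t (X - E X))) \<longlongrightarrow> tr (\<rho> * (X - E X))) at_top"
    by (rule tendsto_eventually) (use X inv in \<open>auto simp: eventually_at_top_linorder intro!: exI[of _ 0]\<close>)
  ultimately have "tr (\<rho> * (X - E X)) = tr (\<rho> * 0\<^sub>m n n)" using tendsto_unique trivial_limit_at_top_linorder by blast
  then show ?thesis using X by (simp add: M_distrib tr_minus)
qed

section \<open>The matrix \<open>\<sigma>\<close>: existence, commutation with \<open>N\<close>,
  definiteness\<close>

abbreviation \<sigma> :: "complex mat" where "\<sigma> \<equiv> sigTr n L"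

lemma tr_nondegenerate:
  assumes "A \<in> M" "B \<in> M" "\<And>X. X \<in> M \<Longrightarrow> tr (A * X) = tr (B * X)" shows "A = B"
proof -
  let ?D = "A - B"
  have "tr (?D * adj ?D) = 0" using assms by (simp add: M_distrib(4) tr_minus)
  then have "tr (adj (adj ?D) * adj ?D) = 0" by simp
  then have "nrm (adj ?D) = 0" using assms by (subst (asm) tr_adj_mult_self) auto
  then have "nrm ?D = 0" using assms by (simp add: nrm_adj)
  then have "?D = 0\<^sub>m n n" using assms nrm_eq_0 by simp
  then show ?thesis by (rule minus_zeroD[rotated 2]) (use assms in simp_all)
qed

lemma sigma_prop: "\<sigma> \<in> M" "X \<in> M \<Longrightarrow> tr (\<sigma> * X) = tr (E X) / of_nat n"
proof -
  define Q where "Q s \<longleftrightarrow> s \<in> M \<and> (\<forall>X\<in>M. tr (s * X) = tr ((1 / of_nat n) \<cdot>\<^sub>m 1\<^sub>m n * E X))" for s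
  have e: "tr ((1 / of_nat n) \<cdot>\<^sub>m 1\<^sub>m n * E X) = tr (E X) / of_nat n" if "X \<in> M" for X
    using that by (simp add: M_smult tr_smult)
  have "\<exists>s. Q s"
  proof
    \<comment> \<open>The indices are transposed because \<open>tr (s * Eu j i)\<close> is the entry
      \<open>(i,j)\<close> of \<open>s\<close>.\<close>
    define s where "s = mat n n (\<lambda>(i,j). tr (E (Eu j i)) / of_nat n)"
    have s: "s \<in> M" by (simp add: s_def)
    have "tr (s * X) = tr (E X) / of_nat n" if X: "X \<in> M" for X
    proof -
      have "tr (E X) = (\<Sum>i<n. \<Sum>(k,l)\<in>{..<n}\<times>{..<n}. X $$ (k,l) * E (Eu k l) $$ (i,i))"
        unfolding tr_sum[OF E_closed[OF X]] by (intro sum.cong refl lin_expand[OF E_lin X]) auto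
      also have "\<dots> = (\<Sum>(k,l)\<in>{..<n}\<times>{..<n}. X $$ (k,l) * tr (E (Eu k l)))"
        unfolding case_prod_beta by (subst sum.swap) (simp add: tr_sum[of "E (Eu _ _)"] sum_distrib_left)
      also have "\<dots> = (\<Sum>k<n. \<Sum>l<n. X $$ (k,l) * tr (E (Eu k l)))" by (simp add: sum.cartesian_product)
      finally have 1: "tr (E X) = (\<Sum>k<n. \<Sum>l<n. X $$ (k,l) * tr (E (Eu k l)))" .
      have "tr (s * X) = (\<Sum>k<n. \<Sum>l<n. X $$ (k,l) * s $$ (l,k))"
        unfolding tr_comm[OF s X] tr_mult[OF X s] ..
      also have "\<dots> = (\<Sum>k<n. \<Sum>l<n. X $$ (k,l) * tr (E (Eu k l))) / of_nat n"
        by (simp add: s_def sum_divide_distrib)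
      finally show ?thesis using 1 by simp
    qed
    then show "Q s" using s e by (simp add: Q_def)
  qed
  moreover have "s = s'" if "Q s" "Q s'" for s s'
    using that by (intro tr_nondegenerate) (auto simp: Q_def)
  ultimately have "\<exists>!s. Q s" by blast
  moreover have "\<sigma> = (THE s. Q s)" by (simp add: sigTr_def Q_def)
  ultimately have "Q \<sigma>" by (metis theI')
  then show "\<sigma> \<in> M" "X \<in> M \<Longrightarrow> tr (\<sigma> * X) = tr (E X) / of_nat n" using e by (auto simp: Q_def)
qed

lemma sigma_E: "X \<in> M \<Longrightarrow> tr (\<sigma> * E X) = tr (\<sigma> * X)"
  by (simp add: sigma_prop E_fix E_N)

text \<open>By the module property both sides, paired with \<open>X\<close>, become the trace of a
  product of \<open>A\<close> and \<open>E X\<close>, and the trace does not see the order.\<close>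

lemma sigma_commute: assumes A: "A \<in> N" shows "\<sigma> * A = A * \<sigma>"
proof (rule tr_nondegenerate)
  note a = N_M[OF A] and s = sigma_prop(1)
  show "\<sigma> * A \<in> M" "A * \<sigma> \<in> M" using a s by auto
  fix X assume X: "X \<in> M"
  have "tr (\<sigma> * A * X) = tr (E (A * X * 1\<^sub>m n)) / of_nat n" using a s X by (simp add: M_assoc sigma_prop)
  also have "\<dots> = tr (A * E X) / of_nat n" using E_bimodule[OF A N_one X] X a by simp
  also have "\<dots> = tr (E X * A) / of_nat n" using tr_comm[of A "E X"] a X by simp
  also have "\<dots> = tr (E (1\<^sub>m n * X * A)) / of_nat n" using E_bimodule[OF N_one A X] X a by simp
  also have "\<dots> = tr (\<sigma> * (X * A))" using a X by (simp add: sigma_prop)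
  also have "\<dots> = tr (A * \<sigma> * X)" using tr_comm[of A "\<sigma> * X"] a s X by (simp add: M_assoc)
  finally show "tr (\<sigma> * A * X) = tr (A * \<sigma> * X)" .
qed

text \<open>If \<open>tr (\<sigma> * X)\<close> vanishes for a positive \<open>X\<close>, then
  \<open>tr (E X) = 0\<close>, so \<open>E X = 0\<close>, so \<open>tr (\<rho> * X) = 0\<close>,
  which forces \<open>X = 0\<close> as \<open>\<rho>\<close> is definite.\<close>

lemma sigma_pd: assumes n: "0 < n" shows "pd n \<sigma>"
proof -
  note s = sigma_prop(1)
  have nonneg: "0 \<le> Re (tr (\<sigma> * X)) \<and> Im (tr (\<sigma> * X)) = 0" if X: "psd n X" for X
  proof -
    have "0 \<le> Re (tr (E X))" "Im (tr (E X)) = 0"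
      using psdD(4)[OF E_psd[OF X], of "1\<^sub>m n"] tr_herm_real[OF psdD(3)[OF E_psd[OF X]], of "1\<^sub>m n"] X psdD(1)[OF X] by auto
    then show ?thesis using psdD(1)[OF X] by (simp add: sigma_prop)
  qed
  have conj: "tr (adj S * \<sigma> * S) = tr (\<sigma> * (S * adj S))" if "S \<in> M" for S
    using tr_comm[of "adj S" "\<sigma> * S"] that s by (simp add: M_assoc)
  have herm: "herm \<sigma>"
  proof -
    have "adj \<sigma> - \<sigma> = 0\<^sub>m n n"
    proof (rule form_zero)
      fix T assume T: "T \<in> M"
      have "tr (adj T * adj \<sigma> * T) = cnj (tr (adj T * \<sigma> * T))"
        using T s by (subst tr_adj[symmetric]) (simp_all add: adj_mult M_assoc)
      also have "\<dots> = tr (adj T * \<sigma> * T)"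
        unfolding conj[OF T] using nonneg[of "T * adj T"] psd_adj_mult[of "adj T"] T by (simp add: complex_eq_iff)
      finally show "tr (adj T * (adj \<sigma> - \<sigma>) * T) = 0" using T s by (simp add: M_distrib tr_minus)
    qed (use s in simp)
    then have "adj \<sigma> = \<sigma>" by (rule minus_zeroD[rotated 2]) (use s in simp_all)
    then show ?thesis using s by (simp add: herm_def)
  qed
  show ?thesis unfolding pd_iff
  proof (intro conjI ballI impI herm)
    fix S assume S: "S \<in> M" "S \<noteq> 0\<^sub>m n n"
    let ?X = "S * adj S"
    have X: "psd n ?X" "?X \<in> M" using psd_adj_mult[of "adj S"] S by auto
    have "Re (tr (\<sigma> * ?X)) \<noteq> 0"
    proof
      assume "Re (tr (\<sigma> * ?X)) = 0"
      then have "Re (tr (1\<^sub>m n * E ?X)) = 0" using X n by (simp add: sigma_prop)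
      moreover have "pd n (1\<^sub>m n)"
        unfolding pd_iff
      proof (intro conjI ballI impI)
        show "herm (1\<^sub>m n)" by (simp add: herm_def)
        show "0 < Re (tr (adj S * 1\<^sub>m n * S))" if "S \<in> M" "S \<noteq> 0\<^sub>m n n" for S
          using that nrm_eq_0[OF that(1)] by (auto simp: tr_adj_mult_self simp flip: of_real_power)
      qed
      ultimately have "E ?X = 0\<^sub>m n n" using tr_pd_mult_zero E_psd[OF X(1)] by blast
      then have "tr (\<rho> * ?X) = 0" using rho_E[OF X(2)] by simp
      then have "tr (adj S * \<rho> * S) = 0" using tr_comm[of "adj S" "\<rho> * S"] S by (simp add: M_assoc)
      then show False using rho S unfolding pd_iff by force
    qed
    then show "0 < Re (tr (adj S * \<sigma> * S))" using nonneg[OF X(1)] conj[OF S(1)] by simp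
  qed
qed

text \<open>\<open>E\<close> is positive and fixes the identity, so it preserves a lower bound
  \<open>\<delta>\<close> on the spectrum.\<close>

lemma E_pd: assumes X: "pd n X" shows "pd n (E X)"
proof -
  note x = psdD(1)[OF pdD[OF X]]
  obtain \<delta> where d: "0 < \<delta>" "psd n (X - complex_of_real \<delta> \<cdot>\<^sub>m 1\<^sub>m n)" using pd_lower_bound[OF X] by blast
  have e: "E (X - complex_of_real \<delta> \<cdot>\<^sub>m 1\<^sub>m n) = E X - complex_of_real \<delta> \<cdot>\<^sub>m 1\<^sub>m n"
    using x by (simp add: lin_minus[OF E_lin] lin_smult[OF E_lin] E_fix N_one)
  have p: "psd n (E X - complex_of_real \<delta> \<cdot>\<^sub>m 1\<^sub>m n)" using E_psd[OF d(2)] e by simp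
  show ?thesis unfolding pd_iff
  proof (intro conjI ballI impI)
    show "herm (E X)" using E_psd[OF pdD[OF X]] psdD(3) by blast
    fix S assume S: "S \<in> M" "S \<noteq> 0\<^sub>m n n"
    have "0 \<le> Re (tr (adj S * (E X - complex_of_real \<delta> \<cdot>\<^sub>m 1\<^sub>m n) * S))" using psdD(4)[OF p S(1)] .
    also have "\<dots> = Re (tr (adj S * E X * S)) - \<delta> * (nrm S)\<^sup>2"
      using S x by (simp add: M_distrib M_smult tr_minus tr_smult tr_adj_mult_self flip: of_real_power of_real_mult)
    finally have "\<delta> * (nrm S)\<^sup>2 \<le> Re (tr (adj S * E X * S))" by simp
    moreover have "0 < \<delta> * (nrm S)\<^sup>2" using d(1) nrm_eq_0[OF S(1)] S(2) by (auto intro!: mult_pos_pos)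
    ultimately show "0 < Re (tr (adj S * E X * S))" by linarith
  qed
qed

end

section \<open>The three lines theorem\<close>

text \<open>The factor \<open>exp (\<epsilon> (z^2 - 1))\<close> has modulus at most 1 on the strip
  and decays as \<open>|Im z|\<close> grows, so the maximum principle on a tall rectangle suffices;
  then \<open>\<epsilon>\<close> tends to 0.\<close>

lemma three_lines_normalised:
  fixes g :: "complex \<Rightarrow> complex"
  assumes hol: "g holomorphic_on UNIV"
    and bd: "\<And>z. 0 \<le> Re z \<Longrightarrow> Re z \<le> 1 \<Longrightarrow> cmod (g z) \<le> B"
    and l0: "\<And>z. Re z = 0 \<Longrightarrow> cmod (g z) \<le> 1" and l1: "\<And>z. Re z = 1 \<Longrightarrow> cmod (g z) \<le> 1"
    and th: "0 \<le> \<theta>" "\<theta> \<le> 1"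
  shows "cmod (g (of_real \<theta>)) \<le> 1"
proof -
  have eps: "cmod (g (of_real \<theta>)) * exp (\<epsilon> * (\<theta>\<^sup>2 - 1)) \<le> 1" if e: "0 < \<epsilon>" for \<epsilon>
  proof -
    define h where "h z = g z * exp (of_real \<epsilon> * (z\<^sup>2 - 1))" for z
    have hh: "h holomorphic_on A" for A
      unfolding h_def by (intro holomorphic_intros holomorphic_on_subset[OF hol]) auto
    have ne: "cmod (exp (of_real \<epsilon> * (z\<^sup>2 - 1))) = exp (\<epsilon> * ((Re z)\<^sup>2 - (Im z)\<^sup>2 - 1))" for z
      by (simp add: norm_exp_eq_Re power2_eq_square)
    have B0: "0 \<le> B" using order_trans[OF norm_ge_zero bd[of 0]] by simp
    \<comment> \<open>With this height
      \<open>B \<le> \<epsilon> R \<le> exp (\<epsilon> R^2)\<close>, so the damping beats the bound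
      \<open>B\<close> on the horizontal sides.\<close>
    define R where "R = 1 + B / \<epsilon>"
    have R1: "1 \<le> R" using B0 e by (simp add: R_def)
    have RB: "B * exp (- \<epsilon> * R\<^sup>2) \<le> 1"
    proof -
      have "B \<le> \<epsilon> * R" using e by (simp add: R_def field_simps)
      also have "\<dots> \<le> \<epsilon> * R\<^sup>2" using e R1 by (intro mult_left_mono) (auto simp: power2_eq_square)
      also have "\<dots> \<le> exp (\<epsilon> * R\<^sup>2)" using exp_ge_add_one_self[of "\<epsilon> * R\<^sup>2"] by linarith
      finally show ?thesis by (simp add: exp_minus field_simps)
    qed
    let ?S = "cbox (Complex 0 (- R)) (Complex 1 R)"
    have "cmod (h (of_real \<theta>)) \<le> 1"
    proof (rule maximum_modulus_frontier[of h ?S])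
      show "h holomorphic_on interior ?S" "continuous_on (closure ?S) h"
        using hh holomorphic_on_imp_continuous_on by blast+
      show "of_real \<theta> \<in> ?S" using th R1 by (auto simp: in_cbox_complex_iff)
      fix z assume "z \<in> frontier ?S"
      then have z: "z \<in> ?S" "z \<notin> box (Complex 0 (- R)) (Complex 1 R)" by (auto simp: frontier_cbox)
      have x: "0 \<le> Re z" "Re z \<le> 1" "- R \<le> Im z" "Im z \<le> R" using z(1) by (auto simp: in_cbox_complex_iff)
      have x2: "(Re z)\<^sup>2 \<le> 1" using x by (simp add: power_le_one)
      have "(Re z)\<^sup>2 - (Im z)\<^sup>2 - 1 \<le> 0" using x2 zero_le_power2[of "Im z"] by linarith
      then have d: "exp (\<epsilon> * ((Re z)\<^sup>2 - (Im z)\<^sup>2 - 1)) \<le> 1" using e by (simp add: mult_nonneg_nonpos)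
      consider "Re z = 0" | "Re z = 1" | "\<bar>Im z\<bar> = R" using z x by (fastforce simp: in_box_complex_iff)
      then show "cmod (h z) \<le> 1"
      proof cases
        case 3
        then have "(Im z)\<^sup>2 = R\<^sup>2" by (metis power2_abs)
        then have "exp (\<epsilon> * ((Re z)\<^sup>2 - (Im z)\<^sup>2 - 1)) \<le> exp (- \<epsilon> * R\<^sup>2)" 
          using x2 e by (simp add: algebra_simps)
        then have "cmod (h z) \<le> B * exp (- \<epsilon> * R\<^sup>2)"
          unfolding h_def norm_mult ne using bd[of z] x B0 by (intro mult_mono) auto
        then show ?thesis using RB by linarith
      next
        case 1
        show ?thesis unfolding h_def norm_mult ne using l0[OF 1] d by (simp add: mult_le_one)
      next
        case 2
        show ?thesis unfolding h_def norm_mult ne using l1[OF 2] d by (simp add: mult_le_one)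
      qed
    qed (rule bounded_cbox)
    then show ?thesis unfolding h_def norm_mult ne by simp
  qed
  have "((\<lambda>\<epsilon>. cmod (g (of_real \<theta>)) * exp (\<epsilon> * (\<theta>\<^sup>2 - 1))) \<longlongrightarrow> cmod (g (of_real \<theta>)) * exp (0 * (\<theta>\<^sup>2 - 1))) (at_right 0)"
    by (intro tendsto_intros)
  moreover have "\<forall>\<^sub>F \<epsilon> in at_right 0. cmod (g (of_real \<theta>)) * exp (\<epsilon> * (\<theta>\<^sup>2 - 1)) \<le> 1"
    using eps by (auto simp: eventually_at_right_field intro!: exI[of _ 1])
  ultimately show ?thesis using tendsto_upperbound[of _ _ "at_right (0::real)" 1] by fastforce
qed

text \<open>Entire functions bounded on the closed unit strip. The class is closed under sums and
  products, so traces of products of the matrix families below belong to it without any explicit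
  bound.\<close>

definition strip :: "(complex \<Rightarrow> complex) \<Rightarrow> bool" where
  "strip f \<longleftrightarrow> f holomorphic_on UNIV \<and> (\<exists>B. \<forall>z. 0 \<le> Re z \<longrightarrow> Re z \<le> 1 \<longrightarrow> cmod (f z) \<le> B)"

lemma strip_const: "strip (\<lambda>z. c)" by (auto simp: strip_def)

lemma strip_add: assumes "strip f" "strip g" shows "strip (\<lambda>z. f z + g z)"
proof -
  obtain B C where "\<forall>z. 0 \<le> Re z \<longrightarrow> Re z \<le> 1 \<longrightarrow> cmod (f z) \<le> B" "\<forall>z. 0 \<le> Re z \<longrightarrow> Re z \<le> 1 \<longrightarrow> cmod (g z) \<le> C"
    using assms by (auto simp: strip_def)
  then have "\<forall>z. 0 \<le> Re z \<longrightarrow> Re z \<le> 1 \<longrightarrow> cmod (f z + g z) \<le> B + C"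
    using norm_triangle_mono by blast
  then show ?thesis using assms by (auto simp: strip_def intro!: holomorphic_intros)
qed

lemma strip_mult: assumes "strip f" "strip g" shows "strip (\<lambda>z. f z * g z)"
proof -
  obtain B C where BC: "\<forall>z. 0 \<le> Re z \<longrightarrow> Re z \<le> 1 \<longrightarrow> cmod (f z) \<le> B" "\<forall>z. 0 \<le> Re z \<longrightarrow> Re z \<le> 1 \<longrightarrow> cmod (g z) \<le> C"
    using assms by (auto simp: strip_def)
  have "cmod (f z * g z) \<le> B * C" if "0 \<le> Re z" "Re z \<le> 1" for z
    unfolding norm_mult using BC that order_trans[OF norm_ge_zero] by (intro mult_mono) auto
  then show ?thesis using assms by (auto simp: strip_def intro!: holomorphic_intros)
qed

lemma strip_sum: "(\<And>i. i \<in> I \<Longrightarrow> strip (f i)) \<Longrightarrow> strip (\<lambda>z. \<Sum>i\<in>I. f i z)"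
  by (induction I rule: infinite_finite_induct) (auto simp: strip_const strip_add)

lemma strip_exp: "strip (\<lambda>z. exp (a + of_real b * z))"
proof -
  have "cmod (exp (a + of_real b * z)) \<le> exp (Re a + \<bar>b\<bar>)" if "0 \<le> Re z" "Re z \<le> 1" for z
  proof -
    have "b * Re z \<le> \<bar>b\<bar> * Re z" using that by (intro mult_right_mono) auto
    also have "\<dots> \<le> \<bar>b\<bar> * 1" using that by (intro mult_left_mono) auto
    finally show ?thesis by (simp add: norm_exp_eq_Re)
  qed
  then have "\<exists>B. \<forall>z. 0 \<le> Re z \<longrightarrow> Re z \<le> 1 \<longrightarrow> cmod (exp (a + of_real b * z)) \<le> B" by blast
  then show ?thesis unfolding strip_def by (intro conjI holomorphic_intros)
qed

lemma strip_powr: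
  assumes "0 \<le> x" shows "strip (\<lambda>z. complex_of_real x powr (a + of_real b * z))"
proof (cases "x = 0")
  case False
  then have "complex_of_real x powr (a + of_real b * z) = exp (a * of_real (ln x) + of_real (b * ln x) * z)" for z
    using assms by (simp add: powr_def Ln_of_real algebra_simps)
  then show ?thesis by (simp only: strip_exp)
qed (simp add: strip_const)

text \<open>Division by \<open>M0^(1-z) * M1^z\<close> normalises both boundary bounds to 1.\<close>

lemma three_lines_pos:
  assumes f: "strip f" and M: "0 < M0" "0 < M1"
    and l0: "\<And>z. Re z = 0 \<Longrightarrow> cmod (f z) \<le> M0" and l1: "\<And>z. Re z = 1 \<Longrightarrow> cmod (f z) \<le> M1"
    and th: "0 \<le> \<theta>" "\<theta> \<le> 1"
  shows "cmod (f (of_real \<theta>)) \<le> M0 powr (1 - \<theta>) * M1 powr \<theta>"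
proof -
  define k where "k z = exp (complex_of_real (- ln M0) + of_real (ln M0 - ln M1) * z)" for z
  define g where "g z = f z * k z" for z
  have sg: "strip g" unfolding g_def k_def by (intro strip_mult f strip_exp)
  have k: "cmod (k z) = M0 powr (Re z - 1) * M1 powr (- Re z)" for z
    using M by (simp add: k_def norm_exp_eq_Re powr_def exp_add[symmetric] algebra_simps)
  obtain B where B: "\<And>z. 0 \<le> Re z \<Longrightarrow> Re z \<le> 1 \<Longrightarrow> cmod (g z) \<le> B" using sg by (auto simp: strip_def)
  have "cmod (g (of_real \<theta>)) \<le> 1"
  proof (rule three_lines_normalised[OF _ B])
    show "g holomorphic_on UNIV" using sg by (simp add: strip_def)
    show "cmod (g z) \<le> 1" if "Re z = 0" for z
      using l0[OF that] that M by (simp add: g_def norm_mult k powr_minus field_simps)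
    show "cmod (g z) \<le> 1" if "Re z = 1" for z
      using l1[OF that] that M by (simp add: g_def norm_mult k powr_minus field_simps)
  qed (use th in auto)
  then have "cmod (f (of_real \<theta>)) * (M0 powr (\<theta> - 1) * M1 powr (- \<theta>)) \<le> 1" by (simp add: g_def norm_mult k)
  then show ?thesis using M by (simp add: powr_diff powr_minus field_simps)
qed

text \<open>Bounds equal to zero do occur, for instance for a zero factor \<open>a\<close>; they are
  raised by \<open>e\<close>, which then tends to 0. Continuity of \<open>powr\<close> at base 0
  needs a positive exponent, hence the open range of \<open>\<theta>\<close>.\<close>

lemma three_lines:
  assumes f: "strip f" and M: "0 \<le> M0" "0 \<le> M1"
    and l0: "\<And>z. Re z = 0 \<Longrightarrow> cmod (f z) \<le> M0" and l1: "\<And>z. Re z = 1 \<Longrightarrow> cmod (f z) \<le> M1"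
    and th: "0 < \<theta>" "\<theta> < 1"
  shows "cmod (f (of_real \<theta>)) \<le> M0 powr (1 - \<theta>) * M1 powr \<theta>"
proof (rule tendsto_lowerbound)
  show "((\<lambda>e. (M0 + e) powr (1 - \<theta>) * (M1 + e) powr \<theta>) \<longlongrightarrow> M0 powr (1 - \<theta>) * M1 powr \<theta>) (at_right 0)"
  proof (rule tendsto_mult)
    have *: "((\<lambda>e. (m + e) powr s) \<longlongrightarrow> m powr s) (at_right 0)" if "0 \<le> m" "0 < s" for m s :: real
    proof -
      have "((\<lambda>e. (m + e) powr s) \<longlongrightarrow> (m + 0) powr s) (at_right 0)"
        using that by (intro tendsto_powr2 tendsto_intros) (auto simp: eventually_at_right_field intro!: exI[of _ 1])
      then show ?thesis by simp
    qed
    show "((\<lambda>e. (M0 + e) powr (1 - \<theta>)) \<longlongrightarrow> M0 powr (1 - \<theta>)) (at_right 0)" using * M th by simp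
    show "((\<lambda>e. (M1 + e) powr \<theta>) \<longlongrightarrow> M1 powr \<theta>) (at_right 0)" using * M th by simp
  qed
  have "cmod (f (of_real \<theta>)) \<le> (M0 + e) powr (1 - \<theta>) * (M1 + e) powr \<theta>" if "0 < e" for e
    using M th that by (intro three_lines_pos[OF f] order_trans[OF l0] order_trans[OF l1]) auto
  then show "\<forall>\<^sub>F e in at_right 0. cmod (f (of_real \<theta>)) \<le> (M0 + e) powr (1 - \<theta>) * (M1 + e) powr \<theta>"
    by (auto simp: eventually_at_right_field intro!: exI[of _ 1])
qed simp

section \<open>Matrix-valued functions on the strip and their derivatives at 0\<close>

context sqmat
begin

definition mstrip :: "(complex \<Rightarrow> complex mat) \<Rightarrow> bool" where
  "mstrip G \<longleftrightarrow> (\<forall>z. G z \<in> M) \<and> (\<forall>i<n. \<forall>j<n. strip (\<lambda>z. G z $$ (i,j)))"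

lemma mstrip_const: "A \<in> M \<Longrightarrow> mstrip (\<lambda>z. A)" by (simp add: mstrip_def strip_const)

lemma mstrip_mult: "mstrip G \<Longrightarrow> mstrip H \<Longrightarrow> mstrip (\<lambda>z. G z * H z)"
  by (auto simp: mstrip_def mult_ij intro!: strip_sum strip_mult)

lemma mstrip_tr: "mstrip G \<Longrightarrow> strip (\<lambda>z. tr (G z))"
  by (auto simp: mstrip_def tr_sum intro!: strip_sum)

lemma mstrip_pw: assumes "psd n A" shows "mstrip (\<lambda>z. pw (a + of_real b * z) A)"
proof -
  obtain U l where U: "unitary n U" "\<And>f. cfun f A = ud U (\<lambda>i. f (l i))" and l: "\<And>i. i < n \<Longrightarrow> 0 \<le> l i"
    using psd_spec[OF assms] by metis
  have "U \<in> M" using U by (simp add: unitaryD)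
  then show ?thesis unfolding mstrip_def pw_def U(2)
    by (auto simp: ud_ij intro!: strip_sum strip_mult strip_const strip_powr l)
qed

definition mderiv :: "(complex \<Rightarrow> complex mat) \<Rightarrow> complex mat \<Rightarrow> bool" where
  "mderiv G G' \<longleftrightarrow> (\<forall>z. G z \<in> M) \<and> G' \<in> M \<and>
     (\<forall>i<n. \<forall>j<n. ((\<lambda>z. G z $$ (i,j)) has_field_derivative G' $$ (i,j)) (at 0))"

lemma mderiv_mult:
  assumes "mderiv G G'" "mderiv H H'" shows "mderiv (\<lambda>z. G z * H z) (G' * H 0 + G 0 * H')"
proof -
  have m: "\<And>z. G z \<in> M" "\<And>z. H z \<in> M" "G' \<in> M" "H' \<in> M" using assms by (auto simp: mderiv_def)
  have "((\<lambda>z. (G z * H z) $$ (i,j)) has_field_derivative (G' * H 0 + G 0 * H') $$ (i,j)) (at 0)"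
    if ij: "i < n" "j < n" for i j
  proof -
    have "((\<lambda>z. \<Sum>k<n. G z $$ (i,k) * H z $$ (k,j)) has_field_derivative
       (\<Sum>k<n. G' $$ (i,k) * H 0 $$ (k,j) + H' $$ (k,j) * G 0 $$ (i,k))) (at 0)"
      by (intro DERIV_sum DERIV_mult) (use assms ij in \<open>auto simp: mderiv_def\<close>)
    then show ?thesis using m ij by (simp add: mult_ij add_ij sum.distrib mult.commute)
  qed
  then show ?thesis using m by (simp add: mderiv_def)
qed

lemma mderiv_tr:
  assumes "mderiv G G'" shows "((\<lambda>z. tr (G z)) has_field_derivative tr G') (at 0)"
proof -
  have m: "\<And>z. G z \<in> M" "G' \<in> M" using assms by (auto simp: mderiv_def)
  show ?thesis unfolding tr_sum[OF m(1)] tr_sum[OF m(2)]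
    by (intro DERIV_sum) (use assms in \<open>auto simp: mderiv_def\<close>)
qed

lemma mderiv_pw:
  assumes "pd n A"
  shows "mderiv (\<lambda>z. pw (a + of_real b * z) A) (of_real b \<cdot>\<^sub>m (pw a A * mln A))"
proof -
  obtain U l where U: "unitary n U" "\<And>f. cfun f A = ud U (\<lambda>i. f (l i))" and l: "\<And>i. i < n \<Longrightarrow> 0 < l i"
    using psd_spec[OF pdD[OF assms]] assms by metis
  have a: "A \<in> M" using assms by (simp add: pdD psdD)
  have u: "U \<in> M" using U by (simp add: unitaryD)
  have eq: "of_real b \<cdot>\<^sub>m (pw a A * mln A) = ud U (\<lambda>i. of_real b * (of_real (l i) powr a * of_real (ln (l i))))"
    using u a by (simp add: pw_def mln_def mfun_cfun U ud_mult ud_smult)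
  have d: "((\<lambda>z. complex_of_real x powr (a + of_real b * z)) has_field_derivative
     of_real b * (of_real x powr a * of_real (ln x))) (at 0)" if "0 < x" for x
  proof -
    have "((\<lambda>z. exp ((a + of_real b * z) * of_real (ln x))) has_field_derivative
      exp ((a + of_real b * 0) * of_real (ln x)) * (of_real b * of_real (ln x))) (at 0)"
      by (auto intro!: derivative_eq_intros)
    then show ?thesis using that by (simp add: powr_def Ln_of_real mult_ac)
  qed
  have "((\<lambda>z. ud U (\<lambda>i. complex_of_real (l i) powr (a + of_real b * z)) $$ (i,j)) has_field_derivative
     ud U (\<lambda>i. of_real b * (of_real (l i) powr a * of_real (ln (l i)))) $$ (i,j)) (at 0)" if ij: "i < n" "j < n" for i j
    unfolding ud_ij[OF u ij]
    by (intro DERIV_sum DERIV_cmult DERIV_cmult_right d l) auto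
  then show ?thesis unfolding mderiv_def eq unfolding pw_def U using u by simp
qed

end

section \<open>Complex time evolution of a symmetric generator\<close>

lemma sum_lessThan_mult: "(\<Sum>p<k * n. f p) = (\<Sum>i<k. \<Sum>j<n. f (i * n + j))"
  for f :: "nat \<Rightarrow> 'a::comm_monoid_add"
proof (induction k)
  case (Suc k)
  have "(\<Sum>p<Suc k * n. f p) = (\<Sum>p<k * n + n. f p)" by (simp add: add.commute)
  then show ?case using Suc by (simp add: sum_lessThan_add)
qed simp

context sqmat
begin

text \<open>Flattening \<open>(i,j)\<close> to \<open>i * n + j\<close> turns
  \<open>\<Lambda>\<close> into a hermitian matrix of size \<open>n * n\<close>, and the spectral
  theorem is applied at that size. The columns of the diagonalising unitary, folded back into
  matrices, are the \<open>e m\<close>.\<close>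

lemma superop_spectral:
  assumes lin: "lin_map n \<Lambda>"
    and sym: "\<And>A B. A \<in> M \<Longrightarrow> B \<in> M \<Longrightarrow> tr (adj A * \<Lambda> B) = tr (adj (\<Lambda> A) * B)"
  obtains e :: "nat \<Rightarrow> complex mat" and l :: "nat \<Rightarrow> real"
  where "\<And>m. e m \<in> M"
    and "\<And>m k. m < n * n \<Longrightarrow> k < n * n \<Longrightarrow> tr (adj (e m) * e k) = (if m = k then 1 else 0)"
    and "\<And>Z i j. Z \<in> M \<Longrightarrow> i < n \<Longrightarrow> j < n \<Longrightarrow> Z $$ (i,j) = (\<Sum>m<n * n. tr (adj (e m) * Z) * e m $$ (i,j))"
    and "\<And>m. m < n * n \<Longrightarrow> \<Lambda> (e m) = of_real (l m) \<cdot>\<^sub>m e m"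
proof -
  interpret big: sqmat "n * n" .
  have dm: "p div n < n" "p mod n < n" if "p < n * n" for p
    using that by (auto simp: less_mult_imp_div_less) (metis mod_less_divisor mult_0_right not_less0 gr0I)
  have idx: "i * n + j < n * n" if "i < n" "j < n" for i j
  proof -
    have "i * n + j < i * n + n" using that by simp
    also have "\<dots> = Suc i * n" by simp
    also have "\<dots> \<le> n * n" using that by (intro mult_right_mono) auto
    finally show ?thesis .
  qed
  have Eu_tr: "tr (adj (Eu k l) * Z) = Z $$ (k,l)" if "Z \<in> M" "k < n" "l < n" for Z k l
  proof -
    have "tr (adj (Eu k l) * Z) = (\<Sum>i<n. \<Sum>j<n. cnj (Eu k l $$ (j,i)) * Z $$ (j,i))"
      using that by (simp add: tr_mult adj_ij)
    also have "\<dots> = (\<Sum>i<n. if i = l then Z $$ (k,i) else 0)"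
    proof (rule sum.cong[OF refl])
      fix i assume "i \<in> {..<n}"
      then have "(\<Sum>j<n. cnj (Eu k l $$ (j,i)) * Z $$ (j,i)) = (\<Sum>j<n. if j = k then (if i = l then Z $$ (j,i) else 0) else 0)"
        by (intro sum.cong) (auto simp: Eu_def)
      then show "(\<Sum>j<n. cnj (Eu k l $$ (j,i)) * Z $$ (j,i)) = (if i = l then Z $$ (k,i) else 0)" using that by simp
    qed
    finally show ?thesis using that by simp
  qed
  define H where "H = mat (n * n) (n * n) (\<lambda>(p,r). \<Lambda> (Eu (r div n) (r mod n)) $$ (p div n, p mod n))"
  have H: "H \<in> carrier_mat (n * n) (n * n)" by (simp add: H_def)
  have Hpr: "H $$ (p,r) = cnj (H $$ (r,p))" if "p < n * n" "r < n * n" for p r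
  proof -
    let ?A = "Eu (p div n) (p mod n)" and ?B = "Eu (r div n) (r mod n)"
    note d = dm[OF that(1)] dm[OF that(2)]
    have "H $$ (p,r) = tr (adj ?A * \<Lambda> ?B)" using that d lin by (simp add: H_def Eu_tr lin_closed)
    also have "\<dots> = tr (adj (\<Lambda> ?A) * ?B)" by (simp add: sym)
    also have "\<dots> = cnj (tr (adj ?B * \<Lambda> ?A))" using lin by (subst tr_adj[symmetric]) (auto simp: lin_closed adj_mult)
    also have "\<dots> = cnj (H $$ (r,p))" using that d lin by (simp add: H_def Eu_tr lin_closed)
    finally show ?thesis .
  qed
  have "adj H = H" by (rule big.M_eqI) (use H Hpr[symmetric] in \<open>auto simp: big.adj_ij\<close>)
  then obtain U l where U: "unitary (n * n) U" and HU: "H = big.ud U (\<lambda>i. complex_of_real (l i))"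
    using big.spectral_theorem[of H] H by (auto simp: big.herm_def)
  note u = big.unitaryD[OF U]
  have orth: "(\<Sum>p<n * n. cnj (U $$ (p,m)) * U $$ (p,k)) = (if m = k then 1 else 0)" if "m < n * n" "k < n * n" for m k
    using arg_cong[OF u(2), of "\<lambda>A. A $$ (m,k)"] that u(1) big.mult_ij[of "adj U" U m k] by (simp add: big.adj_ij)
  have compl: "(\<Sum>m<n * n. U $$ (p,m) * cnj (U $$ (r,m))) = (if p = r then 1 else 0)" if "p < n * n" "r < n * n" for p r
    using arg_cong[OF u(3), of "\<lambda>A. A $$ (p,r)"] that u(1) big.mult_ij[of U "adj U" p r] by (simp add: big.adj_ij)
  have ev: "(\<Sum>r<n * n. H $$ (p,r) * U $$ (r,m)) = of_real (l m) * U $$ (p,m)" if "p < n * n" "m < n * n" for p m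
  proof -
    have "H * U = U * mat_diag (n * n) (\<lambda>i. complex_of_real (l i)) * (adj U * U)"
      using HU u(1) by (simp add: big.ud_def big.M_assoc)
    then have "(H * U) $$ (p,m) = (U * mat_diag (n * n) (\<lambda>i. complex_of_real (l i))) $$ (p,m)" using u by simp
    then show ?thesis using that u(1) H big.mult_ij[of H U p m]
      by (subst (asm) big.diag_right) (auto simp: mult.commute)
  qed
  define e where "e m = mat n n (\<lambda>(i,j). U $$ (i * n + j, m))" for m
  have e: "e m \<in> M" for m by (simp add: e_def)
  have eij: "e m $$ (i,j) = U $$ (i * n + j, m)" if "i < n" "j < n" for i j m using that by (simp add: e_def)
  have cof: "tr (adj (e m) * Z) = (\<Sum>p<n * n. cnj (U $$ (p,m)) * Z $$ (p div n, p mod n))" if "Z \<in> M" for m Z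
  proof -
    have "tr (adj (e m) * Z) = (\<Sum>j<n. \<Sum>i<n. cnj (U $$ (i * n + j, m)) * Z $$ (i,j))"
      using that e by (simp add: tr_mult adj_ij eij)
    also have "\<dots> = (\<Sum>i<n. \<Sum>j<n. cnj (U $$ (i * n + j, m)) * Z $$ (i,j))" by (rule sum.swap)
    also have "\<dots> = (\<Sum>p<n * n. cnj (U $$ (p,m)) * Z $$ (p div n, p mod n))"
      unfolding sum_lessThan_mult by (intro sum.cong refl) auto
    finally show ?thesis .
  qed
  show ?thesis
  proof (rule that[of e l])
    show "tr (adj (e m) * e k) = (if m = k then 1 else 0)" if "m < n * n" "k < n * n" for m k
    proof -
      have "tr (adj (e m) * e k) = (\<Sum>p<n * n. cnj (U $$ (p,m)) * U $$ (p,k))"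
        unfolding cof[OF e] by (intro sum.cong refl) (use dm in \<open>auto simp: eij\<close>)
      then show ?thesis using orth that by simp
    qed
    show "Z $$ (i,j) = (\<Sum>m<n * n. tr (adj (e m) * Z) * e m $$ (i,j))" if Z: "Z \<in> M" and ij: "i < n" "j < n" for Z i j
    proof -
      let ?r = "i * n + j"
      have "(\<Sum>m<n * n. tr (adj (e m) * Z) * e m $$ (i,j))
         = (\<Sum>m<n * n. \<Sum>p<n * n. Z $$ (p div n, p mod n) * (U $$ (?r,m) * cnj (U $$ (p,m))))"
        unfolding cof[OF Z] using ij by (simp add: eij sum_distrib_right sum_distrib_left mult_ac)
      also have "\<dots> = (\<Sum>p<n * n. \<Sum>m<n * n. Z $$ (p div n, p mod n) * (U $$ (?r,m) * cnj (U $$ (p,m))))" by (rule sum.swap)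
      also have "\<dots> = (\<Sum>p<n * n. if p = ?r then Z $$ (p div n, p mod n) else 0)"
        by (intro sum.cong refl) (use idx[OF ij] compl in \<open>auto simp: sum_distrib_left[symmetric]\<close>)
      also have "\<dots> = Z $$ (i,j)" using idx[OF ij] ij by simp
      finally show ?thesis by simp
    qed
    show "\<Lambda> (e m) = of_real (l m) \<cdot>\<^sub>m e m" if m: "m < n * n" for m
    proof (rule M_eqI)
      fix i j assume ij: "i < n" "j < n"
      let ?r = "i * n + j"
      have "\<Lambda> (e m) $$ (i,j) = (\<Sum>k<n. \<Sum>q<n. e m $$ (k,q) * \<Lambda> (Eu k q) $$ (i,j))"
        using lin_expand[OF lin e ij] by (simp add: sum.cartesian_product)
      also have "\<dots> = (\<Sum>k<n. \<Sum>q<n. H $$ (?r, k * n + q) * U $$ (k * n + q, m))"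
        by (intro sum.cong refl) (use ij idx in \<open>auto simp: eij H_def mult.commute\<close>)
      also have "\<dots> = (\<Sum>r<n * n. H $$ (?r,r) * U $$ (r,m))" by (rule sum_lessThan_mult[symmetric])
      also have "\<dots> = of_real (l m) * U $$ (?r,m)" using ev idx[OF ij] m by simp
      finally show "\<Lambda> (e m) $$ (i,j) = (of_real (l m) \<cdot>\<^sub>m e m) $$ (i,j)" using ij e by (simp add: smult_ij eij)
    qed (use e lin in \<open>auto simp: lin_closed\<close>)
  qed (rule e)
qed

end

section \<open>Functional calculus of a symmetric superoperator\<close>

locale eigbasis = sqmat +
  fixes \<Lambda> :: "complex mat \<Rightarrow> complex mat" and e :: "nat \<Rightarrow> complex mat" and l :: "nat \<Rightarrow> real"
  assumes Lin: "lin_map n \<Lambda>"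
    and sym: "\<And>A B. A \<in> M \<Longrightarrow> B \<in> M \<Longrightarrow> tr (adj A * \<Lambda> B) = tr (adj (\<Lambda> A) * B)"
    and e [simp]: "\<And>m. e m \<in> M"
    and orth: "\<And>m k. m < n * n \<Longrightarrow> k < n * n \<Longrightarrow> tr (adj (e m) * e k) = (if m = k then 1 else 0)"
    and compl: "\<And>Z i j. Z \<in> M \<Longrightarrow> i < n \<Longrightarrow> j < n \<Longrightarrow> Z $$ (i,j) = (\<Sum>m<n * n. tr (adj (e m) * Z) * e m $$ (i,j))"
    and eig: "\<And>m. m < n * n \<Longrightarrow> \<Lambda> (e m) = of_real (l m) \<cdot>\<^sub>m e m"
begin

text \<open>The function of \<open>\<Lambda>\<close> that multiplies the \<open>m\<close>-th
  eigencomponent by \<open>w m\<close>. Exponential weights give the evolution in complex time;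
  weights of modulus 1 preserve the Hilbert-Schmidt norm.\<close>

definition W :: "(nat \<Rightarrow> complex) \<Rightarrow> complex mat \<Rightarrow> complex mat" where
  "W w Z = mat n n (\<lambda>(i,j). \<Sum>m<n * n. w m * tr (adj (e m) * Z) * e m $$ (i,j))"

lemma W_closed [simp]: "W w Z \<in> M" by (simp add: W_def)

lemma W_ij: "i < n \<Longrightarrow> j < n \<Longrightarrow> W w Z $$ (i,j) = (\<Sum>m<n * n. w m * tr (adj (e m) * Z) * e m $$ (i,j))"
  by (simp add: W_def)

lemma coeff_W: assumes "k < n * n" shows "tr (adj (e k) * W w Z) = w k * tr (adj (e k) * Z)"
proof -
  have "tr (adj (e k) * W w Z) = (\<Sum>i<n. \<Sum>j<n. \<Sum>m<n * n. w m * tr (adj (e m) * Z) * (adj (e k) $$ (i,j) * e m $$ (j,i)))"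
    by (simp add: tr_mult W_ij sum_distrib_left mult_ac)
  also have "\<dots> = (\<Sum>i<n. \<Sum>m<n * n. \<Sum>j<n. w m * tr (adj (e m) * Z) * (adj (e k) $$ (i,j) * e m $$ (j,i)))"
    by (intro sum.cong refl sum.swap)
  also have "\<dots> = (\<Sum>m<n * n. \<Sum>i<n. \<Sum>j<n. w m * tr (adj (e m) * Z) * (adj (e k) $$ (i,j) * e m $$ (j,i)))"
    by (rule sum.swap)
  also have "\<dots> = (\<Sum>m<n * n. w m * tr (adj (e m) * Z) * tr (adj (e k) * e m))"
    by (simp add: tr_mult sum_distrib_left)
  also have "\<dots> = (\<Sum>m<n * n. if m = k then w m * tr (adj (e m) * Z) else 0)"
    by (intro sum.cong refl) (use assms in \<open>auto simp: orth\<close>)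
  finally show ?thesis using assms by simp
qed

lemma coeff_eqI:
  assumes "Y \<in> M" "Z \<in> M" "\<And>k. k < n * n \<Longrightarrow> tr (adj (e k) * Y) = tr (adj (e k) * Z)" shows "Y = Z"
  by (rule M_eqI) (use assms in \<open>simp_all add: compl[of Y] compl[of Z]\<close>)

lemma W_one: "Z \<in> M \<Longrightarrow> W (\<lambda>m. 1) Z = Z"
  by (rule coeff_eqI) (auto simp: coeff_W)

lemma W_W: "W w (W v Z) = W (\<lambda>m. w m * v m) Z"
  by (rule coeff_eqI) (auto simp: coeff_W)

lemma Lambda_W: assumes "Z \<in> M" shows "\<Lambda> Z = W (\<lambda>m. of_real (l m)) Z"
proof (rule coeff_eqI)
  fix k assume k: "k < n * n"
  have "tr (adj (e k) * \<Lambda> Z) = of_real (l k) * tr (adj (e k) * Z)"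
    using sym[of "e k" Z] assms k by (simp add: eig adj_smult M_smult tr_smult)
  then show "tr (adj (e k) * \<Lambda> Z) = tr (adj (e k) * W (\<lambda>m. of_real (l m)) Z)" using k by (simp add: coeff_W)
qed (use assms Lin in \<open>auto simp: lin_closed\<close>)

lemma Lambda_pow_W: assumes "Z \<in> M" shows "(\<Lambda> ^^ k) Z = W (\<lambda>m. of_real (l m) ^ k) Z"
proof (induction k)
  case 0
  show ?case using assms by (simp add: W_one)
next
  case (Suc k)
  then show ?case using assms by (simp add: Lambda_W W_W)
qed

lemma Parseval: assumes "Y \<in> M" "Z \<in> M"
  shows "tr (adj Y * Z) = (\<Sum>m<n * n. cnj (tr (adj (e m) * Y)) * tr (adj (e m) * Z))"
proof -
  have "tr (adj Y * Z) = (\<Sum>i<n. \<Sum>j<n. adj Y $$ (i,j) * (\<Sum>m<n * n. tr (adj (e m) * Z) * e m $$ (j,i)))"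
    unfolding tr_mult[OF M_closed(5)[OF assms(1)] assms(2)] by (intro sum.cong refl) (simp add: compl[OF assms(2), symmetric])
  also have "\<dots> = (\<Sum>i<n. \<Sum>j<n. \<Sum>m<n * n. tr (adj (e m) * Z) * (adj Y $$ (i,j) * e m $$ (j,i)))"
    by (simp add: sum_distrib_left mult_ac)
  also have "\<dots> = (\<Sum>i<n. \<Sum>m<n * n. \<Sum>j<n. tr (adj (e m) * Z) * (adj Y $$ (i,j) * e m $$ (j,i)))"
    by (intro sum.cong refl sum.swap)
  also have "\<dots> = (\<Sum>m<n * n. \<Sum>i<n. \<Sum>j<n. tr (adj (e m) * Z) * (adj Y $$ (i,j) * e m $$ (j,i)))"
    by (rule sum.swap)
  also have "\<dots> = (\<Sum>m<n * n. tr (adj (e m) * Z) * tr (adj Y * e m))"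
    using assms by (simp add: tr_mult sum_distrib_left)
  also have "\<dots> = (\<Sum>m<n * n. cnj (tr (adj (e m) * Y)) * tr (adj (e m) * Z))"
  proof (intro sum.cong refl)
    fix m
    have "tr (adj Y * e m) = cnj (tr (adj (e m) * Y))"
      using assms by (subst tr_adj[symmetric]) (auto simp: adj_mult)
    then show "tr (adj (e m) * Z) * tr (adj Y * e m) = cnj (tr (adj (e m) * Y)) * tr (adj (e m) * Z)" by simp
  qed
  finally show ?thesis .
qed

lemma nrm_W: assumes "Z \<in> M" "\<And>m. cmod (w m) = 1" shows "nrm (W w Z) = nrm Z"
proof -
  have sq: "complex_of_real ((nrm Y)\<^sup>2) = (\<Sum>m<n * n. of_real ((cmod (tr (adj (e m) * Y)))\<^sup>2))" if "Y \<in> M" for Y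
    using Parseval[OF that that] that by (simp add: tr_adj_mult_self cnj_mult_cmod)
  have "complex_of_real ((nrm (W w Z))\<^sup>2) = complex_of_real ((nrm Z)\<^sup>2)"
    unfolding sq[OF W_closed] sq[OF assms(1)] using assms(2) by (intro sum.cong) (auto simp: coeff_W norm_mult)
  then have "(nrm (W w Z))\<^sup>2 = (nrm Z)\<^sup>2" by (simp only: of_real_eq_iff)
  then show ?thesis by simp
qed

lemma mstrip_W: "mstrip (\<lambda>z. W (\<lambda>m. exp (of_real (l m * T) * z)) Z)"
proof -
  have "strip (\<lambda>z. exp (of_real (l m * T) * z))" for m using strip_exp[of 0 "l m * T"] by simp
  then show ?thesis by (auto simp: mstrip_def W_ij intro!: strip_sum strip_mult strip_const)
qed

lemma mderiv_W: assumes "Z \<in> M" shows "mderiv (\<lambda>z. W (\<lambda>m. exp (of_real (l m * T) * z)) Z) (of_real T \<cdot>\<^sub>m \<Lambda> Z)"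
proof -
  have "((\<lambda>z. W (\<lambda>m. exp (of_real (l m * T) * z)) Z $$ (i,j)) has_field_derivative (of_real T \<cdot>\<^sub>m \<Lambda> Z) $$ (i,j)) (at 0)"
    if ij: "i < n" "j < n" for i j
  proof -
    have d: "((\<lambda>z. exp (of_real c * z)) has_field_derivative of_real c) (at 0)" for c :: real
      by (auto intro!: derivative_eq_intros)
    have "((\<lambda>z. \<Sum>m<n * n. exp (of_real (l m * T) * z) * tr (adj (e m) * Z) * e m $$ (i,j)) has_field_derivative
      (\<Sum>m<n * n. of_real (l m * T) * tr (adj (e m) * Z) * e m $$ (i,j))) (at 0)"
      by (intro DERIV_sum DERIV_cmult_right d)
    moreover have "(of_real T \<cdot>\<^sub>m \<Lambda> Z) $$ (i,j) = (\<Sum>m<n * n. of_real (l m * T) * tr (adj (e m) * Z) * e m $$ (i,j))"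
      unfolding Lambda_W[OF assms] using ij by (simp add: smult_ij W_ij sum_distrib_left mult_ac)
    ultimately show ?thesis using ij by (simp add: W_ij)
  qed
  then show ?thesis using assms Lin by (simp add: mderiv_def lin_closed)
qed

end

section \<open>Weighted norms\<close>

context sqmat
begin

lemma pw_pw: assumes "psd n A" shows "pw z (pw (of_real s) A) = pw (of_real s * z) A"
proof -
  have e: "pw (of_real s) A = cfun (\<lambda>x. of_real (x powr s)) A"
    unfolding pw_def using assms by (auto intro!: cfun_cong_psd simp: powr_of_real)
  show ?thesis unfolding e unfolding pw_def
    using assms by (subst cfun_cfun) (auto simp: psdD powr_def Ln_of_real ln_powr mult_ac intro!: cfun_cong_psd)
qed

lemma pw_mult_left: "psd n A \<Longrightarrow> C \<in> M \<Longrightarrow> pw z A * (pw w A * C) = pw (z + w) A * C"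
  using pw_mult[of A z w] by (simp flip: M_assoc)

text \<open>For \<open>a = w |a|\<close> in polar form this is \<open>w |a|^(1+2u)\<close>, obtained
  with no choice of a polar part. Its value at \<open>u = 0\<close> is \<open>a\<close>, and for
  \<open>Re u = -1/2\<close> it is a partial isometry.\<close>

definition cc :: "complex mat \<Rightarrow> complex \<Rightarrow> complex mat" where
  "cc a u = a * pw u (adj a * a)"

lemma cc_closed [simp]: "a \<in> M \<Longrightarrow> cc a u \<in> M"
  by (simp add: cc_def psd_adj_mult)

lemma cc_gram: assumes a: "a \<in> M" shows "adj (cc a u) * cc a u = pw (cnj u + 1 + u) (adj a * a)"
proof -
  have p: "psd n (adj a * a)" using a by (rule psd_adj_mult)
  have "adj (cc a u) * cc a u = pw (cnj u) (adj a * a) * ((adj a * a) * pw u (adj a * a))"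
    using a p by (simp add: cc_def adj_mult pw_adj M_assoc)
  also have "(adj a * a) * pw u (adj a * a) = pw (1 + u) (adj a * a)"
    using pw_mult[OF p, of 1 u] pw_1[OF p] by simp
  finally show ?thesis using p by (simp add: pw_mult add.assoc)
qed

text \<open>\<open>pw 0\<close> gives only the support projection of \<open>adj a * a\<close>; to
  the right of \<open>a\<close> it acts as the identity, because the difference has norm
  zero.\<close>

lemma cc_zero: assumes a: "a \<in> M" shows "cc a 0 = a"
proof -
  have p: "psd n (adj a * a)" using a by (rule psd_adj_mult)
  let ?P = "pw 0 (adj a * a)" and ?D = "cc a 0 - a"
  have P: "?P \<in> M" using p by simp
  have cP: "(adj a * a) * ?P = adj a * a" using pw_mult[OF p, of 1 0] pw_1[OF p] by simp
  have Pc: "adj (cc a 0) * a = adj a * a"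
  proof -
    have "adj (cc a 0) * a = ?P * (adj a * a)" using a p by (simp add: cc_def adj_mult pw_adj M_assoc)
    also have "\<dots> = adj a * a" using pw_mult[OF p, of 0 1] pw_1[OF p] by simp
    finally show ?thesis .
  qed
  have "adj ?D * ?D = (adj (cc a 0) * cc a 0 - adj a * cc a 0) - (adj (cc a 0) * a - adj a * a)"
    using a by (simp add: adj_minus M_distrib)
  also have "\<dots> = 0\<^sub>m n n"
    using a p cP Pc cc_gram[OF a, of 0] pw_1[OF p] by (simp add: cc_def M_assoc[symmetric] minus_r_inv_mat)
  finally have "nrm ?D = 0" using a tr_adj_mult_self[of ?D] by simp
  then have "?D = 0\<^sub>m n n" using a nrm_eq_0 by simp
  then show ?thesis by (rule minus_zeroD[rotated 2]) (use a in simp_all)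
qed

lemma contr_cc: assumes "a \<in> M" "Re u = - 1 / 2" shows "contr (cc a u)"
proof (rule contrI[OF _ psd_adj_mult[OF assms(1)]])
  have z: "cnj u + 1 + u = 0" using assms(2) by (simp add: complex_eq_iff)
  show "adj (cc a u) * cc a u = cfun (\<lambda>x. complex_of_real (if x = 0 then 0 else 1)) (adj a * a)"
    unfolding cc_gram[OF assms(1)] z pw_def using psd_adj_mult[OF assms(1)]
    by (auto simp: powr_def intro!: cfun_cong_psd)
qed (use assms in auto)

lemma nrm_cc: 
  assumes "a \<in> M" shows "(nrm (cc a u))\<^sup>2 = Re (tr (pw (cnj u + 1 + u) (adj a * a)))"
  using tr_adj_mult_self[of "cc a u"] assms by (simp add: cc_gram flip: of_real_power)

lemma mstrip_cc: "a \<in> M \<Longrightarrow> mstrip (\<lambda>z. cc a (c + of_real b * z))"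
  unfolding cc_def by (intro mstrip_mult mstrip_const mstrip_pw psd_adj_mult)

lemma pd_conj:
  assumes A: "pd n A" and B: "B \<in> M" and C: "C \<in> M" "C * B = 1\<^sub>m n" shows "pd n (adj B * A * B)"
  unfolding pd_iff
proof (intro conjI ballI impI)
  note a = psdD(1,2)[OF pdD[OF A]]
  show "herm (adj B * A * B)" using psd_conj[OF pdD[OF A] B] psdD(3) by blast
  fix S assume S: "S \<in> M" "S \<noteq> 0\<^sub>m n n"
  have "B * S \<noteq> 0\<^sub>m n n"
  proof
    assume "B * S = 0\<^sub>m n n"
    then have "C * B * S = 0\<^sub>m n n" using B C(1) S by (simp add: M_assoc)
    then show False using C S by simp
  qed
  then have "0 < Re (tr (adj (B * S) * A * (B * S)))" using A B S unfolding pd_iff by auto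
  then show "0 < Re (tr (adj S * (adj B * A * B) * S))" using a B S by (simp add: adj_mult M_assoc)
qed

section \<open>Schatten norms as traces, and the operator norm on columns\<close>

lemma schatten_pw:
  assumes Y: "Y \<in> M" shows "schatten (ereal r) Y = (Re (tr (pw (of_real (r / 2)) (adj Y * Y)))) powr (1 / r)"
  using psd_adj_mult[OF Y] by (simp add: schatten_def mabs_def mpow_mpow) (simp add: mpow_pw)

lemma schatten_2: "Y \<in> M \<Longrightarrow> schatten 2 Y = nrm Y"
  using schatten_pw[of Y 2] pw_1[OF psd_adj_mult[of Y]] 
  by (simp add: tr_adj_mult_self powr_half_sqrt flip: of_real_power)

lemma vnorm_L2: "v \<in> carrier_vec n \<Longrightarrow> vnorm v = L2_set (\<lambda>i. cmod (v $ i)) {..<n}"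
  by (simp add: vnorm_def L2_set_def)

lemma nrm_sq_cols: "B \<in> M \<Longrightarrow> (nrm B)\<^sup>2 = (\<Sum>k<n. (vnorm (col B k))\<^sup>2)"
  unfolding nrm_sq by (subst sum.swap) (simp add: vnorm_L2 L2_set_def sum_nonneg)

lemma vnorm_mult_le: assumes "Y \<in> M" "v \<in> carrier_vec n" shows "vnorm (Y *\<^sub>v v) \<le> nrm Y * vnorm v"
proof -
  define B where "B = mat n n (\<lambda>(i,j). if j = 0 then v $ i else 0)"
  have B: "B \<in> M" by (simp add: B_def)
  show ?thesis
  proof (cases "n = 0")
    case True
    then show ?thesis using assms by (simp add: vnorm_def)
  next
    case False
    have c0: "col B 0 = v" using assms False by (auto simp: B_def)
    have z: "vnorm (col B k) = 0" if "k < n" "k \<noteq> 0" for k using that by (simp add: vnorm_def B_def)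
    have "(nrm B)\<^sup>2 = (\<Sum>k<n. if k = 0 then (vnorm v)\<^sup>2 else 0)"
      unfolding nrm_sq_cols[OF B] by (intro sum.cong) (auto simp: c0 z)
    then have nB: "(nrm B)\<^sup>2 = (vnorm v)\<^sup>2" using False by simp
    have v0: "0 \<le> vnorm w" for w by (simp add: vnorm_def sum_nonneg)
    have "(vnorm (Y *\<^sub>v v))\<^sup>2 \<le> (\<Sum>k<n. (vnorm (col (Y * B) k))\<^sup>2)"
      using member_le_sum[of 0 "{..<n}" "\<lambda>k. (vnorm (col (Y * B) k))\<^sup>2"] False c0 assms B
      by (simp add: mult_mat_vec_def)
    also have "\<dots> = (nrm (Y * B))\<^sup>2" using assms B by (simp add: nrm_sq_cols)
    also have "\<dots> \<le> (nrm Y * nrm B)\<^sup>2" using nrm_mult_le[OF assms(1) B] by (intro power_mono) auto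
    also have "\<dots> = (nrm Y * vnorm v)\<^sup>2" using nB by (simp add: power_mult_distrib)
    finally show ?thesis using v0 by (simp add: power2_le_iff_abs_le)
  qed
qed

lemma vnorm_opnorm: assumes Y: "Y \<in> M" and v: "v \<in> carrier_vec n" shows "vnorm (Y *\<^sub>v v) \<le> opnorm Y * vnorm v"
proof -
  let ?S = "{vnorm (Y *\<^sub>v v) | v. v \<in> carrier_vec (dim_col Y) \<and> vnorm v \<le> 1}"
  have v0: "0 \<le> vnorm w" for w by (simp add: vnorm_def sum_nonneg)
  have bdd: "bdd_above ?S"
  proof (rule bdd_aboveI)
    fix x assume "x \<in> ?S"
    then obtain w where w: "x = vnorm (Y *\<^sub>v w)" "w \<in> carrier_vec n" "vnorm w \<le> 1" using Y by auto
    have "x \<le> nrm Y * vnorm w" using vnorm_mult_le[OF Y w(2)] w(1) by simp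
    also have "\<dots> \<le> nrm Y * 1" using w(3) by (intro mult_left_mono) auto
    finally show "x \<le> nrm Y" by simp
  qed
  have scale: "vnorm (complex_of_real c \<cdot>\<^sub>v w) = \<bar>c\<bar> * vnorm w" for c w
    by (simp add: vnorm_def norm_mult power_mult_distrib real_sqrt_mult flip: sum_distrib_left)
  show ?thesis
  proof (cases "vnorm v = 0")
    case True
    then show ?thesis using vnorm_mult_le[OF Y v] by simp
  next
    case False
    let ?w = "complex_of_real (1 / vnorm v) \<cdot>\<^sub>v v"
    have w: "?w \<in> carrier_vec n" "vnorm ?w = 1" using v False v0[of v] by (auto simp: scale[of "1 / vnorm v"] simp del: of_real_divide)
    then have "vnorm (Y *\<^sub>v ?w) \<le> opnorm Y" unfolding opnorm_def using bdd Y by (intro cSup_upper) auto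
    also have "Y *\<^sub>v ?w = complex_of_real (1 / vnorm v) \<cdot>\<^sub>v (Y *\<^sub>v v)" using Y v by (rule mult_mat_vec)
    finally have "1 / vnorm v * vnorm (Y *\<^sub>v v) \<le> opnorm Y" using v0[of v] by (simp add: scale[of "1 / vnorm v"] del: of_real_divide)
    then show ?thesis using False v0[of v] by (simp add: field_simps)
  qed
qed

lemma opnorm_nonneg: assumes "0 < n" "Y \<in> M" shows "0 \<le> opnorm Y"
proof -
  let ?v = "unit_vec n 0 :: complex vec"
  have "vnorm ?v = 1"
  proof -
    have "(\<Sum>i<n. (cmod (?v $ i))\<^sup>2) = (\<Sum>i<n. if i = 0 then 1 else 0)" using assms by (intro sum.cong) auto
    then show ?thesis using assms by (simp add: vnorm_def)
  qed
  moreover have "0 \<le> vnorm (Y *\<^sub>v ?v)" by (simp add: vnorm_def sum_nonneg)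
  ultimately show ?thesis using vnorm_opnorm[OF assms(2), of ?v] by simp
qed

text \<open>The bound for vectors, applied to each column of \<open>B\<close>. In this form the case
  \<open>p = \<infinity>\<close> enters the trace estimates.\<close>

lemma nrm_opnorm: assumes "0 < n" "Y \<in> M" "B \<in> M" shows "nrm (Y * B) \<le> opnorm Y * nrm B"
proof -
  have v0: "0 \<le> vnorm w" for w by (simp add: vnorm_def sum_nonneg)
  have "(nrm (Y * B))\<^sup>2 = (\<Sum>k<n. (vnorm (Y *\<^sub>v col B k))\<^sup>2)"
    using assms by (simp add: nrm_sq_cols mult_mat_vec_def)
  also have "\<dots> \<le> (\<Sum>k<n. (opnorm Y * vnorm (col B k))\<^sup>2)"
    using vnorm_opnorm[OF assms(2)] assms v0 by (intro sum_mono power_mono) auto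
  also have "\<dots> = (opnorm Y * nrm B)\<^sup>2" using assms by (simp add: power_mult_distrib nrm_sq_cols sum_distrib_left)
  finally show ?thesis using opnorm_nonneg[OF assms(1,2)] by (simp add: power2_le_iff_abs_le)
qed

end

section \<open>Powers of \<open>\<sigma>\<close> and the weighted norms\<close>

locale kms = decoh +
  assumes n_pos: "0 < n"
begin

abbreviation sp :: "complex \<Rightarrow> complex mat" where "sp z \<equiv> pw z \<sigma>"

lemma sigma_psd: "psd n \<sigma>" using sigma_pd[OF n_pos] pdD by blast

lemma sp_closed [simp]: "sp z \<in> M" using sigma_psd by simp
lemma sp_mult: "sp z * sp w = sp (z + w)" using sigma_psd by (rule pw_mult)
lemma sp_mult_left: "C \<in> M \<Longrightarrow> sp z * (sp w * C) = sp (z + w) * C" using sigma_psd by (rule pw_mult_left)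
lemma sp_0 [simp]: "sp 0 = 1\<^sub>m n" using sigma_pd[OF n_pos] by (rule pw_0)
lemma sp_1: "sp 1 = \<sigma>" using sigma_psd by (rule pw_1)
lemma sp_adj: "adj (sp z) = sp (cnj z)" using sigma_psd by (rule pw_adj)

lemma sp_commute: "A \<in> N \<Longrightarrow> sp z * A = A * sp z"
  using sigma_commute[of A] by (intro pw_commute sigma_psd) (auto simp: N_M)

lemma sp_commute_left: "A \<in> N \<Longrightarrow> C \<in> M \<Longrightarrow> sp z * (A * C) = A * (sp z * C)"
  using sp_commute[of A z] N_M[of A] by (simp flip: M_assoc)

lemma Gam_sp: "Gam n L s X = sp (of_real (s / 2)) * X * sp (of_real (s / 2))"
  using sigma_psd by (simp add: Gam_def mpow_pw)

text \<open>The map \<open>\<Gamma>^(1/2)\<close>, an isometry from the weighted inner product to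
  the Hilbert-Schmidt one; \<open>Gi\<close> is its inverse.\<close>

abbreviation G :: "complex mat \<Rightarrow> complex mat" where "G X \<equiv> sp (1/4) * X * sp (1/4)"
abbreviation Gi :: "complex mat \<Rightarrow> complex mat" where "Gi X \<equiv> sp (- (1/4)) * X * sp (- (1/4))"

lemma G_Gi: "X \<in> M \<Longrightarrow> G (Gi X) = X"
  by (simp add: M_assoc sp_mult sp_mult_left)

lemma Gi_G: "X \<in> M \<Longrightarrow> Gi (G X) = X"
  by (simp add: M_assoc sp_mult sp_mult_left)

lemma wnorm_2: "X \<in> M \<Longrightarrow> wnorm n L 2 X = nrm (G X)"
proof -
  assume X: "X \<in> M"
  have e: "einv 2 = 1 / 2" by (simp add: einv_def)
  show ?thesis unfolding wnorm_def e Gam_sp using schatten_2[of "G X"] X by simp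
qed

text \<open>The index \<open>4/\<kappa>\<close> will be \<open>2r\<close> for
  \<open>1/r = 1/2 - 1/p = \<kappa>/2\<close>. As \<open>a\<close> commutes with
  \<open>\<sigma>\<close>, the weight splits off: raising the modulus of the weighted matrix to the
  power \<open>4/\<kappa>\<close> gives \<open>\<sigma>\<close> times that power of the modulus of
  \<open>a\<close>.\<close>

lemma wnorm_N:
  assumes a: "a \<in> N" and k: "0 < \<kappa>"
  shows "wnorm n L (ereal (4 / \<kappa>)) a = (Re (tr (\<sigma> * pw (of_real (2 / \<kappa>)) (adj a * a)))) powr (\<kappa> / 4)"
proof -
  note m = N_M[OF a] N_M[OF N_adj[OF a]]
  let ?A = "adj a * a" and ?S = "sp (of_real (\<kappa> / 2))"
  have p: "psd n ?A" using m(1) by (rule psd_adj_mult)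
  have AN: "?A \<in> N" using a by (intro N_mult N_adj)
  let ?t = "Gam n L (einv (ereal (4 / \<kappa>))) a"
  have t: "?t = a * sp (of_real (\<kappa> / 4))"
    using k m a by (simp add: Gam_sp einv_def sp_commute M_assoc sp_mult)
  have tt: "adj ?t * ?t = ?A * ?S"
  proof -
    have "adj ?t * ?t = sp (of_real (\<kappa> / 4)) * (?A * sp (of_real (\<kappa> / 4)))" unfolding t using m by (simp add: adj_mult sp_adj M_assoc)
    also have "\<dots> = ?A * (sp (of_real (\<kappa> / 4)) * sp (of_real (\<kappa> / 4)))" using AN m by (subst sp_commute_left) auto
    finally show ?thesis by (simp add: sp_mult)
  qed
  have comm: "?A * ?S = ?S * ?A" using sp_commute[OF AN] by simp
  have ps: "psd n ?S" using sigma_psd by (rule pw_real_psd)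
  have "pw (of_real (2 / \<kappa>)) (?A * ?S) = pw (of_real (2 / \<kappa>)) ?A * pw (of_real (2 / \<kappa>)) ?S"
    by (rule pw_mult_commuting[OF p ps comm])
  also have "pw (of_real (2 / \<kappa>)) ?S = \<sigma>" using k sigma_psd by (simp add: pw_pw sp_1 del: of_real_divide flip: of_real_mult)
  finally have "tr (pw (of_real (2 / \<kappa>)) (adj ?t * ?t)) = tr (\<sigma> * pw (of_real (2 / \<kappa>)) ?A)"
    unfolding tt using p sigma_prop(1) tr_comm[of "pw (of_real (2 / \<kappa>)) ?A" \<sigma>] by simp
  moreover have "?t \<in> M" unfolding t using m by simp
  ultimately show ?thesis using k by (simp add: wnorm_def schatten_pw)
qed

end

section \<open>The density of \<open>Z^2\<close> on \<open>N\<close>, and the estimate it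
  yields\<close>

locale kmsZ = kms +
  fixes Z :: "complex mat"
  assumes Z: "pd n Z"
begin

definition R :: "complex mat" where "R = E (sp (- (1/2)) * (Z * Z) * sp (- (1/2)))"

lemma Z_psd: "psd n Z" using Z pdD by blast
lemma Z_M [simp]: "Z \<in> M" and Z_adj [simp]: "adj Z = Z" using Z_psd psdD by auto

lemma R_arg_pd: "pd n (sp (- (1/2)) * (Z * Z) * sp (- (1/2)))"
proof -
  have "pd n (adj (sp (- (1/2))) * pw (of_real 2) Z * sp (- (1/2)))"
    by (rule pd_conj[where C = "sp (1/2)"]) (use Z in \<open>auto simp: sp_mult intro: pw_real_pd simp del: of_real_numeral\<close>)
  then show ?thesis using pw_2[OF Z_psd] by (simp add: sp_adj)
qed

lemma R_pd: "pd n R" unfolding R_def by (rule E_pd[OF R_arg_pd])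
lemma R_psd: "psd n R" using R_pd pdD by blast
lemma R_N: "R \<in> N" unfolding R_def by (rule E_N) simp
lemma R_M [simp]: "R \<in> M" using R_N N_M by blast

abbreviation rp :: "complex \<Rightarrow> complex mat" where "rp z \<equiv> pw z R"
text \<open>The power \<open>D^z\<close> of the overview, kept as a product of commuting powers so
  that its derivative at 0 splits into \<open>ln \<sigma> + ln R\<close>.\<close>

definition Dp :: "complex \<Rightarrow> complex mat" where "Dp z = sp z * rp z"

lemma rp_closed [simp]: "rp z \<in> M" using R_psd by simp
lemma rp_N: "rp z \<in> N" using R_psd R_N by (rule N_pw)
lemma rp_mult: "rp z * rp w = rp (z + w)" using R_psd by (rule pw_mult)
lemma rp_mult_left: "C \<in> M \<Longrightarrow> rp z * (rp w * C) = rp (z + w) * C" using R_psd by (rule pw_mult_left)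
lemma rp_0: "rp 0 = 1\<^sub>m n" using R_pd by (rule pw_0)
lemma rp_adj: "adj (rp z) = rp (cnj z)" using R_psd by (rule pw_adj)
lemma sp_rp: "sp z * rp w = rp w * sp z" by (rule sp_commute[OF rp_N])
lemma Dp_closed [simp]: "Dp z \<in> M" by (simp add: Dp_def)
lemma Dp_0: "Dp 0 = 1\<^sub>m n" by (simp add: Dp_def rp_0)
lemma Dp_adj: "adj (Dp z) = Dp (cnj z)" by (simp add: Dp_def adj_mult sp_adj rp_adj sp_rp)
lemma contr_Dp: "Re z = 0 \<Longrightarrow> contr (Dp z)"
  unfolding Dp_def by (intro contr_mult contr_pw_imag sigma_psd R_psd)

text \<open>\<open>E\<close> preserves the pairing with \<open>\<sigma>\<close> and is a module map
  over \<open>N\<close>, so it can be removed from \<open>R\<close>; the outer powers of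
  \<open>\<sigma>\<close> then cancel because they commute with \<open>A\<close>.\<close>

lemma tr_ZZ: assumes A: "A \<in> N" shows "tr (Z * Z * A) = tr (\<sigma> * R * A)"
proof -
  note a = N_M[OF A] and s = sigma_prop(1)
  let ?G = "sp (- (1/2)) * (Z * Z) * sp (- (1/2))"
  have "tr (\<sigma> * R * A) = tr (\<sigma> * E (1\<^sub>m n * ?G * A))"
    using E_bimodule[OF N_one A, of ?G] a s by (simp add: R_def M_assoc)
  also have "\<dots> = tr (\<sigma> * (?G * A))" using a by (subst sigma_E) auto
  also have "\<dots> = tr (sp 1 * (sp (- (1/2)) * (Z * (Z * (sp (- (1/2)) * A)))))" using a s by (simp add: sp_1 M_assoc)
  also have "\<dots> = tr (sp (1/2) * (Z * (Z * (A * sp (- (1/2))))))" using a by (simp add: sp_mult_left sp_commute[OF A])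
  also have "\<dots> = tr ((Z * (Z * (A * sp (- (1/2))))) * sp (1/2))" using a by (intro tr_comm) auto
  also have "\<dots> = tr (Z * Z * A)" using a by (simp add: M_assoc sp_mult)
  finally show ?thesis by simp
qed

lemma nrm_sigma_R: "nrm (sp (1/2) * rp (1/2)) = nrm Z"
proof -
  let ?B = "sp (1/2) * rp (1/2)"
  have "tr (adj ?B * ?B) = tr (sp 1 * rp 1)"
  proof -
    have "adj ?B * ?B = rp (1/2) * (sp 1 * rp (1/2))"
      by (simp add: adj_mult sp_adj rp_adj M_assoc sp_mult_left)
    also have "\<dots> = sp 1 * (rp (1/2) * rp (1/2))" by (simp add: sp_commute_left[OF rp_N])
    finally show ?thesis by (simp add: rp_mult)
  qed
  also have "\<dots> = tr (Z * Z * 1\<^sub>m n)" using tr_ZZ[OF N_one] sigma_prop(1) by (simp add: sp_1 pw_1[OF R_psd])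
  finally have "(nrm ?B)\<^sup>2 = (nrm Z)\<^sup>2"
    using tr_adj_mult_self[of ?B] tr_adj_mult_self[of Z] by (simp flip: of_real_power)
  then show ?thesis by simp
qed

text \<open>In the square of the norm the powers of \<open>\<sigma>\<close> cancel, since
  \<open>2 Re w + 2 Re v = 0\<close>, and \<open>Z^2\<close> is left against an element of
  \<open>N\<close>. There \<open>tr_ZZ\<close> turns it into \<open>\<sigma> R\<close>, the powers
  of \<open>R\<close> add up to \<open>1/2\<close>, and Cauchy-Schwarz is applied with
  \<open>D^(1/2)\<close>, whose norm is that of \<open>Z\<close>.\<close>

lemma boundary_estimate:
  assumes c: "c \<in> N" and w: "Re w = - 1/4" and v: "Re v = 1/4"
  shows "(nrm (Z * Dp w * c * sp v))\<^sup>2 \<le> nrm Z * nrm (sp (1/2) * (c * adj c))"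
proof -
  note m = N_M[OF c]
  let ?Q = "Z * Dp w * c * sp v" and ?C = "c * adj c"
  have Q: "?Q \<in> M" and C: "?C \<in> M" and CN: "?C \<in> N" using m c by (auto intro: N_mult N_adj)
  have vv: "v + cnj v = 1/2" and ww: "w + (1/2 + cnj w) = 0" "cnj w + (1 + w) = 1/2"
    using v w by (simp_all add: complex_eq_iff)
  have QQ: "?Q * adj ?Q = Z * ((rp w * ?C * rp (cnj w)) * Z)"
  proof -
    have "?Q * adj ?Q = Z * (sp w * (rp w * (c * (sp (v + cnj v) * (adj c * (sp (cnj w) * (rp (cnj w) * Z)))))))"
      using m by (simp add: adj_mult Dp_adj sp_adj sp_mult_left M_assoc) (simp add: Dp_def M_assoc)
    also have "c * (sp (v + cnj v) * (adj c * (sp (cnj w) * (rp (cnj w) * Z))))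
       = sp (1/2) * (c * (sp (cnj w) * (adj c * (rp (cnj w) * Z))))"
      unfolding vv using m c N_adj[OF c] by (simp add: sp_commute_left)
    also have "\<dots> = sp (1/2 + cnj w) * (c * (adj c * (rp (cnj w) * Z)))"
      using m c by (simp add: sp_mult_left flip: sp_commute_left[OF c])
    finally have "?Q * adj ?Q = Z * (sp w * (rp w * (sp (1/2 + cnj w) * (c * (adj c * (rp (cnj w) * Z))))))" .
    also have "\<dots> = Z * (sp (w + (1/2 + cnj w)) * (rp w * (c * (adj c * (rp (cnj w) * Z)))))"
      using m by (simp add: sp_mult_left flip: sp_commute_left[OF rp_N])
    finally show ?thesis unfolding ww using m by (simp add: M_assoc)
  qed
  have "complex_of_real ((nrm ?Q)\<^sup>2) = tr (?Q * adj ?Q)"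
    using tr_adj_mult_self[OF Q] tr_comm[of "adj ?Q" ?Q] Q by simp
  also have "\<dots> = tr (Z * Z * (rp w * ?C * rp (cnj w)))"
    unfolding QQ using m tr_comm[of "Z * (rp w * ?C * rp (cnj w))" Z] by (simp add: M_assoc)
  also have "\<dots> = tr (\<sigma> * R * (rp w * ?C * rp (cnj w)))" by (rule tr_ZZ[OF N_mult[OF N_mult[OF rp_N CN] rp_N]])
  also have "\<dots> = tr (sp 1 * (rp 1 * (rp w * ?C)) * rp (cnj w))"
    using m sigma_prop(1) by (simp add: sp_1 pw_1[OF R_psd] M_assoc)
  also have "\<dots> = tr (rp (cnj w) * (sp 1 * (rp 1 * (rp w * ?C))))" using m by (intro tr_comm) auto
  also have "\<dots> = tr (sp 1 * (rp (cnj w + (1 + w)) * ?C))"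
    using m by (simp add: rp_mult_left add.assoc flip: sp_commute_left[OF rp_N])
  also have "\<dots> = tr ((sp (1/2) * rp (1/2)) * (sp (1/2) * ?C))"
  proof -
    have "(sp (1/2) * rp (1/2)) * (sp (1/2) * ?C) = sp (1/2) * (sp (1/2) * (rp (1/2) * ?C))"
      using m sp_commute_left[OF rp_N, of ?C "1/2" "1/2"] by (simp add: M_assoc)
    then show ?thesis unfolding ww using m by (simp add: sp_mult_left)
  qed
  finally have "(nrm ?Q)\<^sup>2 = cmod (tr ((sp (1/2) * rp (1/2)) * (sp (1/2) * ?C)))"
    by (metis norm_of_real abs_of_nonneg zero_le_power2)
  also have "\<dots> \<le> nrm (sp (1/2) * rp (1/2)) * nrm (sp (1/2) * ?C)" using m by (intro cmod_tr_mult_le) auto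
  finally show ?thesis by (simp add: nrm_sigma_R)
qed

end

section \<open>Interpolation on positive matrices\<close>

context kmsZ
begin

lemma mstrip_Dp: "mstrip (\<lambda>z. Dp (c + of_real b * z))"
  unfolding Dp_def by (intro mstrip_mult mstrip_pw sigma_psd R_psd)

lemma nrm_sp_N: assumes A: "A \<in> N" and h: "adj A = A" shows "(nrm (sp (1/2) * A))\<^sup>2 = Re (tr (\<sigma> * (A * A)))"
proof -
  note m = N_M[OF A]
  let ?B = "sp (1/2) * A"
  have "adj ?B * ?B = A * (sp 1 * A)" using m h by (simp add: adj_mult sp_adj M_assoc sp_mult_left)
  also have "\<dots> = sp 1 * (A * A)" using m by (simp add: sp_commute_left[OF A])
  finally have "adj ?B * ?B = \<sigma> * (A * A)" by (simp add: sp_1)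
  then show ?thesis using tr_adj_mult_self[of ?B] m by (simp flip: of_real_power)
qed

text \<open>Pairing with \<open>\<sigma>\<close> is a trace on \<open>N\<close>, so a factor can be
  rotated and \<open>c * adj c\<close> exchanged for \<open>adj c * c\<close>.\<close>

lemma nrm_sp_gram: assumes c: "c \<in> N" shows "(nrm (sp (1/2) * (c * adj c)))\<^sup>2 = Re (tr (\<sigma> * ((adj c * c) * (adj c * c))))"
proof -
  note m = N_M[OF c]
  have "(nrm (sp (1/2) * (c * adj c)))\<^sup>2 = Re (tr (\<sigma> * ((c * adj c) * (c * adj c))))"
    using c m by (intro nrm_sp_N N_mult N_adj) (auto simp: adj_mult)
  also have "tr (\<sigma> * ((c * adj c) * (c * adj c))) = tr (c * (sp 1 * (adj c * (c * adj c))))"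
  proof -
    have "\<sigma> * ((c * adj c) * (c * adj c)) = sp 1 * (c * (adj c * (c * adj c)))"
      using m sigma_prop(1) by (simp add: sp_1 M_assoc)
    then show ?thesis using m by (simp only: sp_commute_left[OF c] M_closed)
  qed
  also have "\<dots> = tr ((sp 1 * (adj c * (c * adj c))) * c)" using m by (intro tr_comm) auto
  also have "\<dots> = tr (\<sigma> * ((adj c * c) * (adj c * c)))" using m sigma_prop(1) by (simp add: M_assoc sp_1)
  finally show ?thesis .
qed

text \<open>Writing \<open>Z^(1+w) = Z * Z^(w-1) * Z\<close> with \<open>w - 1\<close> imaginary
  puts one \<open>Z\<close> at each end of the cyclic product, which is then cut into two factors of
  the kind in \<open>boundary_estimate\<close> with \<open>Y\<close> between them. \<open>K\<close>
  will be an operator norm for \<open>p = \<infinity>\<close>, and 1 on the boundary line for finite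
  \<open>p\<close>.\<close>

lemma line_one:
  assumes w: "Re w = 1" "Re d = - 1/4" "Re d' = - 1/4" "Re s = 1/4" and c: "c \<in> N" "c' \<in> N"
    and Y: "Y \<in> M" "0 \<le> K" "\<And>B. B \<in> M \<Longrightarrow> nrm (Y * B) \<le> K * nrm B"
  shows "cmod (tr (pw (1 + w) Z * Dp d * (c * sp s) * Y * (sp s * c') * Dp d'))
     \<le> K * (nrm Z * sqrt (nrm (sp (1/2) * (c * adj c))) * sqrt (nrm (sp (1/2) * (adj c' * c'))))"
proof -
  note m = N_M[OF c(1)] N_M[OF c(2)]
  let ?Qa = "Z * Dp d * c * sp s" and ?Qb = "sp s * c' * Dp d' * Z"
  have Q: "?Qa \<in> M" "?Qb \<in> M" using m by auto
  have Zw: "pw (1 + w) Z = Z * (pw (w - 1) Z * Z)"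
  proof -
    have "Z * (pw (w - 1) Z * Z) = pw 1 Z * (pw (w - 1) Z * pw 1 Z)" using pw_1[OF Z_psd] by simp
    also have "\<dots> = pw (1 + (w - 1 + 1)) Z" using pw_mult[OF Z_psd] by simp
    finally show ?thesis by simp
  qed
  have "tr (pw (1 + w) Z * Dp d * (c * sp s) * Y * (sp s * c') * Dp d')
     = tr (Z * (pw (w - 1) Z * ?Qa * (Y * (sp s * c' * Dp d'))))"
    unfolding Zw using m Y Z_psd by (simp add: M_assoc)
  also have "\<dots> = tr ((pw (w - 1) Z * ?Qa * (Y * (sp s * c' * Dp d'))) * Z)"
    using m Y Z_psd by (intro tr_comm) auto
  also have "\<dots> = tr ((pw (w - 1) Z * ?Qa) * (Y * ?Qb))" using m Y Z_psd by (simp add: M_assoc)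
  finally have "cmod (tr (pw (1 + w) Z * Dp d * (c * sp s) * Y * (sp s * c') * Dp d'))
      \<le> nrm (pw (w - 1) Z * ?Qa) * nrm (Y * ?Qb)"
    using cmod_tr_mult_le[of "pw (w - 1) Z * ?Qa" "Y * ?Qb"] m Y Z_psd by simp
  also have "\<dots> \<le> nrm ?Qa * (K * nrm ?Qb)"
    using contrD(2)[OF contr_pw_imag[OF Z_psd, of "w - 1"] Q(1)] Y(3)[OF Q(2)] w by (intro mult_mono) auto
  also have "\<dots> \<le> sqrt (nrm Z * nrm (sp (1/2) * (c * adj c))) * (K * sqrt (nrm Z * nrm (sp (1/2) * (adj c' * c'))))"
  proof (intro mult_mono)
    show "nrm ?Qa \<le> sqrt (nrm Z * nrm (sp (1/2) * (c * adj c)))"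
      using boundary_estimate[OF c(1) w(2,4)] by (rule real_le_rsqrt)
    have "adj ?Qb = Z * Dp (cnj d') * adj c' * sp (cnj s)" using m by (simp add: adj_mult Dp_adj sp_adj M_assoc)
    then have "nrm ?Qb = nrm (Z * Dp (cnj d') * adj c' * sp (cnj s))" using nrm_adj[OF Q(2)] by simp
    then show "nrm ?Qb \<le> sqrt (nrm Z * nrm (sp (1/2) * (adj c' * c')))"
      using boundary_estimate[OF N_adj[OF c(2)], of "cnj d'" "cnj s"] w by (intro real_le_rsqrt) simp
  qed (use Y in auto)
  also have "\<dots> = K * (nrm Z * sqrt (nrm (sp (1/2) * (c * adj c))) * sqrt (nrm (sp (1/2) * (adj c' * c'))))"
    by (simp add: real_sqrt_mult)
  finally show ?thesis .
qed

text \<open>For \<open>a\<close> in \<open>N\<close>, the power \<open>4/\<kappa>\<close> of its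
  weighted \<open>4/\<kappa>\<close>-norm.\<close>

definition \<alpha> :: "real \<Rightarrow> complex mat \<Rightarrow> real" where
  "\<alpha> \<kappa> a = Re (tr (\<sigma> * pw (of_real (2 / \<kappa>)) (adj a * a)))"

lemma cc_N: assumes "a \<in> N" shows "cc a u \<in> N"
  unfolding cc_def using assms N_M[OF assms] by (intro N_mult N_pw psd_adj_mult N_adj)

text \<open>The condition on \<open>u\<close> is what the line \<open>Re w = 1\<close> produces
  below; it makes the square of the Gram matrix of \<open>cc a u\<close> equal to
  \<open>|a|^(4/\<kappa>)\<close>.\<close>

lemma alpha_cc:
  assumes a: "a \<in> N" and u: "cnj u + 1 + u = of_real (1 / \<kappa>)"
  shows "sqrt (nrm (sp (1/2) * (cc a u * adj (cc a u)))) = \<alpha> \<kappa> a powr (1/4)"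
    and "sqrt (nrm (sp (1/2) * (adj (cc a u) * cc a u))) = \<alpha> \<kappa> a powr (1/4)"
proof -
  note m = N_M[OF a] and p = psd_adj_mult[OF N_M[OF a]]
  have sq: "(adj (cc a u) * cc a u) * (adj (cc a u) * cc a u) = pw (of_real (2 / \<kappa>)) (adj a * a)"
    unfolding cc_gram[OF m] u pw_mult[OF p] by (simp flip: of_real_add add: field_simps)
  have root: "sqrt x = \<alpha> \<kappa> a powr (1/4)" if "x\<^sup>2 = \<alpha> \<kappa> a" "0 \<le> x" for x
  proof -
    have "\<alpha> \<kappa> a powr (1/4) = (x powr 2) powr (1/4)" using that by (cases "x = 0") (auto simp: powr_numeral)
    also have "\<dots> = x powr (1/2)" by (simp add: powr_powr)
    finally show ?thesis using that by (simp add: powr_half_sqrt)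
  qed
  show "sqrt (nrm (sp (1/2) * (cc a u * adj (cc a u)))) = \<alpha> \<kappa> a powr (1/4)"
    using nrm_sp_gram[OF cc_N[OF a, of u]] sq by (intro root) (auto simp: \<alpha>_def)
  show "sqrt (nrm (sp (1/2) * (adj (cc a u) * cc a u))) = \<alpha> \<kappa> a powr (1/4)"
    using nrm_sp_N[OF N_mult[OF N_adj[OF cc_N[OF a, of u]] cc_N[OF a, of u]]] sq m
    by (intro root) (auto simp: \<alpha>_def adj_mult)
qed

text \<open>Stein interpolation in \<open>w\<close> with the target at \<open>w = \<kappa>\<close>.
  On \<open>Re w = 0\<close> the factors from \<open>a\<close> and \<open>b\<close> are partial
  isometries and the imaginary powers contractions, so Cauchy-Schwarz leaves only the norms of
  \<open>Z\<close> and of the factor from \<open>Y\<close>; on \<open>Re w = 1\<close> the factor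
  from \<open>Y\<close> is a contraction and \<open>line_one\<close> applies.\<close>

lemma interpolation_finite:
  fixes \<kappa> \<eta> :: real
  assumes a: "a \<in> N" and b: "b \<in> N" and Y: "Y \<in> M" and k: "0 < \<kappa>" "\<kappa> < 1"
  shows "cmod (tr (pw (of_real (1 + \<kappa>)) Z * Dp (of_real (- \<kappa>/4) - \<i> * of_real \<eta>) * (a * sp (of_real (\<kappa>/4))) * Y
        * (sp (of_real (\<kappa>/4)) * b) * Dp (of_real (- \<kappa>/4) + \<i> * of_real \<eta>)))
     \<le> nrm Z * (\<alpha> \<kappa> a powr (\<kappa>/4) * \<alpha> \<kappa> b powr (\<kappa>/4) * Re (tr (pw (of_real (1 / (1 - \<kappa>))) (adj Y * Y))) powr ((1 - \<kappa>)/2))"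
proof -
  note m = N_M[OF a] N_M[OF b]
  \<comment> \<open>Both exponents are affine and vanish at \<open>w = \<kappa>\<close>, where
    \<open>cc\<close> returns the given matrices; \<open>u\<close> is \<open>-1/2\<close> at
    \<open>w = 0\<close> and \<open>v\<close> is \<open>-1/2\<close> at \<open>w = 1\<close>. With
    \<open>1/(1 - \<kappa>) = p/2\<close>, the quantity \<open>h\<close> is the \<open>p\<close>-th
    power of the Schatten norm of \<open>Y\<close>.\<close>
  define u where "u w = - 1/2 + of_real (1 / (2 * \<kappa>)) * w" for w :: complex
  define c where "c = 1 / (2 * (1 - \<kappa>))"
  have c: "2 * c = 1 / (1 - \<kappa>)" "c - 1/2 - c * \<kappa> = 0" using k by (simp_all add: c_def field_simps)
  define v where "v w = of_real (c - 1/2) + of_real (- c) * w" for w :: complex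
  \<comment> \<open>The shift by \<open>\<eta>\<close> stays fixed during the interpolation. Only
    real parts of exponents enter the boundary bounds, so the result is uniform in
    \<open>\<eta>\<close>.\<close>
  define d where "d w = - (\<i> * of_real \<eta>) + of_real (- 1/4) * w" for w :: complex
  define d' where "d' w = \<i> * of_real \<eta> + of_real (- 1/4) * w" for w :: complex
  define s where "s w = 0 + of_real (1/4) * w" for w :: complex
  define J where "J w = tr (pw (1 + of_real 1 * w) Z * Dp (d w) * (cc a (u w) * sp (s w)) * cc Y (v w) * (sp (s w) * cc b (u w)) * Dp (d' w))" for w
  have st: "strip J"
    unfolding J_def u_def v_def d_def d'_def s_def
    by (intro mstrip_tr mstrip_mult mstrip_Dp mstrip_cc mstrip_pw Z_psd sigma_psd Y m)
  define h where "h = Re (tr (pw (of_real (1 / (1 - \<kappa>))) (adj Y * Y)))"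
  have vv: "cnj (v w) + 1 + v w = of_real ((1 - Re w) / (1 - \<kappa>))" for w
  proof -
    have "(1 - Re w) / (1 - \<kappa>) = 2 * c * (1 - Re w)" unfolding c by simp
    then show ?thesis by (simp add: v_def complex_eq_iff algebra_simps)
  qed
  have uu: "cnj (u w) + 1 + u w = of_real (Re w / \<kappa>)" for w
    using k by (simp add: u_def complex_eq_iff)
  have h: "(nrm (cc Y (v w)))\<^sup>2 = h" if "Re w = 0" for w
    unfolding nrm_cc[OF Y] vv that h_def by simp
  have h0: "0 \<le> h" using h[of 0] zero_le_power2[of "nrm (cc Y (v 0))"] by simp
  let ?M0 = "nrm Z * sqrt h" and ?M1 = "nrm Z * \<alpha> \<kappa> a powr (1/4) * \<alpha> \<kappa> b powr (1/4)"
  have "cmod (J (of_real \<kappa>)) \<le> ?M0 powr (1 - \<kappa>) * ?M1 powr \<kappa>"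
  proof (rule three_lines[OF st])
    fix w assume w: "Re w = 0"
    have ru: "Re (u w) = - 1/2" using w by (simp add: u_def)
    have c1: "contr (pw w Z * (Dp (d w) * (cc a (u w) * sp (s w))))"
      using w ru m by (intro contr_mult contr_pw_imag contr_Dp contr_cc Z_psd sigma_psd) (auto simp: d_def s_def)
    have c2: "contr ((sp (s w) * cc b (u w)) * Dp (d' w))"
      using w ru m by (intro contr_mult contr_pw_imag contr_Dp contr_cc Z_psd sigma_psd) (auto simp: d'_def s_def)
    have "pw (1 + w) Z = Z * pw w Z" using pw_mult[OF Z_psd, of 1 w] pw_1[OF Z_psd] by simp
    then have Jw: "J w = tr ((Z * (pw w Z * (Dp (d w) * (cc a (u w) * sp (s w))))) * (cc Y (v w) * ((sp (s w) * cc b (u w)) * Dp (d' w))))"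
      using m Y Z_psd by (simp add: J_def M_assoc)
    have "cmod (J w) \<le> nrm (Z * (pw w Z * (Dp (d w) * (cc a (u w) * sp (s w))))) * nrm (cc Y (v w) * ((sp (s w) * cc b (u w)) * Dp (d' w)))"
      unfolding Jw using m Y Z_psd by (intro cmod_tr_mult_le) auto
    also have "\<dots> \<le> nrm Z * nrm (cc Y (v w))"
      using contr_right[OF c1] contr_right[OF c2] Y by (intro mult_mono) auto
    also have "nrm (cc Y (v w)) = sqrt h" using h[OF w] by (metis nrm_nonneg real_sqrt_abs abs_of_nonneg)
    finally show "cmod (J w) \<le> ?M0" .
  next
    fix w assume w: "Re w = 1"
    have cY: "contr (cc Y (v w))" by (rule contr_cc[OF Y]) (use w k in \<open>simp add: v_def\<close>)
    have J1: "J w = tr (pw (1 + w) Z * Dp (d w) * (cc a (u w) * sp (s w)) * cc Y (v w) * (sp (s w) * cc b (u w)) * Dp (d' w))"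
      by (simp add: J_def)
    have "cmod (J w) \<le> 1 * (nrm Z * sqrt (nrm (sp (1/2) * (cc a (u w) * adj (cc a (u w))))) * sqrt (nrm (sp (1/2) * (adj (cc b (u w)) * cc b (u w)))))"
      unfolding J1 by (rule line_one) (use w a b Y contrD[OF cY] in \<open>auto simp: d_def d'_def s_def intro: cc_N\<close>)
    also have "\<dots> = ?M1" using alpha_cc(1)[OF a, of "u w" \<kappa>] alpha_cc(2)[OF b, of "u w" \<kappa>] uu[of w] w by simp
    finally show "cmod (J w) \<le> ?M1" .
  qed (use k h0 in auto)
  also have "?M0 powr (1 - \<kappa>) * ?M1 powr \<kappa> = nrm Z * (\<alpha> \<kappa> a powr (\<kappa>/4) * \<alpha> \<kappa> b powr (\<kappa>/4) * h powr ((1 - \<kappa>)/2))"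
  proof -
    have "nrm Z powr (1 - \<kappa>) * nrm Z powr \<kappa> = nrm Z" by (simp flip: powr_add)
    moreover have "sqrt h powr (1 - \<kappa>) = h powr ((1 - \<kappa>)/2)" using h0 by (simp add: powr_half_sqrt[symmetric] powr_powr)
    ultimately show ?thesis using h0 by (simp add: powr_mult powr_powr mult_ac)
  qed
  finally have *: "cmod (J (of_real \<kappa>)) \<le> nrm Z * (\<alpha> \<kappa> a powr (\<kappa>/4) * \<alpha> \<kappa> b powr (\<kappa>/4) * h powr ((1 - \<kappa>)/2))" .
  have u0: "u (of_real \<kappa>) = 0" using k by (simp add: u_def)
  have v0: "v (of_real \<kappa>) = 0"
  proof -
    have "v (of_real \<kappa>) = of_real (c - 1/2 - c * \<kappa>)" by (simp add: v_def)
    also have "\<dots> = 0" unfolding c by simp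
    finally show ?thesis .
  qed
  have ds: "d (of_real \<kappa>) = of_real (- \<kappa>/4) - \<i> * of_real \<eta>" "d' (of_real \<kappa>) = of_real (- \<kappa>/4) + \<i> * of_real \<eta>"
     "s (of_real \<kappa>) = of_real (\<kappa>/4)" by (simp_all add: d_def d'_def s_def)
  have "J (of_real \<kappa>) = tr (pw (of_real (1 + \<kappa>)) Z * Dp (of_real (- \<kappa>/4) - \<i> * of_real \<eta>) * (a * sp (of_real (\<kappa>/4))) * Y
        * (sp (of_real (\<kappa>/4)) * b) * Dp (of_real (- \<kappa>/4) + \<i> * of_real \<eta>))"
    unfolding J_def u0 v0 ds cc_zero[OF m(1)] cc_zero[OF m(2)] cc_zero[OF Y] by simp
  then show ?thesis using * by (simp add: h_def)
qed

text \<open>Of each outer power \<open>1/4\<close> of \<open>\<sigma>\<close>, the part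
  \<open>1/(2p)\<close> goes to \<open>Y\<close> and turns its weighted norm into a plain Schatten
  norm, while \<open>\<kappa>/4\<close> stays with \<open>a\<close> or \<open>b\<close>. For
  \<open>p = \<infinity>\<close> one has \<open>\<kappa> = 1\<close>, the end point, where
  \<open>line_one\<close> applies directly.\<close>

lemma interpolation:
  fixes p :: ereal and \<kappa> \<eta> :: real
  assumes a: "a \<in> N" and b: "b \<in> N" and Y: "Y \<in> M" and p: "2 < p" and k: "\<kappa> = 1 - 2 * einv p"
  shows "cmod (tr (pw (of_real (1 + \<kappa>)) Z * Dp (of_real (- \<kappa>/4) - \<i> * of_real \<eta>) * G (a * Y * b) * Dp (of_real (- \<kappa>/4) + \<i> * of_real \<eta>)))
     \<le> nrm Z * (wnorm n L (ereal (4 / \<kappa>)) a * wnorm n L (ereal (4 / \<kappa>)) b * wnorm n L p Y)"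
proof -
  note m = N_M[OF a] N_M[OF b]
  let ?Y = "Gam n L (einv p) Y"
  have Y': "?Y \<in> M" using Y by (simp add: Gam_sp)
  have quarter: "1/4 = complex_of_real (\<kappa>/4) + of_real (einv p / 2)" unfolding k by (simp add: field_simps)
  have GY: "G (a * Y * b) = (a * sp (of_real (\<kappa>/4))) * ?Y * (sp (of_real (\<kappa>/4)) * b)"
  proof -
    let ?k = "sp (of_real (\<kappa>/4))" and ?e = "sp (of_real (einv p / 2))"
    have s: "?k * ?e = sp (1/4)" "?e * ?k = sp (1/4)"
      unfolding sp_mult quarter by (simp_all add: add.commute)
    have "G (a * Y * b) = a * (sp (1/4) * (Y * (sp (1/4) * b)))"
      using m Y by (simp add: M_assoc sp_commute_left[OF a] sp_commute[OF b])
    also have "\<dots> = a * ((?k * ?e) * (Y * ((?e * ?k) * b)))" by (simp only: s)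
    also have "\<dots> = (a * ?k) * ?Y * (?k * b)" unfolding Gam_sp using m Y by (simp only: M_assoc M_closed sp_closed)
    finally show ?thesis .
  qed
  have kpos: "0 < \<kappa>" "\<kappa> \<le> 1" and k1: "p \<noteq> \<infinity> \<Longrightarrow> \<kappa> < 1"
    using p unfolding k by (cases p; auto simp: einv_def field_simps)+
  have w: "wnorm n L (ereal (4 / \<kappa>)) x = \<alpha> \<kappa> x powr (\<kappa>/4)" if "x \<in> N" for x
    using wnorm_N[OF that kpos(1)] by (simp add: \<alpha>_def)
  show ?thesis
  proof (cases "p = \<infinity>")
    case False
    then obtain r where r: "p = ereal r" "2 < r" using p by (cases p) auto
    have "1 / (1 - \<kappa>) = r / 2" "(1 - \<kappa>) / 2 = 1 / r" using r unfolding k by (auto simp: einv_def)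
    then have "wnorm n L p Y = Re (tr (pw (of_real (1 / (1 - \<kappa>))) (adj ?Y * ?Y))) powr ((1 - \<kappa>)/2)"
      using schatten_pw[OF Y', of r] r by (simp add: wnorm_def)
    then show ?thesis using interpolation_finite[OF a b Y' kpos(1) k1[OF False], of \<eta>] w[OF a] w[OF b] m Y' Z_psd
      unfolding GY by (simp add: M_assoc)
  next
    case True
    then have k1: "\<kappa> = 1" by (simp add: k einv_def)
    have "\<alpha> \<kappa> x powr (1/4) = sqrt (nrm (sp (1/2) * (x * adj x)))" "\<alpha> \<kappa> x powr (1/4) = sqrt (nrm (sp (1/2) * (adj x * x)))" if "x \<in> N" for x
      using alpha_cc[OF that, of 0 \<kappa>] N_M[OF that] by (simp_all add: cc_zero k1)
    then have e: "wnorm n L (ereal (4 / \<kappa>)) a = sqrt (nrm (sp (1/2) * (a * adj a)))"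
       "wnorm n L (ereal (4 / \<kappa>)) b = sqrt (nrm (sp (1/2) * (adj b * b)))" "wnorm n L p Y = opnorm ?Y"
      using w[OF a] w[OF b] a b True by (simp_all add: k1 wnorm_def schatten_def)
    have "cmod (tr (pw (1 + of_real \<kappa>) Z * Dp (of_real (- \<kappa>/4) - \<i> * of_real \<eta>) * (a * sp (of_real (\<kappa>/4))) * ?Y * (sp (of_real (\<kappa>/4)) * b) * Dp (of_real (- \<kappa>/4) + \<i> * of_real \<eta>)))
      \<le> opnorm ?Y * (nrm Z * sqrt (nrm (sp (1/2) * (a * adj a))) * sqrt (nrm (sp (1/2) * (adj b * b))))"
      by (rule line_one) (use k1 a b Y' n_pos in \<open>auto intro: nrm_opnorm opnorm_nonneg\<close>)
    then show ?thesis unfolding GY e using m Y' Z_psd by (simp add: M_assoc mult_ac)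
  qed
qed

text \<open>The interpolation bound holds for every factorisation, hence for the infimum, which the
  hypothesis controls at \<open>X = Gi A\<close>; the weighted 2-norm of \<open>Gi A\<close> is
  \<open>nrm A\<close>.\<close>

lemma psd_estimate:
  fixes p :: ereal and \<kappa> \<eta> :: real
  assumes p: "2 < p" and k: "\<kappa> = 1 - 2 * einv p" 
    and hyp: "\<forall>X. psd n X \<longrightarrow> abnorm n L 2 p (P T X) \<le> Mp * wnorm n L 2 X"
    and A: "psd n A"
  shows "cmod (tr (pw (of_real (1 + \<kappa>)) Z * Dp (of_real (- \<kappa>/4) - \<i> * of_real \<eta>) * G (P T (Gi A)) * Dp (of_real (- \<kappa>/4) + \<i> * of_real \<eta>)))
     \<le> nrm Z * (Mp * nrm A)" (is "?l \<le> _")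
proof -
  have a: "A \<in> M" using A psdD by blast
  have gp: "psd n (Gi A)" using psd_conj[OF A, of "sp (- (1/4))"] by (simp add: sp_adj)
  let ?q = "ereal (4 / \<kappa>)"
  let ?S = "{wnorm n L ?q a * wnorm n L ?q b * wnorm n L p Y | a b Y. a \<in> N \<and> b \<in> N \<and> Y \<in> M \<and> P T (Gi A) = a * Y * b}"
  have k0: "0 < \<kappa>" using p unfolding k by (cases p) (auto simp: einv_def field_simps)
  have e2: "einv 2 = 1/2" by (simp add: einv_def)
  have ek: "einv 2 - einv p = \<kappa> / 2" unfolding e2 k by simp
  have ab: "abnorm n L 2 p (P T (Gi A)) = Inf ?S"
    unfolding abnorm_def Let_def ek using k0 by simp
  have "wnorm n L 2 (Gi A) = nrm A" using wnorm_2[of "Gi A"] G_Gi[OF a] a by simp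
  then have le: "Inf ?S \<le> Mp * nrm A" using hyp gp ab by metis
  \<comment> \<open>The trivial factorisation keeps the infimum from being one over the empty
    set.\<close>
  have ne: "?S \<noteq> {}"
  proof -
    have "wnorm n L ?q (1\<^sub>m n) * wnorm n L ?q (1\<^sub>m n) * wnorm n L p (P T (Gi A)) \<in> ?S"
      unfolding mem_Collect_eq
      by (rule exI[of _ "1\<^sub>m n"], rule exI[of _ "1\<^sub>m n"], rule exI[of _ "P T (Gi A)"]) (use N_one a in simp)
    then show ?thesis by blast
  qed
  have "?l \<le> nrm Z * (Mp * nrm A + \<epsilon>)" if e: "0 < \<epsilon>" for \<epsilon>
  proof -
    have "Inf ?S < Mp * nrm A + \<epsilon>" using le e by linarith
    then obtain x where x: "x \<in> ?S" "x < Mp * nrm A + \<epsilon>" using cInf_lessD[OF ne] by blast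
    then obtain a b Y where aby: "x = wnorm n L ?q a * wnorm n L ?q b * wnorm n L p Y" "a \<in> N" "b \<in> N" "Y \<in> M" "P T (Gi A) = a * Y * b"
      by blast
    have "?l \<le> nrm Z * x" unfolding aby(5) aby(1) by (rule interpolation[OF aby(2-4) p k])
    also have "\<dots> \<le> nrm Z * (Mp * nrm A + \<epsilon>)" using x by (intro mult_left_mono) auto
    finally show ?thesis .
  qed
  then have "?l \<le> nrm Z * (Mp * nrm A) + \<delta>" if d: "0 < \<delta>" for \<delta>
  proof -
    have "?l \<le> nrm Z * (Mp * nrm A + \<delta> / (nrm Z + 1))" using d by (intro \<open>\<And>\<epsilon>. 0 < \<epsilon> \<Longrightarrow> ?l \<le> nrm Z * (Mp * nrm A + \<epsilon>)\<close>) (auto intro!: divide_pos_pos add_nonneg_pos)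
    also have "\<dots> = nrm Z * (Mp * nrm A) + nrm Z / (nrm Z + 1) * \<delta>" by (simp add: algebra_simps)
    also have "nrm Z / (nrm Z + 1) * \<delta> \<le> 1 * \<delta>" using d by (intro mult_right_mono) (auto simp: divide_le_eq add_nonneg_pos)
    finally show ?thesis by simp
  qed
  then show ?thesis by (rule field_le_epsilon)
qed

end

section \<open>The logarithmic Sobolev inequality\<close>

lemma nonneg_right_imp_deriv_nonneg:
  fixes \<phi> :: "real \<Rightarrow> real"
  assumes "(\<phi> has_real_derivative D) (at 0)" "\<phi> 0 = 0" "\<And>t. 0 < t \<Longrightarrow> t < 1 \<Longrightarrow> 0 \<le> \<phi> t"
  shows "0 \<le> D"
proof (rule ccontr)
  assume "\<not> 0 \<le> D"
  then obtain d where d: "0 < d" "\<forall>h>0. h < d \<longrightarrow> \<phi> (0 + h) < \<phi> 0"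
    using DERIV_neg_dec_right[OF assms(1)] by auto
  define h where "h = min (d/2) (1/2)"
  have "0 < h" "h < d" "h < 1" using d(1) by (auto simp: h_def)
  then show False using d(2) assms(2) assms(3)[of h] by force
qed

locale rev = kms +
  assumes rev: "reversible n L"
begin

lemma winner_Gi_left: "A \<in> M \<Longrightarrow> Y \<in> M \<Longrightarrow> winner n L (Gi A) Y = tr (adj A * G Y)"
proof -
  assume m: "A \<in> M" "Y \<in> M"
  have "winner n L (Gi A) Y = tr (sp (1/4) * (adj A * (sp (1/4) * Y)))"
    using m sigma_psd by (simp add: winner_def mpow_pw adj_mult sp_adj M_assoc sp_mult_left)
  also have "\<dots> = tr ((adj A * (sp (1/4) * Y)) * sp (1/4))" using m by (intro tr_comm) auto
  finally show ?thesis using m by (simp add: M_assoc)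
qed

lemma winner_Gi_right: "X \<in> M \<Longrightarrow> B \<in> M \<Longrightarrow> winner n L X (Gi B) = tr (adj (G X) * B)"
proof -
  assume m: "X \<in> M" "B \<in> M"
  have "winner n L X (Gi B) = tr ((sp (1/2) * (adj X * (sp (1/4) * B))) * sp (- (1/4)))"
    using m sigma_psd by (simp add: winner_def mpow_pw M_assoc sp_mult_left)
  also have "\<dots> = tr (sp (- (1/4)) * (sp (1/2) * (adj X * (sp (1/4) * B))))" using m by (intro tr_comm) auto
  finally show ?thesis using m by (simp add: M_assoc adj_mult sp_adj sp_mult_left)
qed

text \<open>The generator transported by \<open>G\<close>; reversibility becomes self-adjointness
  for the Hilbert-Schmidt inner product.\<close>

definition Lam :: "complex mat \<Rightarrow> complex mat" where "Lam Y = G (L (Gi Y))"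

lemma G_lin: "lin_map n (\<lambda>X. G X)"
  by (auto simp: lin_map_def M_distrib M_smult)

lemma Lam_lin: "lin_map n Lam"
  unfolding lin_map_def Lam_def
  by (auto simp: M_distrib M_smult lin_add[OF L] lin_smult[OF L])

lemma Lam_sym: assumes "A \<in> M" "B \<in> M" shows "tr (adj A * Lam B) = tr (adj (Lam A) * B)"
proof -
  have "winner n L (Gi A) (L (Gi B)) = winner n L (L (Gi A)) (Gi B)" using rev assms by (simp add: reversible_def)
  then show ?thesis using assms by (simp add: winner_Gi_left winner_Gi_right Lam_def)
qed

lemma G_Lpow: "X \<in> M \<Longrightarrow> G ((L ^^ k) X) = (Lam ^^ k) (G X)"
proof (induction k)
  case (Suc k)
  then have "(Lam ^^ Suc k) (G X) = Lam (G ((L ^^ k) X))" by simp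
  also have "\<dots> = G ((L ^^ Suc k) X)" using Suc.prems by (simp add: Lam_def Gi_G)
  finally show ?case by simp
qed simp

end

locale reveig = rev +
  fixes e :: "nat \<Rightarrow> complex mat" and l :: "nat \<Rightarrow> real"
  assumes eig: "eigbasis n Lam e l"

sublocale reveig \<subseteq> eigbasis n Lam e l by (rule eig)

context reveig
begin

text \<open>The semigroup is a power series in \<open>L\<close>, the evolution \<open>W\<close> an
  exponential of eigenvalues. They agree entry by entry because \<open>G\<close> carries powers of
  \<open>L\<close> to powers of \<open>Lam\<close>.\<close>

lemma G_P: assumes X: "X \<in> M" shows "G (P t X) = W (\<lambda>m. exp (of_real (l m * t))) (G X)"
proof (rule M_eqI)
  fix i j assume ij: "i < n" "j < n"
  have GX: "G X \<in> M" using X by simp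
  define x where "x m = tr (adj (e m) * G X) * e m $$ (i,j)" for m
  have ex: "(\<lambda>k. complex_of_real (t ^ k / fact k) * of_real (l m) ^ k * x m) sums (exp (of_real (l m * t)) * x m)" for m
  proof (rule sums_mult2)
    have "(\<lambda>k. complex_of_real (l m * t) ^ k /\<^sub>R fact k) sums exp (of_real (l m * t))" by (rule exp_converges)
    then show "(\<lambda>k. complex_of_real (t ^ k / fact k) * of_real (l m) ^ k) sums exp (of_real (l m * t))"
      by (simp add: scaleR_conv_of_real power_mult_distrib field_simps)
  qed
  have "(\<lambda>k. \<Sum>m<n * n. complex_of_real (t ^ k / fact k) * of_real (l m) ^ k * x m) sums (\<Sum>m<n * n. exp (of_real (l m * t)) * x m)"
    by (intro sums_sum ex)
  moreover have "(\<Sum>m<n * n. complex_of_real (t ^ k / fact k) * of_real (l m) ^ k * x m) = complex_of_real (t ^ k / fact k) * G ((L ^^ k) X) $$ (i,j)" for k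
    unfolding G_Lpow[OF X] Lambda_pow_W[OF GX] W_ij[OF ij] by (simp add: x_def sum_distrib_left mult_ac)
  ultimately have "(\<lambda>k. complex_of_real (t ^ k / fact k) * G ((L ^^ k) X) $$ (i,j)) sums (\<Sum>m<n * n. exp (of_real (l m * t)) * x m)"
    by simp
  moreover have "(\<lambda>k. complex_of_real (t ^ k / fact k) * G ((L ^^ k) X) $$ (i,j)) sums (G (P t X) $$ (i,j))"
    by (rule lin_sg_sums[OF G_lin X ij])
  ultimately have "G (P t X) $$ (i,j) = (\<Sum>m<n * n. exp (of_real (l m * t)) * x m)" by (rule sums_unique2[symmetric])
  then show "G (P t X) $$ (i,j) = W (\<lambda>m. exp (of_real (l m * t))) (G X) $$ (i,j)"
    unfolding W_ij[OF ij] by (simp add: x_def mult_ac)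
qed (use X in auto)

end

locale reveigZ = reveig n L \<rho> e l + kmsZ n L \<rho> Z for n L \<rho> e l Z
begin

section \<open>The interpolating function: boundary values and derivative\<close>

context
  fixes p :: ereal and \<kappa> T Mp :: real
  assumes p: "2 < p" and k: "\<kappa> = 1 - 2 * einv p" and T: "0 < T" and Mp: "0 < Mp"
    and hyp: "\<forall>X. psd n X \<longrightarrow> abnorm n L 2 p (P T X) \<le> Mp * wnorm n L 2 X"
begin

definition V :: "complex \<Rightarrow> complex mat" where "V z = W (\<lambda>m. exp (of_real (l m * T) * z)) Z"

definition F :: "complex \<Rightarrow> complex" where
  "F z = tr (pw (1 + of_real \<kappa> * z) Z * Dp (0 + of_real (- \<kappa>/4) * z) * V z * Dp (0 + of_real (- \<kappa>/4) * z))"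

lemma V_closed [simp]: "V z \<in> M" by (simp add: V_def)

lemma F_strip: "strip F"
  unfolding F_def V_def by (intro mstrip_tr mstrip_mult mstrip_pw mstrip_Dp mstrip_W Z_psd)

lemma nrm_V: "Re z = 0 \<Longrightarrow> nrm (V z) = nrm Z"
  unfolding V_def by (intro nrm_W) (auto simp: norm_exp_eq_Re)

lemma F_line_zero: assumes z: "Re z = 0" shows "cmod (F z) \<le> (nrm Z)\<^sup>2"
proof -
  let ?D = "Dp (0 + of_real (- \<kappa>/4) * z)"
  have c: "contr ?D" "contr (pw (of_real \<kappa> * z) Z)" using z by (auto intro!: contr_Dp contr_pw_imag Z_psd)
  have "pw (1 + of_real \<kappa> * z) Z = Z * pw (of_real \<kappa> * z) Z" using pw_mult[OF Z_psd, of 1 "of_real \<kappa> * z"] pw_1[OF Z_psd] by simp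
  then have Fz: "F z = tr ((Z * pw (of_real \<kappa> * z) Z) * (?D * (V z * ?D)))" unfolding F_def using Z_psd by (simp add: M_assoc)
  have "cmod (F z) \<le> nrm (Z * pw (of_real \<kappa> * z) Z) * nrm (?D * (V z * ?D))" unfolding Fz using Z_psd by (intro cmod_tr_mult_le) auto
  also have "\<dots> \<le> nrm Z * nrm (V z)"
  proof (intro mult_mono)
    have "nrm (?D * (V z * ?D)) \<le> nrm (V z * ?D)" using contrD(2)[OF c(1)] by simp
    also have "\<dots> \<le> nrm (V z)" using contr_right[OF c(1)] by simp
    finally show "nrm (?D * (V z * ?D)) \<le> nrm (V z)" .
  qed (use contr_right[OF c(2)] in auto)
  finally show ?thesis using nrm_V[OF z] by (simp add: power2_eq_square)
qed

text \<open>A value on the line \<open>Re z = 1\<close> is the semigroup at time \<open>T\<close>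
  applied to a value on \<open>Re z = 0\<close>, whose norm is that of \<open>Z\<close>. This brings
  the hypothesis at time \<open>T\<close> into play.\<close>

lemma V_step: "V (1 + z) = G (P T (Gi (V z)))"
proof -
  have "G (P T (Gi (V z))) = W (\<lambda>m. exp (of_real (l m * T))) (V z)" using G_P[of "Gi (V z)" T] by (simp add: G_Gi)
  also have "\<dots> = V (1 + z)" unfolding V_def W_W by (simp add: exp_add[symmetric] algebra_simps)
  finally show ?thesis by simp
qed

text \<open>The hypothesis only concerns positive semidefinite matrices, while \<open>V (\<i> y)\<close> is not even
  self-adjoint. It is the corner of the positive block matrix with diagonal \<open>|V*|, |V|\<close>, and
  complete positivity of \<open>P T\<close> controls the corner by the diagonal.\<close>
lemma F_line_one: assumes z: "Re z = 1" shows "cmod (F z) \<le> Mp * (nrm Z)\<^sup>2"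
proof -
  define y where "y = Im z"
  define v where "v = V (z - 1)"
  have zy: "z = 1 + \<i> * of_real y" using z by (simp add: y_def complex_eq_iff)
  have v: "v \<in> M" "nrm v = nrm Z" using nrm_V[of "z - 1"] z by (auto simp: v_def)
  have pv: "psd n (adj v * v)" using v by (intro psd_adj_mult)
  \<comment> \<open>In terms of the modulus, \<open>g = v |v|^(-1/2)\<close> and
    \<open>h = |v|^(1/2)\<close>. Their Gram block has corner \<open>v\<close>, and its diagonal
    blocks have the same Hilbert-Schmidt norm as \<open>v\<close>.\<close>
  define g h where "g = cc v (- 1/4)" and "h = pw (1/4) (adj v * v)"
  have gm: "g \<in> M" "h \<in> M" "adj h = h" using v pv by (auto simp: g_def h_def pw_adj)
  have gh: "g * adj h = v"
  proof -
    have "g * adj h = v * (pw (- 1/4) (adj v * v) * pw (1/4) (adj v * v))" unfolding gm(3) using v pv by (simp add: g_def h_def cc_def M_assoc)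
    also have "\<dots> = cc v 0" unfolding cc_def pw_mult[OF pv] by simp
    finally show ?thesis using v by (simp add: cc_zero)
  qed
  have half: "pw (1/2) (adj v * v) * pw (1/2) (adj v * v) = adj v * v" unfolding pw_mult[OF pv] using pw_1[OF pv] by simp
  have hh: "h * adj h = pw (1/2) (adj v * v)" unfolding gm(3) unfolding h_def pw_mult[OF pv] by simp
  have gg: "adj g * g = pw (1/2) (adj v * v)" unfolding g_def cc_gram[OF v(1)] by simp
  have nhh: "nrm (h * adj h) = nrm Z"
  proof -
    have "(nrm (h * adj h))\<^sup>2 = Re (tr (adj (h * adj h) * (h * adj h)))" using tr_adj_mult_self[of "h * adj h"] gm by (simp flip: of_real_power)
    also have "adj (h * adj h) * (h * adj h) = adj v * v" unfolding hh using half pv by (simp add: pw_adj)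
    finally show ?thesis using tr_adj_mult_self[of v] v by (simp flip: of_real_power)
  qed
  have ngg: "nrm (g * adj g) = nrm Z"
  proof -
    have "(nrm (g * adj g))\<^sup>2 = Re (tr (adj (g * adj g) * (g * adj g)))" using tr_adj_mult_self[of "g * adj g"] gm by (simp flip: of_real_power)
    also have "adj (g * adj g) * (g * adj g) = g * (adj g * g * adj g)" using gm by (simp add: adj_mult M_assoc)
    also have "tr (g * (adj g * g * adj g)) = tr (adj g * g * adj g * g)" using gm by (intro tr_comm) auto
    also have "\<dots> = tr ((adj g * g) * (adj g * g))" using gm by (simp add: M_assoc)
    also have "\<dots> = tr (adj v * v)" unfolding gg half ..
    finally show ?thesis using tr_adj_mult_self[of v] v by (simp flip: of_real_power)
  qed
  \<comment> \<open>\<open>Z^(1 + \<kappa> z)\<close> is split as \<open>K * U * K\<close> with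
    \<open>K\<close> positive and \<open>U\<close> unitary, so that each diagonal block sees only
    the real exponent \<open>1 + \<kappa>\<close> of \<open>psd_estimate\<close>.\<close>
  let ?K = "pw (of_real ((1 + \<kappa>) / 2)) Z" and ?U = "pw (\<i> * of_real (\<kappa> * y)) Z"
  define d where "d = Dp (of_real (- \<kappa>/4) - \<i> * of_real (\<kappa> * y / 4))"
  define d' where "d' = Dp (of_real (- \<kappa>/4) + \<i> * of_real (\<kappa> * y / 4))"
  have dd: "d \<in> M" "d' \<in> M" "adj d = d'" "adj d' = d"
    unfolding d_def d'_def Dp_adj by (simp_all, (rule arg_cong[of _ _ Dp], simp add: complex_eq_iff)+)
  have dz: "Dp (0 + of_real (- \<kappa>/4) * z) = d"
    unfolding d_def zy by (rule arg_cong[of _ _ Dp]) (simp add: complex_eq_iff)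
  have KU: "?K \<in> M" "?U \<in> M" "adj ?K = ?K" "adj ?U * ?U = 1\<^sub>m n" "adj ?U = pw (- (\<i> * of_real (\<kappa> * y))) Z"
    using Z_psd pw_0[OF Z] by (auto simp: pw_adj pw_mult)
  have KK: "?K * ?K = pw (of_real (1 + \<kappa>)) Z" unfolding pw_mult[OF Z_psd] by (simp flip: of_real_add)
  have KUK: "?K * (?U * ?K) = pw (1 + of_real \<kappa> * z) Z"
    unfolding pw_mult[OF Z_psd] zy by (rule arg_cong[of _ _ "\<lambda>x. pw x Z"]) (simp add: field_simps)
  \<comment> \<open>This phase makes the corner contribute \<open>- cmod (F z)\<close>.\<close>
  obtain \<omega> where om: "cmod \<omega> = 1" "\<omega> * F z = - of_real (cmod (F z))"
  proof (cases "F z = 0")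
    case True
    then show ?thesis using that[of 1] by simp
  next
    case False
    then show ?thesis using that[of "- cnj (F z) / of_real (cmod (F z))"]
      by (simp add: norm_divide cnj_mult_cmod power2_eq_square)
  qed
  \<comment> \<open>\<open>S\<close> and \<open>T'\<close> are read off from the corner term, whose
    trace must become \<open>\<omega> * F z\<close>. The diagonal terms then have the shape of
    \<open>psd_estimate\<close>, with \<open>\<eta>\<close> equal to \<open>\<kappa> y / 4\<close>
    and \<open>- (\<kappa> y / 4)\<close>.\<close>
  define S where "S = sp (1/4) * d' * ?K"
  define T' where "T' = \<omega> \<cdot>\<^sub>m (sp (1/4) * d * ?K * ?U)"
  have ST: "S \<in> M" "T' \<in> M" using dd KU by (auto simp: S_def T'_def)
  have adjS: "adj S = ?K * d * sp (1/4)" using dd KU by (simp add: S_def adj_mult sp_adj M_assoc)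
  have adjT: "adj T' = cnj \<omega> \<cdot>\<^sub>m (adj ?U * ?K * d' * sp (1/4))" using dd KU by (simp add: T'_def adj_smult adj_mult sp_adj M_assoc)
  \<comment> \<open>The powers of \<open>\<sigma>\<close> on the left turn each Gram product into
    its image under \<open>Gi\<close>, the argument that \<open>P T\<close> receives.\<close>
  let ?g = "sp (- (1/4)) * g" and ?h = "sp (- (1/4)) * h"
  have gi: "?g * adj ?g = Gi (g * adj g)" "?g * adj ?h = Gi (g * adj h)" "?h * adj ?h = Gi (h * adj h)"
    using gm(1,2) by (simp_all add: adj_mult sp_adj M_assoc)
  have u: "ucp n (P T)" using T P_ucp by simp
  have Pc: "P T (Gi X) \<in> M" if "X \<in> M" for X using that by simp
  have Phg: "P T (?h * adj ?g) = adj (P T (Gi v))" using ucp_block(1)[OF u, of ?g ?h] gm(1,2) unfolding gi gh by simp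
  have block: "0 \<le> Re (tr (adj S * P T (Gi (g * adj g)) * S) + tr (adj S * P T (Gi v) * T')
           + tr (adj T' * adj (P T (Gi v)) * S) + tr (adj T' * P T (Gi (h * adj h)) * T'))"
    using ucp_block(2)[OF u, of ?g ?h S T'] gm(1,2) ST unfolding Phg gi gh by simp
  have t2: "tr (adj S * P T (Gi v) * T') = - of_real (cmod (F z))"
  proof -
    have "adj S * P T (Gi v) * T' = \<omega> \<cdot>\<^sub>m (?K * (d * (G (P T (Gi v)) * (d * (?K * ?U)))))"
      unfolding adjS T'_def using dd KU Pc[OF v(1)] by (simp add: M_smult M_assoc)
    then have "tr (adj S * P T (Gi v) * T') = \<omega> * tr (?K * (d * (G (P T (Gi v)) * (d * (?K * ?U)))))"
      using dd KU Pc[OF v(1)] by (simp add: tr_smult)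
    also have "tr (?K * (d * (G (P T (Gi v)) * (d * (?K * ?U))))) = tr ((?K * (d * (G (P T (Gi v)) * d))) * (?K * ?U))"
      using dd KU Pc[OF v(1)] by (simp add: M_assoc)
    also have "\<dots> = tr ((?K * ?U) * (?K * (d * (G (P T (Gi v)) * d))))" using dd KU Pc[OF v(1)] by (intro tr_comm) auto
    also have "\<dots> = F z" unfolding F_def dz KUK[symmetric] using V_step[of "z - 1"] dd KU by (simp add: v_def M_assoc)
    finally show ?thesis using om by simp
  qed
  have t3: "tr (adj T' * adj (P T (Gi v)) * S) = - of_real (cmod (F z))"
  proof -
    have "tr (adj T' * adj (P T (Gi v)) * S) = cnj (tr (adj S * P T (Gi v) * T'))"
      using ST Pc[OF v(1)] by (subst tr_adj[symmetric]) (auto simp: adj_mult M_assoc)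
    then show ?thesis using t2 by simp
  qed
  have t1: "cmod (tr (adj S * P T (Gi (g * adj g)) * S)) \<le> nrm Z * (Mp * nrm Z)"
  proof -
    have "adj S * P T (Gi (g * adj g)) * S = (?K * (d * (G (P T (Gi (g * adj g))) * d'))) * ?K"
      unfolding adjS unfolding S_def using dd(1,2) KU(1) Pc[of "g * adj g"] gm(1) by (simp add: M_assoc)
    then have "tr (adj S * P T (Gi (g * adj g)) * S) = tr (?K * (?K * (d * (G (P T (Gi (g * adj g))) * d'))))"
      using dd KU gm tr_comm[of "?K * (d * (G (P T (Gi (g * adj g))) * d'))" ?K] by simp
    also have "\<dots> = tr (pw (of_real (1 + \<kappa>)) Z * d * G (P T (Gi (g * adj g))) * d')"
      unfolding KK[symmetric] using dd KU gm by (simp add: M_assoc)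
    finally show ?thesis
      using psd_estimate[OF p k hyp, of "g * adj g" "\<kappa> * y / 4"] psd_adj_mult[of "adj g"] gm ngg by (simp add: d_def d'_def)
  qed
  have t4: "cmod (tr (adj T' * P T (Gi (h * adj h)) * T')) \<le> nrm Z * (Mp * nrm Z)"
  proof -
    let ?Q = "?K * (d' * (G (P T (Gi (h * adj h))) * (d * ?K)))"
    have Q: "?Q \<in> M" using dd KU gm by simp
    have "adj T' * P T (Gi (h * adj h)) * T' = (\<omega> * cnj \<omega>) \<cdot>\<^sub>m (adj ?U * (?Q * ?U))"
      unfolding adjT unfolding T'_def using dd(1,2) KU(1,2) Pc[of "h * adj h"] gm(1,2) by (simp add: M_smult M_assoc mult.commute)
    also have "\<omega> * cnj \<omega> = 1" using om(1) by (simp add: cnj_mult_cmod)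
    finally have "tr (adj T' * P T (Gi (h * adj h)) * T') = tr (adj ?U * (?Q * ?U))"
      by (simp only: one_smult_M M_closed Q KU(2))
    also have "\<dots> = tr ((?Q * ?U) * adj ?U)" using Q KU(2) by (intro tr_comm) auto
    also have "\<dots> = tr (?Q * (?U * adj ?U))" using Q KU(2) by (simp add: M_assoc)
    also have "?U * adj ?U = 1\<^sub>m n" unfolding KU(5) pw_mult[OF Z_psd] using pw_0[OF Z] by simp
    also have "tr (?Q * 1\<^sub>m n) = tr ((?K * (d' * (G (P T (Gi (h * adj h))) * d))) * ?K)" using dd KU gm Q by (simp add: M_assoc)
    also have "\<dots> = tr (?K * (?K * (d' * (G (P T (Gi (h * adj h))) * d))))" using dd KU gm by (intro tr_comm) auto
    also have "\<dots> = tr (pw (of_real (1 + \<kappa>)) Z * d' * G (P T (Gi (h * adj h))) * d)"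
      unfolding KK[symmetric] using dd KU gm by (simp add: M_assoc)
    finally show ?thesis
      using psd_estimate[OF p k hyp, of "h * adj h" "- (\<kappa> * y / 4)"] psd_adj_mult[of "adj h"] gm nhh by (simp add: d_def d'_def)
  qed
  have "0 \<le> Re (tr (adj S * P T (Gi (g * adj g)) * S)) - 2 * cmod (F z) + Re (tr (adj T' * P T (Gi (h * adj h)) * T'))"
    using block unfolding t2 t3 by simp
  also have "\<dots> \<le> 2 * (Mp * (nrm Z)\<^sup>2) - 2 * cmod (F z)"
    using t1 t4 complex_Re_le_cmod[of "tr (adj S * P T (Gi (g * adj g)) * S)"] complex_Re_le_cmod[of "tr (adj T' * P T (Gi (h * adj h)) * T')"]
    by (simp add: power2_eq_square mult_ac)
  finally show ?thesis by simp
qed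

lemma F_bound: assumes "0 < \<theta>" "\<theta> < 1" shows "cmod (F (of_real \<theta>)) \<le> (nrm Z)\<^sup>2 * Mp powr \<theta>"
proof -
  have "cmod (F (of_real \<theta>)) \<le> ((nrm Z)\<^sup>2) powr (1 - \<theta>) * (Mp * (nrm Z)\<^sup>2) powr \<theta>"
    by (rule three_lines[OF F_strip _ _ F_line_zero F_line_one]) (use Mp assms in auto)
  also have "\<dots> = ((nrm Z)\<^sup>2 powr (1 - \<theta>) * (nrm Z)\<^sup>2 powr \<theta>) * Mp powr \<theta>" using Mp by (simp add: powr_mult mult_ac)
  also have "(nrm Z)\<^sup>2 powr (1 - \<theta>) * (nrm Z)\<^sup>2 powr \<theta> = (nrm Z)\<^sup>2" by (simp flip: powr_add)
  finally show ?thesis .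
qed

lemma mln_closed [simp]: "psd n A \<Longrightarrow> mln A \<in> M"
  by (simp add: mln_def mfun_cfun psdD)

lemma F_0: "F 0 = of_real ((nrm Z)\<^sup>2)"
  using tr_adj_mult_self[OF Z_M] Z_psd by (simp add: F_def V_def W_one Dp_0 pw_1)

text \<open>Product rule at 0, where both \<open>Dp\<close> factors are the identity. By cyclicity
  they contribute equally, which doubles \<open>-\<kappa>/4\<close> to the coefficient
  \<open>-\<kappa>/2\<close> of the two logarithms.\<close>

lemma F_deriv:
  "(F has_field_derivative (of_real \<kappa> * tr (Z * Z * (mln Z - (1/2) \<cdot>\<^sub>m mln R - (1/2) \<cdot>\<^sub>m mln \<sigma>)) + of_real T * tr (Z * Lam Z))) (at 0)"
proof -
  have m: "mln Z \<in> M" "mln R \<in> M" "mln \<sigma> \<in> M" "Lam Z \<in> M"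
    using Z_psd R_psd sigma_psd lin_closed[OF Lam_lin Z_M] by auto
  let ?K = "of_real \<kappa> \<cdot>\<^sub>m (Z * mln Z)" and ?D = "of_real (- \<kappa>/4) \<cdot>\<^sub>m (mln \<sigma> + mln R)"
  have dK: "mderiv (\<lambda>z. pw (1 + of_real \<kappa> * z) Z) ?K" using mderiv_pw[OF Z, of 1 \<kappa>] pw_1[OF Z_psd] by simp
  have dD: "mderiv (\<lambda>z. Dp (0 + of_real (- \<kappa>/4) * z)) ?D"
  proof -
    have "mderiv (\<lambda>z. Dp (0 + of_real (- \<kappa>/4) * z)) (of_real (- \<kappa>/4) \<cdot>\<^sub>m (sp 0 * mln \<sigma>) * rp (0 + of_real (- \<kappa>/4) * 0)
       + sp (0 + of_real (- \<kappa>/4) * 0) * (of_real (- \<kappa>/4) \<cdot>\<^sub>m (rp 0 * mln R)))"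
      unfolding Dp_def by (intro mderiv_mult mderiv_pw sigma_pd n_pos R_pd)
    also have "of_real (- \<kappa>/4) \<cdot>\<^sub>m (sp 0 * mln \<sigma>) * rp (0 + of_real (- \<kappa>/4) * 0)
       + sp (0 + of_real (- \<kappa>/4) * 0) * (of_real (- \<kappa>/4) \<cdot>\<^sub>m (rp 0 * mln R)) = ?D"
      using m by (simp add: rp_0) (intro M_eqI; simp add: add_ij smult_ij algebra_simps)
    finally show ?thesis .
  qed
  have dV: "mderiv V (of_real T \<cdot>\<^sub>m Lam Z)" unfolding V_def[abs_def] by (rule mderiv_W) simp
  have V0: "V 0 = Z" by (simp add: V_def W_one)
  have m': "?K \<in> M" "?D \<in> M" using m by auto
  have "(F has_field_derivative tr (((?K * 1\<^sub>m n + Z * ?D) * Z + (Z * 1\<^sub>m n) * (of_real T \<cdot>\<^sub>m Lam Z)) * 1\<^sub>m n + ((Z * 1\<^sub>m n) * Z) * ?D)) (at 0)"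
    using mderiv_tr[OF mderiv_mult[OF mderiv_mult[OF mderiv_mult[OF dK dD] dV] dD]] pw_1[OF Z_psd] Dp_0 V0
    unfolding F_def[abs_def] by simp
  also have "tr (((?K * 1\<^sub>m n + Z * ?D) * Z + (Z * 1\<^sub>m n) * (of_real T \<cdot>\<^sub>m Lam Z)) * 1\<^sub>m n + ((Z * 1\<^sub>m n) * Z) * ?D)
    = of_real \<kappa> * tr (Z * mln Z * Z) + tr (Z * ?D * Z) + of_real T * tr (Z * Lam Z) + tr (Z * Z * ?D)"
    using m m' by (simp add: M_distrib M_smult tr_add tr_smult M_assoc)
  also have "tr (Z * mln Z * Z) = tr (Z * Z * mln Z)" using m tr_comm[of "Z * mln Z" Z] by (simp add: M_assoc)
  also have "tr (Z * ?D * Z) = tr (Z * Z * ?D)" using m' tr_comm[of "Z * ?D" Z] by (simp add: M_assoc)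
  also have "of_real \<kappa> * tr (Z * Z * mln Z) + tr (Z * Z * ?D) + of_real T * tr (Z * Lam Z) + tr (Z * Z * ?D)
    = of_real \<kappa> * tr (Z * Z * (mln Z - (1/2) \<cdot>\<^sub>m mln R - (1/2) \<cdot>\<^sub>m mln \<sigma>)) + of_real T * tr (Z * Lam Z)"
    using m by (simp add: M_distrib M_smult tr_add tr_minus tr_smult algebra_simps)
  finally show ?thesis .
qed

text \<open>\<open>\<phi>\<close> vanishes at 0 and is nonnegative on the open unit interval, so its
  derivative at 0 is nonnegative; that derivative is the right side minus the left.\<close>

lemma entropy_bound:
  "\<kappa> * Re (tr (Z * Z * (mln Z - (1/2) \<cdot>\<^sub>m mln R - (1/2) \<cdot>\<^sub>m mln \<sigma>))) + T * Re (tr (Z * Lam Z)) \<le> (nrm Z)\<^sup>2 * ln Mp"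
proof -
  let ?D = "of_real \<kappa> * tr (Z * Z * (mln Z - (1/2) \<cdot>\<^sub>m mln R - (1/2) \<cdot>\<^sub>m mln \<sigma>)) + of_real T * tr (Z * Lam Z)"
  define \<phi> where "\<phi> t = (nrm Z)\<^sup>2 * Mp powr t - Re (F (of_real t))" for t
  have "((\<lambda>t. Re (F (of_real t))) has_real_derivative Re ?D) (at 0)"
  proof -
    have "(F has_field_derivative ?D) (at (of_real 0))" using F_deriv by simp
    then have "((\<lambda>t. F (of_real t)) has_vector_derivative ?D) (at 0)" by (rule has_vector_derivative_real_field)
    then have "((\<lambda>t. Re (F (of_real t))) has_vector_derivative Re ?D) (at 0)" 
      by (rule bounded_linear.has_vector_derivative[OF bounded_linear_Re])
    then show ?thesis by (simp add: has_real_derivative_iff_has_vector_derivative)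
  qed
  moreover have "((\<lambda>t. (nrm Z)\<^sup>2 * Mp powr t) has_real_derivative (nrm Z)\<^sup>2 * ln Mp) (at 0)"
    using Mp by (auto intro!: derivative_eq_intros)
  ultimately have "(\<phi> has_real_derivative (nrm Z)\<^sup>2 * ln Mp - Re ?D) (at 0)"
    unfolding \<phi>_def by (intro DERIV_diff)
  moreover have "\<phi> 0 = 0" using Mp F_0 by (simp add: \<phi>_def)
  moreover have "0 \<le> \<phi> t" if "0 < t" "t < 1" for t
    using F_bound[OF that] complex_Re_le_cmod[of "F (of_real t)"] by (simp add: \<phi>_def)
  ultimately have "0 \<le> (nrm Z)\<^sup>2 * ln Mp - Re ?D" by (rule nonneg_right_imp_deriv_nonneg)
  then show ?thesis by simp
qed

end

end

theorem theorem4p7: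
  fixes n :: nat and L :: "complex mat \<Rightarrow> complex mat"
    and p :: ereal and tp Mp :: real
  assumes "0 < n"
    and "qms n L" and "decohering n L" and "reversible n L"
    and "2 < p" and "0 < tp" and "0 < Mp"
    and "\<forall>X. psd n X \<longrightarrow> abnorm n L 2 p (sg L tp X) \<le> Mp * wnorm n L 2 X"
  shows "LSI2 n L (pfac p * tp) (pfac p * ln Mp)"
proof -
  obtain \<rho> where rho: "pd n \<rho>" "\<forall>t\<ge>0. \<forall>X\<in>carrier_mat n n. tr (\<rho> * sg L t X) = tr (\<rho> * X)"
    using assms(3) by (auto simp: decohering_def)
  interpret rev n L \<rho>
    by unfold_locales (use assms rho in \<open>auto simp: qms_def\<close>)
  have "\<exists>e l. eigbasis n Lam e l"
  proof (rule superop_spectral[OF Lam_lin])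
    show "tr (adj A * Lam B) = tr (adj (Lam A) * B)" if "A \<in> M" "B \<in> M" for A B
      using Lam_sym that .
    fix e l
    assume "\<And>m. e m \<in> M"
      "\<And>m k. m < n * n \<Longrightarrow> k < n * n \<Longrightarrow> tr (adj (e m) * e k) = (if m = k then 1 else 0)"
      "\<And>Z i j. Z \<in> M \<Longrightarrow> i < n \<Longrightarrow> j < n \<Longrightarrow> Z $$ (i,j) = (\<Sum>m<n * n. tr (adj (e m) * Z) * e m $$ (i,j))"
      "\<And>m. m < n * n \<Longrightarrow> Lam (e m) = of_real (l m) \<cdot>\<^sub>m e m"
    then have "eigbasis n Lam e l" by (intro eigbasis.intro Lam_lin Lam_sym)
    then show "\<exists>e l. eigbasis n Lam e l" by blast
  qed
  then obtain e l where el: "eigbasis n Lam e l" by blast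
  interpret reveig n L \<rho> e l by (intro reveig.intro reveig_axioms.intro rev_axioms el)
  define \<kappa> where "\<kappa> = 1 - 2 * einv p"
  \<comment> \<open>For finite \<open>p\<close> this is \<open>p/(p-2) = 1/(1 - 2/p)\<close>; at
    \<open>p = \<infinity>\<close> both sides are 1, in accordance with the convention.\<close>
  have k: "0 < \<kappa>" "pfac p = 1 / \<kappa>"
    using assms(5) unfolding \<kappa>_def by (cases p; auto simp: einv_def pfac_def field_simps)+
  show ?thesis unfolding LSI2_def
  proof (intro allI impI)
    fix X assume X: "pd n X"
    have x: "X \<in> M" "adj X = X" using X pdD psdD by auto
    define Z where "Z = G X"
    have "pd n (adj (sp (1/4)) * X * sp (1/4))"
      by (rule pd_conj[OF X, where C = "sp (- (1/4))"]) (auto simp: sp_mult)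
    then have Z: "pd n Z" by (simp add: Z_def sp_adj)
    interpret reveigZ n L \<rho> e l Z by unfold_locales (rule Z)
    have "\<kappa> * ent2 n L X - tp * dirichlet2 n L X \<le> (nrm Z)\<^sup>2 * ln Mp"
    proof -
      have "ent2 n L X = Re (tr (Z * Z * (mln Z - (1/2) \<cdot>\<^sub>m mln R - (1/2) \<cdot>\<^sub>m mln \<sigma>)))"
        using sigma_psd by (simp add: ent2_def Let_def Gam_sp mpow_pw R_def Z_def[symmetric])
      moreover have "dirichlet2 n L X = - Re (tr (Z * Lam Z))"
        using winner_Gi_left[of Z "L X"] x Gi_G[OF x(1)] by (simp add: dirichlet2_def Lam_def Z_def[symmetric])
      ultimately show ?thesis
        using entropy_bound[OF assms(5) \<kappa>_def assms(6,7,8)] by simp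
    qed
    then have "ent2 n L X \<le> (tp * dirichlet2 n L X + (nrm Z)\<^sup>2 * ln Mp) / \<kappa>"
      using k(1) by (simp add: pos_le_divide_eq mult.commute)
    moreover have "wnorm n L 2 X = nrm Z" unfolding Z_def by (rule wnorm_2[OF x(1)])
    ultimately show "ent2 n L X \<le> pfac p * tp * dirichlet2 n L X + pfac p * ln Mp * (wnorm n L 2 X)\<^sup>2"
      unfolding k(2) by (simp add: add_divide_distrib mult_ac)
  qed
qed

end
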